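(* Let $k$ be a positive integer and let $\gamma:\mathcal G_k\to\mathbb R$. Define $\lambda(G)=\binom nk^{-1}\sum_{X\in\binom{V}{k}}\gamma(G[X])$ for every graph $G=(V,E)$ with $n=|V|$ vertices, and let $\lambda(n)=\max\{\lambda(G):v(G)=n\}$. Suppose that $\lambda$ is symmetrisable and that $\mathrm{OPT}(\lambda)$ is finite. Then $\lambda$ is perfectly stable if it is strict.
   Context: $\mathcal G_k$ is the set of graphs on $k$ vertices up to isomorphism. Let $\Lambda(G)=\sum_{X}\gamma(G[X])$ (over $k$-subsets $X$), $\Lambda(G,x)=\sum_{X\ni x}\gamma(G[X])$, $\lambda(G,x)=\binom{n-1}{k-1}^{-1}\Lambda(G,x)$; $G\oplus xy$ is $G$ with the adjacency of the pair $xy$ flipped. A graph is complete partite if its vertex set is partitioned into independent sets (parts) with all edges between distinct parts. Symmetrisable: for every $\varepsilon>0$ there is $n_0$ such that for every graph $G=(V,E)$ of order $n\ge n_0$: (Sym1) there are graphs $G_0=G,\ldots,G_m$ on $V$ with $G_m$ complete partite, and for every $i\in[m]$, $\lambda(G_{i-1})\le\lambda(G_i)$ and $|E(G_{i-1})\triangle E(G_i)|<\varepsilon\binom n2$; (Sym2) if $z\in V$ and $G-z$ is complete partite with parts $V_1,\ldots,V_t$, there are graphs $G_0=G,\ldots,G_m$ on $V$ with $G_i-z=G-z$, $\lambda(G_{i-1})\le\lambda(G_i)$, $|E(G_{i-1})\triangle E(G_i)|\le\varepsilon(n-1)$ for all $i\in[m]$, and for each $j$ either $N_{G_m}(z)\supseteq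 V_j$ or $N_{G_m}(z)\cap V_j=\emptyset$. Perfectly stable: there is $C>0$ such that every graph $G$ of order $n\ge C$ admits a complete partite $H$ of order $n$ with $\hat\delta_1(G,H)\le C(\lambda(n)-\lambda(G))$, where $\hat\delta_1(G,H)=\frac2{n^2}\min_\sigma|E(H)\triangle E(\sigma(G))|$ over bijections $\sigma:V(G)\to V(H)$. Partite limits: $\overline{\mathcal P}=\{\mathbf x=(x_1,x_2,\ldots):x_1\ge x_2\ge\cdots\ge0,\ \sum_{i\ge1}x_i\le1\}$, $x_0:=1-\sum_{i\ge1}x_i$, $\mathrm{supp}^*(\mathbf x)=\{i\ge1:x_i>0\}\cup\{0\text{ if }x_0>0\}$. The realisation $G_{n,\mathbf x}$ is the complete partite graph on $[n]$ with parts $V_1,\ldots,V_m$ plus a set $V_0$ of universal vertices: if $x_0=0$, $[n]=V_1\cup\dots\cup V_m$ with $||V_i|-x_in|<1$, $V_0=\emptyset$; otherwise $|V_i|=\lfloor x_in\rfloor$ for each $i\ge1$ with $x_in\ge2$, and $V_0$ is the rest. Set $\lambda(\mathbf x)=\lim_n\lambda(G_{n,\mathbf x})$ (the limit exists), $\lambda_{\max}=\max_{\mathbf x\in\overline{\mathcal P}}\lambda(\mathbf x)$, and $\mathrm{OPT}(\lambda)=\{\mathbf x\in\overline{\mathcal P}:\lambda(\mathbf x)=\lambda_{\max}\}$. For an $n$-vertex $G$ and pair $x,y$: $\nabla^{\bullet\bullet}_{xy}\lambda(G)=\binom{n-2}{k-2}^{-1}(\Lambda(G)-\Lambda(G\oplus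 xy))$; for $i_1,i_2\in\mathrm{supp}^*(\mathbf x)$, $\nabla^{\bullet\bullet}_{i_1i_2}\lambda(\mathbf x)=\lim_n\nabla^{\bullet\bullet}_{v_1v_2}\lambda(G_{n,\mathbf x})$ with $v_1\in V_{i_1}$, $v_2\in V_{i_2}$ distinct. For $i\in\mathbb N_0$, $e_i:\mathbb N\to\{0,1\}$ has $e_i(j)=0$ iff $j=i$. For $b:\mathbb N\to\{0,1\}$, $\alpha\in[0,1]$ and $G$ with structure $V_0,\ldots,V_m$, $G+_{b,\alpha}u$ adds a new vertex $u$ joined to all of $V_i$ ($i\ge1$) if $b(i)=1$ and to none of it otherwise, and to $\lfloor\alpha|V_0|\rfloor$ vertices of $V_0$ (convention $\alpha=1$ if $x_0=0$). $\nabla^{\bullet}_{b,\alpha}\lambda(G)=\binom{n}{k-1}^{-1}(\Lambda(G+_{e_1,1}u)-\Lambda(G+_{b,\alpha}u))$ and $\nabla^\bullet_{b,\alpha}\lambda(\mathbf x)=\lim_n\nabla^\bullet_{b,\alpha}\lambda(G_{n,\mathbf x})$. Strict: there is $c>0$ such that for each $\mathbf x\in\mathrm{OPT}$: (Str1) $\nabla^{\bullet\bullet}_{i_1i_2}\lambda(\mathbf x)\ge c$ for all $i_1,i_2\in\mathrm{supp}^*(\mathbf x)$; (Str2) $\nabla^\bullet_{b,\alpha}\lambda(\mathbf x)\ge c\big((1-\alpha)x_0+\min_{i\in\mathrm{supp}^*(\mathbf x)}w_i\big)$ for all $b,\alpha$, where $w_i=\mathbb 1_{i>0}b(i)x_i+\sum_{j\in\mathrm{supp}^*(\mathbf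 x)\setminus\{0,i\}}(1-b(j))x_j$. *)

theory Defs
  imports "HOL-Analysis.Analysis"
begin

section \<open>Graphs\<close>

text \<open>A finite simple graph is a pair of a finite vertex set and a set of two-element subsets of it.
  Up to isomorphism nothing is lost by drawing the vertices from the natural numbers.\<close>

type_synonym graph = "nat set \<times> nat set set"

abbreviation verts :: "graph \<Rightarrow> nat set" where "verts G \<equiv> fst G"
abbreviation edges :: "graph \<Rightarrow> nat set set" where "edges G \<equiv> snd G"
abbreviation order :: "graph \<Rightarrow> nat" where "order G \<equiv> card (verts G)"

definition fin_graph :: "graph \<Rightarrow> bool" where
  "fin_graph G \<longleftrightarrow> finite (verts G) \<and> edges G \<subseteq> {e. e \<subseteq> verts G \<and> card e = 2}"

definition graph_image :: "(nat \<Rightarrow> nat) \<Rightarrow> graph \<Rightarrow> graph" where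
  "graph_image \<sigma> G = (\<sigma> ` verts G, (`) \<sigma> ` edges G)"

definition graph_iso :: "graph \<Rightarrow> graph \<Rightarrow> bool" where
  "graph_iso G H \<longleftrightarrow> (\<exists>\<sigma>. inj_on \<sigma> (verts G) \<and> H = graph_image \<sigma> G)"

definition induced :: "graph \<Rightarrow> nat set \<Rightarrow> graph" where
  "induced G X = (X, {e \<in> edges G. e \<subseteq> X})"

definition del_vertex :: "graph \<Rightarrow> nat \<Rightarrow> graph" where
  "del_vertex G z = induced G (verts G - {z})"

definition neighbours :: "graph \<Rightarrow> nat \<Rightarrow> nat set" where
  "neighbours G z = {v \<in> verts G. {z, v} \<in> edges G}"

definition flip_pair :: "graph \<Rightarrow> nat \<Rightarrow> nat \<Rightarrow> graph" where
  "flip_pair G x y = (verts G, sym_diff (edges G) {{x, y}})"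

definition complete_partite_on :: "graph \<Rightarrow> nat set set \<Rightarrow> bool" where
  "complete_partite_on G \<P> \<longleftrightarrow> fin_graph G \<and> partition_on (verts G) \<P> \<and>
     edges G = {{x, y} | x y. \<exists>A\<in>\<P>. \<exists>B\<in>\<P>. A \<noteq> B \<and> x \<in> A \<and> y \<in> B}"

definition complete_partite :: "graph \<Rightarrow> bool" where
  "complete_partite G \<longleftrightarrow> (\<exists>\<P>. complete_partite_on G \<P>)"


section \<open>The graph parameter\<close>

text \<open>A function on the set of isomorphism classes of graphs with \<open>k\<close> vertices is represented by a
  function on graphs that is isomorphism invariant on the graphs of order \<open>k\<close>; its values on other
  arguments are never used.\<close>

definition iso_invariant :: "nat \<Rightarrow> (graph \<Rightarrow> real) \<Rightarrow> bool" where
  "iso_invariant k \<gamma> \<longleftrightarrow>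
     (\<forall>G H. fin_graph G \<and> fin_graph H \<and> order G = k \<and> graph_iso G H \<longrightarrow> \<gamma> G = \<gamma> H)"

definition Lambda :: "nat \<Rightarrow> (graph \<Rightarrow> real) \<Rightarrow> graph \<Rightarrow> real" where
  "Lambda k \<gamma> G = (\<Sum>X | X \<subseteq> verts G \<and> card X = k. \<gamma> (induced G X))"

definition lam :: "nat \<Rightarrow> (graph \<Rightarrow> real) \<Rightarrow> graph \<Rightarrow> real" where
  "lam k \<gamma> G = Lambda k \<gamma> G / real (order G choose k)"

text \<open>For isomorphism invariant \<open>\<gamma>\<close> the set below is finite, since \<open>lam\<close> is then
  isomorphism invariant as well.\<close>

definition lam_ext :: "nat \<Rightarrow> (graph \<Rightarrow> real) \<Rightarrow> nat \<Rightarrow> real" where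
  "lam_ext k \<gamma> n = Max {lam k \<gamma> G | G. fin_graph G \<and> order G = n}"


section \<open>Symmetrisability and perfect stability\<close>

definition sym1 :: "nat \<Rightarrow> (graph \<Rightarrow> real) \<Rightarrow> real \<Rightarrow> graph \<Rightarrow> bool" where
  "sym1 k \<gamma> \<epsilon> G \<longleftrightarrow>
     (\<exists>(m::nat) Gs. Gs 0 = G \<and> complete_partite (Gs m) \<and>
        (\<forall>i\<le>m. fin_graph (Gs i) \<and> verts (Gs i) = verts G) \<and>
        (\<forall>i\<in>{1..m}. lam k \<gamma> (Gs (i - 1)) \<le> lam k \<gamma> (Gs i) \<and>
           real (card (sym_diff (edges (Gs (i - 1))) (edges (Gs i))))
             < \<epsilon> * real (order G choose 2)))"

definition sym2 :: "nat \<Rightarrow> (graph \<Rightarrow> real) \<Rightarrow> real \<Rightarrow> graph \<Rightarrow> bool" where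
  "sym2 k \<gamma> \<epsilon> G \<longleftrightarrow>
     (\<forall>z\<in>verts G. \<forall>\<P>. complete_partite_on (del_vertex G z) \<P> \<longrightarrow>
        (\<exists>(m::nat) Gs. Gs 0 = G \<and>
           (\<forall>i\<le>m. fin_graph (Gs i) \<and> verts (Gs i) = verts G) \<and>
           (\<forall>i\<in>{1..m}. del_vertex (Gs i) z = del_vertex G z \<and>
              lam k \<gamma> (Gs (i - 1)) \<le> lam k \<gamma> (Gs i) \<and>
              real (card (sym_diff (edges (Gs (i - 1))) (edges (Gs i))))
                \<le> \<epsilon> * (real (order G) - 1)) \<and>
           (\<forall>A\<in>\<P>. A \<subseteq> neighbours (Gs m) z \<or> neighbours (Gs m) z \<inter> A = {})))"

definition symmetrisable :: "nat \<Rightarrow> (graph \<Rightarrow> real) \<Rightarrow> bool" where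
  "symmetrisable k \<gamma> \<longleftrightarrow>
     (\<forall>\<epsilon>>0. \<exists>n0. \<forall>G. fin_graph G \<and> order G \<ge> n0 \<longrightarrow> sym1 k \<gamma> \<epsilon> G \<and> sym2 k \<gamma> \<epsilon> G)"

text \<open>Edit distance between graphs of the same order, normalised by \<open>2 / n\<^sup>2\<close>.\<close>

definition delta1 :: "graph \<Rightarrow> graph \<Rightarrow> real" where
  "delta1 G H = 2 / (real (order G))\<^sup>2 *
     real (Min {card (sym_diff (edges H) (edges (graph_image \<sigma> G))) | \<sigma>.
                  bij_betw \<sigma> (verts G) (verts H)})"

definition perfectly_stable :: "nat \<Rightarrow> (graph \<Rightarrow> real) \<Rightarrow> bool" where
  "perfectly_stable k \<gamma> \<longleftrightarrow>
     (\<exists>C>0. \<forall>G. fin_graph G \<and> real (order G) \<ge> C \<longrightarrow>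
        (\<exists>H. complete_partite H \<and> order H = order G \<and>
           delta1 G H \<le> C * (lam_ext k \<gamma> (order G) - lam k \<gamma> G)))"


section \<open>Partite limits and their realisations\<close>

text \<open>A limit \<open>(x\<^sub>1, x\<^sub>2, \<dots>)\<close> is stored together with \<open>x\<^sub>0 = 1 - \<Sum>i\<ge>1. x\<^sub>i\<close> as a sequence on
  the natural numbers; since the entry at \<open>0\<close> is determined by the others, this is a bijective
  encoding.\<close>

definition partite_limits :: "(nat \<Rightarrow> real) set" where
  "partite_limits =
     {x. (\<forall>i\<ge>1. 0 \<le> x i \<and> x (Suc i) \<le> x i) \<and> (x has_sum (1 - x 0)) {1..} \<and> 1 - x 0 \<le> 1}"

definition supp :: "(nat \<Rightarrow> real) \<Rightarrow> nat set" where
  "supp x = {i. x i > 0}"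

text \<open>A structured graph is given by a family \<open>P\<close> of pairwise disjoint sets: the sets \<open>P i\<close> with
  \<open>i \<ge> 1\<close> are the (possibly empty) parts, and \<open>P 0\<close> consists of universal vertices.\<close>

definition partite_graph :: "(nat \<Rightarrow> nat set) \<Rightarrow> graph" where
  "partite_graph P =
     (\<Union>i. P i, {{u, v} | u v. u \<noteq> v \<and> (\<exists>i j. u \<in> P i \<and> v \<in> P j \<and> (i \<noteq> j \<or> i = 0))})"

definition is_realisation :: "nat \<Rightarrow> (nat \<Rightarrow> real) \<Rightarrow> (nat \<Rightarrow> nat set) \<Rightarrow> bool" where
  "is_realisation n x P \<longleftrightarrow>
     disjoint_family P \<and> (\<Union>i. P i) = {1..n} \<and>
     (if x 0 = 0
      then P 0 = {} \<and> (\<forall>i\<ge>1. \<bar>real (card (P i)) - x i * real n\<bar> < 1)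
      else (\<forall>i\<ge>1. card (P i) = (if x i * real n \<ge> 2 then nat \<lfloor>x i * real n\<rfloor> else 0)))"

text \<open>The defining conditions determine the realisation up to isomorphism if \<open>x\<^sub>0 > 0\<close>, and up to
  rounding of the part sizes if \<open>x\<^sub>0 = 0\<close>; an arbitrary one is chosen. None of the limits below
  depends on the choice.\<close>

definition realisation :: "nat \<Rightarrow> (nat \<Rightarrow> real) \<Rightarrow> nat \<Rightarrow> nat set" where
  "realisation n x = (SOME P. is_realisation n x P)"

definition lam_lim :: "nat \<Rightarrow> (graph \<Rightarrow> real) \<Rightarrow> (nat \<Rightarrow> real) \<Rightarrow> real" where
  "lam_lim k \<gamma> x = lim (\<lambda>n. lam k \<gamma> (partite_graph (realisation n x)))"

text \<open>The maximum over all partite limits; it is attained, so that it is the supremum.\<close>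

definition lam_max :: "nat \<Rightarrow> (graph \<Rightarrow> real) \<Rightarrow> real" where
  "lam_max k \<gamma> = (SUP x\<in>partite_limits. lam_lim k \<gamma> x)"

definition OPT :: "nat \<Rightarrow> (graph \<Rightarrow> real) \<Rightarrow> (nat \<Rightarrow> real) set" where
  "OPT k \<gamma> = {x \<in> partite_limits. lam_lim k \<gamma> x = lam_max k \<gamma>}"


section \<open>Strictness\<close>

text \<open>For \<open>k = 1\<close> the numerator below is \<open>0\<close>, so the truncated subtraction \<open>k - 2\<close> is harmless.\<close>

definition nabla_pair :: "nat \<Rightarrow> (graph \<Rightarrow> real) \<Rightarrow> graph \<Rightarrow> nat \<Rightarrow> nat \<Rightarrow> real" where
  "nabla_pair k \<gamma> G x y =
     (Lambda k \<gamma> G - Lambda k \<gamma> (flip_pair G x y)) / real ((order G - 2) choose (k - 2))"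

text \<open>By symmetry of the parts the choice of the pair is immaterial. If \<open>i1, i2 \<in> supp x\<close>, a
  suitable pair exists for all large \<open>n\<close>.\<close>

definition nabla_pair_lim ::
    "nat \<Rightarrow> (graph \<Rightarrow> real) \<Rightarrow> (nat \<Rightarrow> real) \<Rightarrow> nat \<Rightarrow> nat \<Rightarrow> real" where
  "nabla_pair_lim k \<gamma> x i1 i2 =
     lim (\<lambda>n. let P = realisation n x;
                  p = (SOME p. fst p \<in> P i1 \<and> snd p \<in> P i2 \<and> fst p \<noteq> snd p)
              in nabla_pair k \<gamma> (partite_graph P) (fst p) (snd p))"

definition e_vec :: "nat \<Rightarrow> nat \<Rightarrow> bool" where
  "e_vec i j \<longleftrightarrow> j \<noteq> i"

text \<open>The structured graph \<open>P\<close> with a new vertex \<open>u\<close>. Zero-one vectors are predicates, whose value at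
  \<open>0\<close> is never used. The \<open>\<lfloor>\<alpha> |P 0|\<rfloor>\<close> neighbours inside \<open>P 0\<close> are chosen arbitrarily; the result is
  unique up to isomorphism.\<close>

definition add_vertex :: "(nat \<Rightarrow> nat set) \<Rightarrow> (nat \<Rightarrow> bool) \<Rightarrow> real \<Rightarrow> nat \<Rightarrow> graph" where
  "add_vertex P b \<alpha> u =
     (let A = (SOME A. A \<subseteq> P 0 \<and> card A = nat \<lfloor>\<alpha> * real (card (P 0))\<rfloor>);
          N = (\<Union>i\<in>{i. i \<ge> 1 \<and> b i}. P i) \<union> A
      in (insert u (verts (partite_graph P)),
          edges (partite_graph P) \<union> {{u, v} | v. v \<in> N}))"

definition nabla_vertex ::
    "nat \<Rightarrow> (graph \<Rightarrow> real) \<Rightarrow> (nat \<Rightarrow> bool) \<Rightarrow> real \<Rightarrow> (nat \<Rightarrow> nat set) \<Rightarrow> real" where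
  "nabla_vertex k \<gamma> b \<alpha> P =
     (let u = (SOME u. u \<notin> verts (partite_graph P))
      in (Lambda k \<gamma> (add_vertex P (e_vec 1) 1 u) - Lambda k \<gamma> (add_vertex P b \<alpha> u))
           / real (order (partite_graph P) choose (k - 1)))"

definition nabla_vertex_lim ::
    "nat \<Rightarrow> (graph \<Rightarrow> real) \<Rightarrow> (nat \<Rightarrow> bool) \<Rightarrow> real \<Rightarrow> (nat \<Rightarrow> real) \<Rightarrow> real" where
  "nabla_vertex_lim k \<gamma> b \<alpha> x = lim (\<lambda>n. nabla_vertex k \<gamma> b \<alpha> (realisation n x))"

definition str_weight :: "(nat \<Rightarrow> real) \<Rightarrow> (nat \<Rightarrow> bool) \<Rightarrow> nat \<Rightarrow> real" where
  "str_weight x b i =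
     of_bool (i > 0) * of_bool (b i) * x i
     + (\<Sum>\<^sub>\<infinity>j\<in>supp x - {0, i}. (1 - of_bool (b j)) * x j)"

definition str1 :: "nat \<Rightarrow> (graph \<Rightarrow> real) \<Rightarrow> real \<Rightarrow> (nat \<Rightarrow> real) \<Rightarrow> bool" where
  "str1 k \<gamma> c x \<longleftrightarrow> (\<forall>i1\<in>supp x. \<forall>i2\<in>supp x. nabla_pair_lim k \<gamma> x i1 i2 \<ge> c)"

text \<open>The infimum below is the minimum whenever the latter exists, in particular for finite
  support. By convention \<open>\<alpha> = 1\<close> if \<open>x\<^sub>0 = 0\<close>.\<close>

definition str2 :: "nat \<Rightarrow> (graph \<Rightarrow> real) \<Rightarrow> real \<Rightarrow> (nat \<Rightarrow> real) \<Rightarrow> bool" where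
  "str2 k \<gamma> c x \<longleftrightarrow>
     (\<forall>b \<alpha>. 0 \<le> \<alpha> \<and> \<alpha> \<le> 1 \<and> (x 0 = 0 \<longrightarrow> \<alpha> = 1) \<longrightarrow>
        nabla_vertex_lim k \<gamma> b \<alpha> x
          \<ge> c * ((1 - \<alpha>) * x 0 + (INF i\<in>supp x. str_weight x b i)))"

definition strict_param :: "nat \<Rightarrow> (graph \<Rightarrow> real) \<Rightarrow> bool" where
  "strict_param k \<gamma> \<longleftrightarrow> (\<exists>c>0. \<forall>x\<in>OPT k \<gamma>. str1 k \<gamma> c x \<and> str2 k \<gamma> c x)"

end

theory Submission
  imports Defs "HOL-Library.Diagonal_Subsequence"
begin

text \<open>Let \<open>G\<close> be close to the realisation of an optimal limit \<open>x\<close>. Vertices whose neighbourhood is far from that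
  of every part are replaced, one at a time, by clones of a fixed part; by (Sym2) and (Str2) each
  replacement gains a constant times \<open>n\<^sup>k / n\<close>. Afterwards all vertices have small degree in the graph of
  wrong pairs, so that by (Str1) every flip of a wrong pair gains a constant times \<open>n\<^sup>k / n\<^sup>2\<close>. The result is
  complete partite, and the increase of \<open>\<Lambda>\<close> bounds the number of edits.
  For an arbitrary nearly optimal \<open>G\<close>, (Sym1) provides a path to a complete partite graph, which is
  close to an optimal limit by compactness. Following the path backwards in small steps, closeness
  is never lost: the local statement improves any sufficiently good closeness.\<close>

section \<open>Induced subgraph sums and densities\<close>

text \<open>Every estimate rests on one count: at most \<open>n^k / n^(card A)\<close> of the
  \<open>k\<close>-sets contain a given set \<open>A\<close>. Hence sparse edits perturb rooted sums
  only slightly, and in a graph governed by finitely many vertex types the rooted sums depend, up to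
  order \<open>1 / n\<close>, on the proportions of the types alone. The obstacle is that a partite
  limit may have infinitely many parts. For the values of \<open>lam\<close> and the pair
  derivatives, all parts beyond some \<open>M\<close> are merged into the universal vertices, and
  \<open>M\<close> is sent to infinity after the order. For vertex derivatives this double limit is
  avoided: (Str1) already forces the support of an optimal limit to be finite, so that finitely many
  types describe everything near it. (Str2) compares an attachment with the single reference vector
  \<open>e_vec 1\<close>, which is why one fixed part supplies all clones. Finiteness of
  \<open>OPT\<close> makes the local constants uniform, and compactness may then pass from one
  optimal limit to another without loss.\<close>

definition pattern :: "nat \<Rightarrow> ('a \<Rightarrow> 'a \<Rightarrow> bool) \<Rightarrow> (nat \<Rightarrow> 'a) \<Rightarrow> graph" where
  "pattern k Q t = ({..<k}, {{i, j} | i j. i < k \<and> j < k \<and> i \<noteq> j \<and> Q (t i) (t j)})"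

text \<open>Only distinct vertices are compared, so \<open>Q a a\<close> decides whether the
  vertices of type \<open>a\<close> form a clique or an independent set. With the vertices
  themselves as types every graph is typed.\<close>

definition typed :: "('a \<Rightarrow> 'a \<Rightarrow> bool) \<Rightarrow> (nat \<Rightarrow> 'a) \<Rightarrow> graph \<Rightarrow> bool" where
  "typed Q \<tau> G \<longleftrightarrow> fin_graph G \<and>
     (\<forall>u\<in>verts G. \<forall>v\<in>verts G. u \<noteq> v \<longrightarrow> ({u, v} \<in> edges G \<longleftrightarrow> Q (\<tau> u) (\<tau> v)))"

text \<open>The part of \<open>Lambda\<close> contributed by the sets containing the roots \<open>R\<close>, and its limit when the unrooted
  vertices have type \<open>a\<close> with density \<open>y a\<close> and the roots have types \<open>\<rho> 0, \<dots>, \<rho> (r - 1)\<close>.\<close>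

definition rsum :: "nat \<Rightarrow> (graph \<Rightarrow> real) \<Rightarrow> graph \<Rightarrow> nat set \<Rightarrow> real" where
  "rsum k \<gamma> G R = (\<Sum>X | R \<subseteq> X \<and> X \<subseteq> verts G \<and> card X = k. \<gamma> (induced G X))"

definition dens ::
    "nat \<Rightarrow> (graph \<Rightarrow> real) \<Rightarrow> ('a \<Rightarrow> 'a \<Rightarrow> bool) \<Rightarrow> nat \<Rightarrow> (nat \<Rightarrow> 'a) \<Rightarrow> 'a set \<Rightarrow> ('a \<Rightarrow> real) \<Rightarrow> real" where
  "dens k \<gamma> Q r \<rho> S y =
     (\<Sum>t \<in> {r..<k} \<rightarrow>\<^sub>E S. \<gamma> (pattern k Q (\<lambda>i. if i < r then \<rho> i else t i)) * (\<Prod>i\<in>{r..<k}. y (t i)))"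

section \<open>Induced subgraphs transported to a fixed vertex set\<close>

lemma fin_graph_pattern: "fin_graph (pattern k Q t)"
  by (auto simp: fin_graph_def pattern_def card_2_iff)

lemma order_pattern [simp]: "order (pattern k Q t) = k"
  by (simp add: pattern_def)

lemma pattern_cong: "(\<And>i. i < k \<Longrightarrow> t i = t' i) \<Longrightarrow> pattern k Q t = pattern k Q t'"
  unfolding pattern_def by (intro arg_cong[where f = "Pair {..<k}"] Collect_cong) metis

lemma fin_graph_induced: "fin_graph G \<Longrightarrow> X \<subseteq> verts G \<Longrightarrow> fin_graph (induced G X)"
  by (auto simp: fin_graph_def induced_def intro: finite_subset)

lemma edge_cases:
  assumes "fin_graph G" "e \<in> edges G"
  obtains u v where "e = {u, v}" "u \<noteq> v" "u \<in> verts G" "v \<in> verts G"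
proof -
  from assms have "e \<subseteq> verts G" "card e = 2" by (auto simp: fin_graph_def)
  then show ?thesis using that by (auto simp: card_2_iff)
qed

lemma finite_edges: "fin_graph G \<Longrightarrow> finite (edges G)"
  by (rule finite_subset[of _ "Pow (verts G)"]) (auto simp: fin_graph_def)

lemma typed_adjacency: "fin_graph G \<Longrightarrow> typed (\<lambda>u v. {u, v} \<in> edges G) id G"
  by (auto simp: typed_def)

lemma pattern_image:
  assumes "typed Q \<tau> G" "inj_on f {..<k}" "f ` {..<k} \<subseteq> verts G"
  shows "induced G (f ` {..<k}) = graph_image f (pattern k Q (\<lambda>i. \<tau> (f i)))"
proof -
  have fg: "fin_graph G" and Q: "\<And>u v. u \<in> verts G \<Longrightarrow> v \<in> verts G \<Longrightarrow> u \<noteq> v \<Longrightarrow> {u,v} \<in> edges G \<longleftrightarrow> Q (\<tau> u) (\<tau> v)"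
    using assms(1) by (auto simp: typed_def)
  have "{e \<in> edges G. e \<subseteq> f ` {..<k}} = (`) f ` {{i, j} | i j. i < k \<and> j < k \<and> i \<noteq> j \<and> Q (\<tau> (f i)) (\<tau> (f j))}"
    (is "?L = ?R")
  proof (intro equalityI subsetI)
    fix e assume e: "e \<in> ?L"
    then have "e \<in> edges G" by simp
    from edge_cases[OF fg this] obtain u v where uv: "e = {u, v}" "u \<noteq> v" .
    with e obtain i j where "i < k" "j < k" "u = f i" "v = f j" by auto
    then have "e = f ` {i, j}" "i \<noteq> j" "Q (\<tau> (f i)) (\<tau> (f j))"
      using uv e assms(3) Q[of u v] by auto
    then show "e \<in> ?R" using \<open>i < k\<close> \<open>j < k\<close> by blast
  next
    fix e assume "e \<in> ?R"
    then obtain i j where ij: "e = f ` {i, j}" "i < k" "j < k" "i \<noteq> j" "Q (\<tau> (f i)) (\<tau> (f j))" by blast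
    then have "f i \<noteq> f j" using assms(2) by (auto dest: inj_onD)
    moreover have "f i \<in> verts G" "f j \<in> verts G" using ij assms(3) by auto
    ultimately show "e \<in> ?L" using ij Q[of "f i" "f j"] by auto
  qed
  then show ?thesis by (simp add: induced_def graph_image_def pattern_def)
qed

text \<open>The enumeration \<open>f\<close> is an isomorphism from the pattern onto the induced
  subgraph, so \<open>\<gamma>\<close> sees only the types of the chosen vertices. Sums over vertex
  sets can therefore be grouped by types.\<close>

lemma gamma_pattern:
  assumes "iso_invariant k \<gamma>" "typed Q \<tau> G" "inj_on f {..<k}" "f ` {..<k} \<subseteq> verts G"
  shows "\<gamma> (induced G (f ` {..<k})) = \<gamma> (pattern k Q (\<lambda>i. \<tau> (f i)))"
proof -
  let ?p = "pattern k Q (\<lambda>i. \<tau> (f i))"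
  have "graph_iso ?p (induced G (f ` {..<k}))"
    unfolding graph_iso_def using assms(3) pattern_image[OF assms(2-4)]
    by (auto simp: pattern_def)
  moreover have "fin_graph (induced G (f ` {..<k}))"
    using assms by (auto intro!: fin_graph_induced simp: typed_def)
  ultimately show ?thesis
    using assms(1) fin_graph_pattern[of k Q] unfolding iso_invariant_def by (metis order_pattern)
qed

text \<open>Every graph of order \<open>k\<close> is isomorphic to one on \<open>{..<k}\<close>,
  which leaves finitely many values. The number \<open>1\<close> is inserted into the maximum to
  make the bound positive.\<close>

lemma gamma_bounded:
  assumes "iso_invariant k \<gamma>"
  obtains B where "B > 0" "\<And>G. fin_graph G \<Longrightarrow> order G = k \<Longrightarrow> \<bar>\<gamma> G\<bar> \<le> B"
proof -
  let ?A = "(\<lambda>H. \<bar>\<gamma> H\<bar>) ` ({{..<k}} \<times> Pow (Pow {..<k}))"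
  have fin: "finite ?A" by (intro finite_imageI finite_cartesian_product) auto
  have "\<bar>\<gamma> G\<bar> \<le> Max (insert 1 ?A)" if G: "fin_graph G" "order G = k" for G
  proof -
    have "finite (verts G)" using G by (simp add: fin_graph_def)
    then obtain f where f: "bij_betw f {..<k} (verts G)"
      using ex_bij_betw_nat_finite G by (metis atLeast0LessThan)
    then have "induced G (f ` {..<k}) = G"
      using G by (auto simp: induced_def bij_betw_def fin_graph_def prod_eq_iff)
    then have "\<gamma> G = \<gamma> (pattern k (\<lambda>u v. {u, v} \<in> edges G) (\<lambda>i. id (f i)))"
      using gamma_pattern[OF assms typed_adjacency[OF G(1)], of f] f by (simp add: bij_betw_def)
    then have "\<bar>\<gamma> G\<bar> \<in> ?A" by (auto simp: pattern_def)
    then show ?thesis using fin by (intro Max_ge) auto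
  qed
  moreover have "Max (insert 1 ?A) \<ge> 1" using fin by (intro Max_ge) auto
  then have "Max (insert 1 ?A) > 0" by linarith
  ultimately show ?thesis by (rule that[rotated])
qed

text \<open>Removing \<open>A\<close> embeds these sets into the subsets of size
  \<open>k - card A\<close>. The bound is written as a quotient because \<open>A\<close> will be
  \<open>e \<union> R\<close> for an edited pair \<open>e\<close> and roots \<open>R\<close>, whose
  size varies with \<open>e\<close> and may exceed \<open>k\<close>; in that case the left side
  vanishes.\<close>

lemma card_supersets_le:
  assumes "finite V" "A \<subseteq> V" "V \<noteq> {}"
  shows "real (card {X. A \<subseteq> X \<and> X \<subseteq> V \<and> card X = k}) \<le> real (card V) ^ k / real (card V) ^ card A"
proof (cases "card A \<le> k")
  case True
  have fA: "finite A" using assms finite_subset by blast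
  have "card {X. A \<subseteq> X \<and> X \<subseteq> V \<and> card X = k} \<le> card {Y. Y \<subseteq> V \<and> card Y = k - card A}"
  proof (rule card_inj_on_le[where f = "\<lambda>X. X - A"])
    show "inj_on (\<lambda>X. X - A) {X. A \<subseteq> X \<and> X \<subseteq> V \<and> card X = k}"
      by (rule inj_onI) blast
    show "(\<lambda>X. X - A) ` {X. A \<subseteq> X \<and> X \<subseteq> V \<and> card X = k} \<subseteq> {Y. Y \<subseteq> V \<and> card Y = k - card A}"
      using fA by (auto simp: card_Diff_subset)
    show "finite {Y. Y \<subseteq> V \<and> card Y = k - card A}" using assms by simp
  qed
  also have "\<dots> = card V choose (k - card A)" using assms n_subsets by blast
  also have "\<dots> \<le> card V ^ (k - card A)"
    by (cases "k - card A \<le> card V") (auto simp: binomial_le_pow binomial_eq_0)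
  finally have "real (card {X. A \<subseteq> X \<and> X \<subseteq> V \<and> card X = k}) \<le> real (card V) ^ (k - card A)"
    unfolding of_nat_power[symmetric] of_nat_le_iff .
  also have "\<dots> = real (card V) ^ k / real (card V) ^ card A"
    using True assms by (simp add: power_diff)
  finally show ?thesis .
next
  case False
  have "{X. A \<subseteq> X \<and> X \<subseteq> V \<and> card X = k} = {}"
  proof -
    have "card A \<le> card X" if "A \<subseteq> X" "X \<subseteq> V" for X
      using that assms(1) by (intro card_mono) (auto intro: finite_subset)
    then show ?thesis using False by fastforce
  qed
  then show ?thesis by (simp only: card.empty) simp
qed

text \<open>Every set of the right size is the image of exactly \<open>fact (card I)\<close>
  injections. This passes from sums over vertex sets to sums over maps, whose coordinates can be
  treated separately.\<close>

lemma sum_image_injections: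
  fixes h :: "'b set \<Rightarrow> real"
  assumes "finite I" "finite W"
  shows "(\<Sum>f | f \<in> I \<rightarrow>\<^sub>E W \<and> inj_on f I. h (f ` I)) =
           fact (card I) * (\<Sum>Y | Y \<subseteq> W \<and> card Y = card I. h Y)"
proof -
  let ?F = "{f. f \<in> I \<rightarrow>\<^sub>E W \<and> inj_on f I}" and ?T = "{Y. Y \<subseteq> W \<and> card Y = card I}"
  have finF: "finite ?F" by (rule finite_subset[of _ "I \<rightarrow>\<^sub>E W"]) (use assms in \<open>auto intro: finite_PiE\<close>)
  have "(\<Sum>f\<in>?F. h (f ` I)) = (\<Sum>Y\<in>?T. \<Sum>f\<in>{f\<in>?F. f ` I = Y}. h (f ` I))"
    by (rule sum.group[symmetric]) (use assms finF in \<open>auto simp: card_image\<close>)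
  also have "\<dots> = (\<Sum>Y\<in>?T. fact (card I) * h Y)"
  proof (rule sum.cong[OF refl])
    fix Y assume Y: "Y \<in> ?T"
    then have fY: "finite Y" using assms finite_subset by auto
    have eq: "{f\<in>?F. f ` I = Y} = {f \<in> I \<rightarrow>\<^sub>E Y. inj_on f I}"
    proof (intro equalityI subsetI)
      fix f assume "f \<in> {f \<in> I \<rightarrow>\<^sub>E Y. inj_on f I}"
      moreover from this have "f ` I = Y"
        using Y fY by (intro card_subset_eq) (auto simp: card_image)
      ultimately show "f \<in> {f\<in>?F. f ` I = Y}" using Y by (auto simp: PiE_iff)
    qed auto
    have "prod ((-) (card I)) {0..<card I} = fact (card I)"
      by (simp add: fact_prod_rev)
    then have "card {f\<in>?F. f ` I = Y} = fact (card I)"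
      unfolding eq using card_inj_on_subset_funcset[OF assms(1) fY order_refl] Y by simp
    then show "(\<Sum>f\<in>{f\<in>?F. f ` I = Y}. h (f ` I)) = fact (card I) * h Y"
      by simp
  qed
  finally show ?thesis by (simp add: sum_distrib_left)
qed

text \<open>The falling factorial is at least \<open>(n - k)^k\<close>, and Bernoulli's inequality
  bounds \<open>(1 - k / n)^k\<close> from below. Read the other way, \<open>k^2 / n\<close> bounds
  the share of non-injective maps among all maps.\<close>

lemma fact_binomial_lower:
  assumes "k \<le> n" "n > 0"
  shows "real n ^ k * (1 - real k ^ 2 / real n) \<le> fact k * real (n choose k)"
proof -
  have "real n ^ k * (1 - real k ^ 2 / real n) = real n ^ k * (1 + real k * (- real k / real n))"
    by (simp add: power2_eq_square)
  also have "\<dots> \<le> real n ^ k * (1 + (- real k / real n)) ^ k"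
    using assms by (intro mult_left_mono Bernoulli_inequality) (auto simp: field_simps)
  also have "\<dots> = (real n - real k) ^ k"
    using assms by (simp add: power_mult_distrib[symmetric] algebra_simps)
  also have "\<dots> = (\<Prod>i<k. real n - real k)" by simp
  also have "\<dots> \<le> (\<Prod>i<k. real n - real i)"
    using assms by (intro prod_mono) auto
  also have "\<dots> = fact k * real (n choose k)"
    by (simp add: gbinomial_mult_fact binomial_gbinomial atLeast0LessThan)
  finally show ?thesis .
qed

lemma fact_binomial_upper: "fact k * real (n choose k) \<le> real n ^ k"
proof (cases "k \<le> n")
  case True
  have "fact k * real (n choose k) = (\<Prod>i<k. real n - real i)"
    by (simp add: gbinomial_mult_fact binomial_gbinomial atLeast0LessThan)
  also have "\<dots> \<le> (\<Prod>i<k. real n)" using True by (intro prod_mono) auto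
  finally show ?thesis by simp
qed (simp add: binomial_eq_0)

lemma abs_sum_le:
  fixes f :: "'b \<Rightarrow> real"
  assumes "\<And>x. x \<in> A \<Longrightarrow> \<bar>f x\<bar> \<le> b"
  shows "\<bar>sum f A\<bar> \<le> b * real (card A)"
  using order_trans[OF sum_abs sum_bounded_above[of A "\<lambda>x. \<bar>f x\<bar>" b]] assms by (simp add: mult.commute)

section \<open>Perturbation and sampling estimates for rooted sums\<close>

locale graph_param =
  fixes k :: nat and \<gamma> :: "graph \<Rightarrow> real" and B :: real
  assumes k_pos: "k \<ge> 1" and iso: "iso_invariant k \<gamma>" and B_pos: "B > 0"
    and bound: "\<And>G. fin_graph G \<Longrightarrow> order G = k \<Longrightarrow> \<bar>\<gamma> G\<bar> \<le> B"
begin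

abbreviation "rs \<equiv> rsum k \<gamma>"
abbreviation "\<Lambda> \<equiv> Lambda k \<gamma>"
abbreviation "dn \<equiv> dens k \<gamma>"

lemma bound_induced: "fin_graph G \<Longrightarrow> X \<subseteq> verts G \<Longrightarrow> card X = k \<Longrightarrow> \<bar>\<gamma> (induced G X)\<bar> \<le> B"
  by (rule bound[OF fin_graph_induced]) (auto simp: induced_def)

lemma bound_pattern: "\<bar>\<gamma> (pattern k Q t)\<bar> \<le> B"
  by (rule bound[OF fin_graph_pattern]) simp

lemma Lambda_rsum: "\<Lambda> G = rs G {}"
  by (simp add: Lambda_def rsum_def)

text \<open>A \<open>k\<close>-set contributes to the difference only if it contains an edited pair,
  and then at most \<open>2 * B\<close>. A union bound over the edited pairs leaves the number of
  sets containing \<open>e \<union> R\<close>, so an edit is the cheaper the fewer roots it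
  meets.\<close>

lemma rsum_diff:
  assumes fg: "fin_graph G" "fin_graph G'" and V: "verts G' = verts G" and R: "R \<subseteq> verts G"
  shows "\<bar>rs G R - rs G' R\<bar> \<le>
    2 * B * (\<Sum>e\<in>sym_diff (edges G) (edges G'). real (order G) ^ k / real (order G) ^ card (e \<union> R))"
    (is "_ \<le> 2 * B * ?s")
proof (cases "verts G = {}")
  case True
  then have "edges G = {}" "edges G' = {}" using fg V by (auto simp: fin_graph_def)
  then show ?thesis using V by (simp add: rsum_def induced_def)
next
  case False
  let ?n = "real (order G)"
  let ?D = "sym_diff (edges G) (edges G')"
  let ?T = "{X. R \<subseteq> X \<and> X \<subseteq> verts G \<and> card X = k}"
  have fV: "finite (verts G)" using fg by (simp add: fin_graph_def)
  have fT: "finite ?T" using fV by (auto intro: finite_subset[of _ "Pow (verts G)"])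
  have fD: "finite ?D" using finite_edges[OF fg(1)] finite_edges[OF fg(2)] by auto
  have "\<bar>rs G R - rs G' R\<bar> = \<bar>\<Sum>X\<in>?T. \<gamma> (induced G X) - \<gamma> (induced G' X)\<bar>"
    by (simp add: rsum_def V sum_subtractf)
  also have "\<dots> \<le> (\<Sum>X\<in>?T. \<bar>\<gamma> (induced G X) - \<gamma> (induced G' X)\<bar>)" by (rule sum_abs)
  also have "\<dots> \<le> (\<Sum>X\<in>?T. \<Sum>e\<in>?D. if e \<subseteq> X then 2 * B else 0)"
  proof (rule sum_mono)
    fix X assume X: "X \<in> ?T"
    have nn: "0 \<le> (\<Sum>e\<in>?D. if e \<subseteq> X then 2 * B else 0)" using B_pos by (intro sum_nonneg) auto
    show "\<bar>\<gamma> (induced G X) - \<gamma> (induced G' X)\<bar> \<le> (\<Sum>e\<in>?D. if e \<subseteq> X then 2 * B else 0)"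
    proof (cases "\<exists>e\<in>?D. e \<subseteq> X")
      case False
      then have "induced G X = induced G' X" by (auto simp: induced_def)
      then show ?thesis using nn by simp
    next
      case True
      then obtain e where e: "e \<in> ?D" "e \<subseteq> X" by blast
      have "\<bar>\<gamma> (induced G X) - \<gamma> (induced G' X)\<bar> \<le> 2 * B"
        using bound_induced[OF fg(1), of X] bound_induced[OF fg(2), of X] X V by auto
      also have "\<dots> = (\<Sum>e\<in>{e}. if e \<subseteq> X then 2 * B else 0)" using e by simp
      also have "\<dots> \<le> (\<Sum>e\<in>?D. if e \<subseteq> X then 2 * B else 0)"
        using e fD B_pos by (intro sum_mono2) auto
      finally show ?thesis .
    qed
  qed
  also have "\<dots> = (\<Sum>e\<in>?D. \<Sum>X\<in>?T. if e \<subseteq> X then 2 * B else 0)" by (rule sum.swap)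
  also have "\<dots> \<le> (\<Sum>e\<in>?D. 2 * B * (?n ^ k / ?n ^ card (e \<union> R)))"
  proof (rule sum_mono)
    fix e assume e: "e \<in> ?D"
    then have "e \<union> R \<subseteq> verts G" using R fg V by (auto simp: fin_graph_def)
    from card_supersets_le[OF fV this False, of k]
    have "real (card {X. e \<union> R \<subseteq> X \<and> X \<subseteq> verts G \<and> card X = k}) \<le> ?n ^ k / ?n ^ card (e \<union> R)" .
    moreover have "(\<Sum>X\<in>?T. if e \<subseteq> X then 2 * B else 0) = 2 * B * card {X. e \<union> R \<subseteq> X \<and> X \<subseteq> verts G \<and> card X = k}"
    proof -
      have "{X \<in> ?T. e \<subseteq> X} = {X. e \<union> R \<subseteq> X \<and> X \<subseteq> verts G \<and> card X = k}" by auto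
      then show ?thesis using fT by (simp add: sum.inter_filter[symmetric])
    qed
    ultimately show "(\<Sum>X\<in>?T. if e \<subseteq> X then 2 * B else 0) \<le> 2 * B * (?n ^ k / ?n ^ card (e \<union> R))"
      using mult_left_mono[of "real (card {X. e \<union> R \<subseteq> X \<and> X \<subseteq> verts G \<and> card X = k})" "?n ^ k / ?n ^ card (e \<union> R)" "2 * B"] B_pos by simp
  qed
  finally show ?thesis by (simp add: sum_distrib_left)
qed

text \<open>Products of numbers in \<open>[0, 1]\<close> differ by at most the sum of the
  differences of their factors. What matters about the crude constant is that it is the same for all
  \<open>Q\<close> and \<open>\<rho>\<close>.\<close>

lemma dens_lipschitz:
  assumes S: "finite S" and y: "\<And>a. a \<in> S \<Longrightarrow> 0 \<le> y a \<and> y a \<le> 1" "\<And>a. a \<in> S \<Longrightarrow> 0 \<le> z a \<and> z a \<le> 1"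
    and d: "\<And>a. a \<in> S \<Longrightarrow> \<bar>y a - z a\<bar> \<le> d" "d \<ge> 0"
  shows "\<bar>dn Q r \<rho> S y - dn Q r \<rho> S z\<bar> \<le> B * real (card S) ^ (k - r) * real k * d"
proof -
  let ?F = "{r..<k} \<rightarrow>\<^sub>E S"
  let ?g = "\<lambda>t. \<gamma> (pattern k Q (\<lambda>i. if i < r then \<rho> i else t i))"
  have "\<bar>dn Q r \<rho> S y - dn Q r \<rho> S z\<bar> = \<bar>\<Sum>t\<in>?F. ?g t * ((\<Prod>i\<in>{r..<k}. y (t i)) - (\<Prod>i\<in>{r..<k}. z (t i)))\<bar>"
    by (simp add: dens_def sum_subtractf right_diff_distrib)
  also have "\<dots> \<le> (\<Sum>t\<in>?F. \<bar>?g t * ((\<Prod>i\<in>{r..<k}. y (t i)) - (\<Prod>i\<in>{r..<k}. z (t i)))\<bar>)" by (rule sum_abs)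
  also have "\<dots> \<le> (\<Sum>t\<in>?F. B * (real k * d))"
  proof (rule sum_mono)
    fix t assume t: "t \<in> ?F"
    then have tS: "t i \<in> S" if "i \<in> {r..<k}" for i using that by (auto simp: PiE_iff)
    have "\<bar>(\<Prod>i\<in>{r..<k}. y (t i)) - (\<Prod>i\<in>{r..<k}. z (t i))\<bar> \<le> (\<Sum>i\<in>{r..<k}. \<bar>y (t i) - z (t i)\<bar>)"
      using norm_prod_diff[of "{r..<k}" "\<lambda>i. y (t i)" "\<lambda>i. z (t i)"] y tS by auto
    also have "\<dots> \<le> (\<Sum>i\<in>{r..<k}. d)" by (rule sum_mono) (use d tS in auto)
    also have "\<dots> \<le> real k * d" using d(2) by (auto intro: mult_right_mono)
    finally show "\<bar>?g t * ((\<Prod>i\<in>{r..<k}. y (t i)) - (\<Prod>i\<in>{r..<k}. z (t i)))\<bar> \<le> B * (real k * d)"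
      unfolding abs_mult using bound_pattern B_pos d(2) by (intro mult_mono) auto
  qed
  also have "\<dots> = B * real (card S) ^ (k - r) * real k * d"
    by (simp add: card_PiE)
  finally show ?thesis .
qed

text \<open>Sampling without and with replacement: the normalised rooted sum averages
  \<open>\<gamma>\<close> over injective maps from the unrooted positions, the density averages it
  over all maps, where the types of the positions are independent. The averages differ by at most
  \<open>2 * B\<close> times the share of non-injective maps.\<close>

lemma rsum_dens:
  fixes \<tau> :: "nat \<Rightarrow> 'a"
  assumes ty: "typed Q \<tau> G" and \<rho>: "inj_on \<rho> {..<r}" "\<rho> ` {..<r} = R" "R \<subseteq> verts G" and r: "r \<le> k"
    and S: "finite S" "\<tau> ` (verts G - R) \<subseteq> S" and n: "n = card (verts G - R)" "n \<ge> k" "n > 0"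
  shows "\<bar>rs G R / real (n choose (k - r)) -
     dn Q r (\<lambda>i. \<tau> (\<rho> i)) S (\<lambda>a. real (card {v \<in> verts G - R. \<tau> v = a}) / real n)\<bar> \<le> 2 * B * real k ^ 2 / real n"
proof -
  let ?W = "verts G - R" and ?I = "{r..<k}"
  define s where "s a = real (card {v \<in> ?W. \<tau> v = a})" for a
  define q where "q = k - r"
  have q: "card ?I = q" "q \<le> k" by (auto simp: q_def)
  let ?all = "?I \<rightarrow>\<^sub>E ?W" and ?inj = "{f. f \<in> ?I \<rightarrow>\<^sub>E ?W \<and> inj_on f ?I}"
  define g where "g t = \<gamma> (pattern k Q (\<lambda>i. if i < r then \<tau> (\<rho> i) else t i))" for t
  have fin: "finite (verts G)" "fin_graph G" using ty by (auto simp: typed_def fin_graph_def)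
  have fR: "finite R" using fin \<rho>(3) finite_subset by blast
  have fW: "finite ?W" using fin by simp
  have fall: "finite ?all" using fW by (auto intro: finite_PiE)
  have cardall: "real (card ?all) = real n ^ q" using n q by (simp add: card_PiE)
  have gb: "\<bar>g t\<bar> \<le> B" for t unfolding g_def by (rule bound_pattern)
  have cR: "card R = r" using \<rho> card_image by fastforce
  have cardinj: "real (card ?inj) = fact q * real (n choose q)"
    using sum_image_injections[of ?I ?W "\<lambda>_. 1"] fW n q by (simp add: n_subsets)
  \<comment> \<open>The roots occupy the positions below \<open>r\<close>, an injection fills the
    others, and each set arises from \<open>fact q\<close> injections.\<close>
  have 1: "fact q * rs G R = (\<Sum>f\<in>?inj. g (\<lambda>i. \<tau> (f i)))"
  proof -
    have "rs G R = (\<Sum>Y | Y \<subseteq> ?W \<and> card Y = card ?I. \<gamma> (induced G (R \<union> Y)))"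
      unfolding rsum_def
    proof (rule sum.reindex_bij_witness[where i = "\<lambda>Y. R \<union> Y" and j = "\<lambda>X. X - R"])
      fix X assume "X \<in> {X. R \<subseteq> X \<and> X \<subseteq> verts G \<and> card X = k}"
      then show "R \<union> (X - R) = X" "X - R \<in> {Y. Y \<subseteq> ?W \<and> card Y = card ?I}"
        "\<gamma> (induced G (R \<union> (X - R))) = \<gamma> (induced G X)"
        using fR cR by (auto simp: card_Diff_subset Un_absorb1)
    next
      fix Y assume Y: "Y \<in> {Y. Y \<subseteq> ?W \<and> card Y = card ?I}"
      then have "finite Y" "Y \<inter> R = {}" using fW finite_subset by auto
      then show "R \<union> Y - R = Y" "R \<union> Y \<in> {X. R \<subseteq> X \<and> X \<subseteq> verts G \<and> card X = k}"
        using Y fR cR \<rho>(3) r by (auto simp: card_Un_disjoint Int_commute)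
    qed
    then have "fact q * rs G R = (\<Sum>f\<in>?inj. \<gamma> (induced G (R \<union> f ` ?I)))"
      using sum_image_injections[of ?I ?W "\<lambda>Y. \<gamma> (induced G (R \<union> Y))"] fW q by simp
    also have "\<dots> = (\<Sum>f\<in>?inj. g (\<lambda>i. \<tau> (f i)))"
    proof (rule sum.cong[OF refl])
      fix f assume f: "f \<in> ?inj"
      let ?f = "\<lambda>i. if i < r then \<rho> i else f i"
      have im: "?f ` {..<k} = R \<union> f ` ?I"
      proof -
        have "{..<k} = {..<r} \<union> ?I" using r by auto
        then have "?f ` {..<k} = ?f ` {..<r} \<union> ?f ` ?I" by (metis image_Un)
        also have "?f ` {..<r} = R" using \<rho> by force
        also have "?f ` ?I = f ` ?I" by force
        finally show ?thesis .
      qed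
      have inj: "inj_on ?f {..<k}"
      proof (rule inj_onI)
        fix i j assume ij: "i \<in> {..<k}" "j \<in> {..<k}" "?f i = ?f j"
        have a: "f l \<notin> R" if "l \<in> ?I" for l using that f by (auto simp: PiE_iff)
        have b: "\<rho> l \<in> R" if "l < r" for l using that \<rho> by auto
        show "i = j"
        proof (cases "i < r")
          case True
          show ?thesis
          proof (cases "j < r")
            case True with \<open>i < r\<close> ij \<rho>(1) show ?thesis by (auto dest: inj_onD)
          next
            case False with True ij a[of j] b[of i] show ?thesis by auto
          qed
        next
          case False
          show ?thesis
          proof (cases "j < r")
            case True with False ij a[of i] b[of j] show ?thesis by auto
          next
            case f2: False
            with False ij f show ?thesis by (auto dest: inj_onD)
          qed
        qed
      qed
      have sub: "?f ` {..<k} \<subseteq> verts G" unfolding im using f \<rho>(3) by (auto simp: PiE_iff)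
      have "\<gamma> (induced G (R \<union> f ` ?I)) = \<gamma> (pattern k Q (\<lambda>i. \<tau> (?f i)))"
        using gamma_pattern[OF iso ty inj sub] im by simp
      also have "\<dots> = g (\<lambda>i. \<tau> (f i))" unfolding g_def by (simp add: if_distrib)
      finally show "\<gamma> (induced G (R \<union> f ` ?I)) = g (\<lambda>i. \<tau> (f i))" .
    qed
    finally show ?thesis .
  qed
  \<comment> \<open>Grouping all maps by the tuple of types they produce turns the sum into products
    of class sizes.\<close>
  have 2: "(\<Sum>f\<in>?all. g (\<lambda>i. \<tau> (f i))) = (\<Sum>t\<in>?I \<rightarrow>\<^sub>E S. g t * (\<Prod>i\<in>?I. s (t i)))"
  proof -
    let ?r = "\<lambda>f. restrict (\<lambda>i. \<tau> (f i)) ?I"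
    have "(\<Sum>f\<in>?all. g (\<lambda>i. \<tau> (f i))) = (\<Sum>t\<in>?I \<rightarrow>\<^sub>E S. \<Sum>f\<in>{f\<in>?all. ?r f = t}. g (\<lambda>i. \<tau> (f i)))"
    proof (rule sum.group[symmetric])
      show "finite ?all" by fact
      show "finite (?I \<rightarrow>\<^sub>E S)" using S by (auto intro: finite_PiE)
      show "?r ` ?all \<subseteq> ?I \<rightarrow>\<^sub>E S" using S(2) by (auto simp: PiE_iff image_subset_iff)
    qed
    also have "\<dots> = (\<Sum>t\<in>?I \<rightarrow>\<^sub>E S. g t * (\<Prod>i\<in>?I. s (t i)))"
    proof (rule sum.cong[OF refl])
      fix t assume t: "t \<in> ?I \<rightarrow>\<^sub>E S"
      have eq: "{f\<in>?all. ?r f = t} = PiE ?I (\<lambda>i. {v \<in> ?W. \<tau> v = t i})"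
      proof (intro equalityI subsetI)
        fix f assume "f \<in> {f\<in>?all. ?r f = t}"
        then have "f \<in> ?all" "\<And>i. i \<in> ?I \<Longrightarrow> \<tau> (f i) = t i" by (auto simp: restrict_def)
        then show "f \<in> PiE ?I (\<lambda>i. {v \<in> ?W. \<tau> v = t i})" by (auto simp: PiE_iff)
      next
        fix f assume f: "f \<in> PiE ?I (\<lambda>i. {v \<in> ?W. \<tau> v = t i})"
        then have "?r f = t" using t by (intro extensionalityI[of _ ?I]) (auto simp: PiE_iff)
        then show "f \<in> {f\<in>?all. ?r f = t}" using f by (auto simp: PiE_iff)
      qed
      have "g (\<lambda>i. \<tau> (f i)) = g t" if "f \<in> PiE ?I (\<lambda>i. {v \<in> ?W. \<tau> v = t i})" for f
        unfolding g_def using that by (intro arg_cong[where f = \<gamma>] pattern_cong) (auto simp: PiE_iff)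
      then have "(\<Sum>f\<in>{f\<in>?all. ?r f = t}. g (\<lambda>i. \<tau> (f i))) = real (card (PiE ?I (\<lambda>i. {v \<in> ?W. \<tau> v = t i}))) * g t"
        unfolding eq by simp
      also have "real (card (PiE ?I (\<lambda>i. {v \<in> ?W. \<tau> v = t i}))) = (\<Prod>i\<in>?I. s (t i))"
        unfolding s_def by (simp add: card_PiE)
      finally show "(\<Sum>f\<in>{f\<in>?all. ?r f = t}. g (\<lambda>i. \<tau> (f i))) = g t * (\<Prod>i\<in>?I. s (t i))"
        by (simp only: mult.commute)
    qed
    finally show ?thesis .
  qed
  have 3: "dn Q r (\<lambda>i. \<tau> (\<rho> i)) S (\<lambda>a. s a / real n) = (\<Sum>f\<in>?all. g (\<lambda>i. \<tau> (f i))) / real n ^ q"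
    unfolding 2 unfolding dens_def g_def
    by (simp add: prod_dividef sum_divide_distrib q_def)
  define N where "N = real (card ?inj)"
  have Npos: "N > 0" unfolding N_def cardinj using n q by (auto simp: zero_less_binomial_iff)
  have Nle: "N \<le> real n ^ q" unfolding N_def cardinj by (rule fact_binomial_upper)
  have Nge: "real n ^ q * (1 - real k ^ 2 / real n) \<le> N"
  proof -
    have "real n ^ q * (1 - real k ^ 2 / real n) \<le> real n ^ q * (1 - real q ^ 2 / real n)"
      using q n by (intro mult_left_mono) (auto intro!: divide_right_mono power_mono)
    also have "\<dots> \<le> N" unfolding N_def cardinj using q n by (intro fact_binomial_lower) auto
    finally show ?thesis .
  qed
  \<comment> \<open>\<open>a\<close> and \<open>b\<close> collect the injective and the
    non-injective maps. Dividing \<open>a\<close> by \<open>N\<close> instead of \<open>n^q\<close>,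
    and dropping \<open>b\<close>, each cost at most \<open>B * (n^q - N) / n^q\<close>.\<close>
  define a where "a = (\<Sum>f\<in>?inj. g (\<lambda>i. \<tau> (f i)))"
  define b where "b = (\<Sum>f\<in>?all - ?inj. g (\<lambda>i. \<tau> (f i)))"
  have ab: "(\<Sum>f\<in>?all. g (\<lambda>i. \<tau> (f i))) = a + b"
    unfolding a_def b_def using fall by (subst sum.subset_diff[of ?inj ?all]) auto
  have abs_a: "\<bar>a\<bar> \<le> B * N" unfolding a_def N_def
    by (rule abs_sum_le) (rule gb)
  have cb: "real (card (?all - ?inj)) = real n ^ q - N" unfolding N_def cardall[symmetric]
    using fall by (subst card_Diff_subset) (auto intro: finite_subset[of ?inj ?all] simp: card_mono of_nat_diff)
  have abs_b: "\<bar>b\<bar> \<le> B * (real n ^ q - N)" unfolding b_def cb[symmetric]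
    by (rule abs_sum_le) (rule gb)
  have "rs G R / real (n choose (k - r)) = a / N"
    unfolding N_def cardinj a_def 1[symmetric] q_def by simp
  then have "\<bar>rs G R / real (n choose (k - r)) - dn Q r (\<lambda>i. \<tau> (\<rho> i)) S (\<lambda>a. s a / real n)\<bar> = \<bar>a / N - (a + b) / real n ^ q\<bar>"
    unfolding 3 ab by simp
  also have "\<dots> = \<bar>a * (real n ^ q - N) / (N * real n ^ q) - b / real n ^ q\<bar>"
  proof -
    have "a / N - (a + b) / real n ^ q = a * (real n ^ q - N) / (N * real n ^ q) - b / real n ^ q"
      using Npos n(3) by (simp add: field_simps)
    then show ?thesis by simp
  qed
  also have "\<dots> \<le> \<bar>a * (real n ^ q - N) / (N * real n ^ q)\<bar> + \<bar>b / real n ^ q\<bar>" by (rule abs_triangle_ineq4)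
  also have "\<bar>a * (real n ^ q - N) / (N * real n ^ q)\<bar> = \<bar>a\<bar> * (real n ^ q - N) / (N * real n ^ q)"
    using Npos Nle by (simp add: abs_mult)
  also have "\<dots> \<le> (B * N) * (real n ^ q - N) / (N * real n ^ q)"
    using abs_a Npos Nle by (intro divide_right_mono mult_right_mono) auto
  also have "\<dots> = B * (real n ^ q - N) / real n ^ q" using Npos by simp
  also have "\<bar>b / real n ^ q\<bar> \<le> B * (real n ^ q - N) / real n ^ q"
    using abs_b by (simp add: divide_right_mono)
  also have "B * (real n ^ q - N) / real n ^ q + B * (real n ^ q - N) / real n ^ q = 2 * B * ((real n ^ q - N) / real n ^ q)"
    by (simp add: field_simps)
  also have "\<dots> \<le> 2 * B * (real k ^ 2 / real n)"
  proof (intro mult_left_mono)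
    have "real n ^ q - N \<le> real n ^ q * (real k ^ 2 / real n)" using Nge by (simp add: algebra_simps)
    then show "(real n ^ q - N) / real n ^ q \<le> real k ^ 2 / real n" using n(3) by (simp add: field_simps)
  qed (use B_pos in auto)
  finally show ?thesis by (simp add: s_def)
qed

end

section \<open>Graphs given by types\<close>

text \<open>Type \<open>0\<close> stands for universal vertices and is the only type adjacent to
  itself; every other type is an independent part.\<close>

definition adj :: "nat \<Rightarrow> nat \<Rightarrow> bool" where
  "adj i j \<longleftrightarrow> i \<noteq> j \<or> i = 0"

text \<open>A type function replaces the family of parts: moving a vertex is a function update,
  merging parts is a composition, and proportions are those of the fibres.\<close>

definition pg :: "nat set \<Rightarrow> (nat \<Rightarrow> nat) \<Rightarrow> graph" where
  "pg V \<tau> = (V, {{u, v} | u v. u \<in> V \<and> v \<in> V \<and> u \<noteq> v \<and> adj (\<tau> u) (\<tau> v)})"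

definition ratio :: "nat set \<Rightarrow> (nat \<Rightarrow> 'a) \<Rightarrow> 'a \<Rightarrow> real" where
  "ratio V \<tau> a = real (card {v \<in> V. \<tau> v = a}) / real (card V)"

abbreviation edit :: "graph \<Rightarrow> graph \<Rightarrow> nat set set" where
  "edit G H \<equiv> sym_diff (edges G) (edges H)"

lemma adj_commute: "adj i j \<longleftrightarrow> adj j i"
  by (auto simp: adj_def)

lemma verts_pg [simp]: "verts (pg V \<tau>) = V"
  by (simp add: pg_def)

lemma fin_graph_pg: "finite V \<Longrightarrow> fin_graph (pg V \<tau>)"
  by (auto simp: fin_graph_def pg_def card_2_iff)

lemma pg_edge: "u \<in> V \<Longrightarrow> v \<in> V \<Longrightarrow> u \<noteq> v \<Longrightarrow> {u, v} \<in> edges (pg V \<tau>) \<longleftrightarrow> adj (\<tau> u) (\<tau> v)"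
  by (auto simp: pg_def doubleton_eq_iff adj_commute)

lemma typed_pg: "finite V \<Longrightarrow> typed adj \<tau> (pg V \<tau>)"
  by (simp add: typed_def fin_graph_pg pg_edge)

lemma pg_cong: "(\<And>v. v \<in> V \<Longrightarrow> \<tau> v = \<tau>' v) \<Longrightarrow> pg V \<tau> = pg V \<tau>'"
  unfolding pg_def by (intro arg_cong[where f = "Pair V"] Collect_cong) metis

text \<open>The part of \<open>v\<close>. A universal vertex is a part by itself, which is how
  graphs with universal vertices count as complete partite.\<close>

definition cls :: "nat set \<Rightarrow> (nat \<Rightarrow> nat) \<Rightarrow> nat \<Rightarrow> nat set" where
  "cls V \<tau> v = {w \<in> V. w = v \<or> (\<tau> w = \<tau> v \<and> \<tau> v \<noteq> 0)}"

lemma cls_eq_iff: "u \<in> V \<Longrightarrow> v \<in> V \<Longrightarrow> cls V \<tau> u = cls V \<tau> v \<longleftrightarrow> u = v \<or> \<not> adj (\<tau> u) (\<tau> v)"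
  unfolding cls_def adj_def by (auto simp: set_eq_iff)

lemma in_cls: "v \<in> V \<Longrightarrow> v \<in> cls V \<tau> v"
  by (simp add: cls_def)

lemma complete_partite_on_pg:
  assumes "finite V"
  shows "complete_partite_on (pg V \<tau>) (cls V \<tau> ` V)"
  unfolding complete_partite_on_def
proof (intro conjI)
  show "fin_graph (pg V \<tau>)" using assms by (rule fin_graph_pg)
  have mem: "cls V \<tau> w = cls V \<tau> u" if "u \<in> V" "w \<in> cls V \<tau> u" for u w
    using that by (auto simp: cls_def)
  have sub: "cls V \<tau> u \<subseteq> V" for u by (auto simp: cls_def)
  show "partition_on (verts (pg V \<tau>)) (cls V \<tau> ` V)"
  proof (rule partition_onI)
    show "\<Union>(cls V \<tau> ` V) = verts (pg V \<tau>)" using sub in_cls by auto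
    show "disjnt p q" if "p \<in> cls V \<tau> ` V" "q \<in> cls V \<tau> ` V" "p \<noteq> q" for p q
      using that mem unfolding disjnt_def by blast
    show "{} \<notin> cls V \<tau> ` V" using in_cls by fastforce
  qed
  have "{u, v} \<in> edges (pg V \<tau>) \<longleftrightarrow> cls V \<tau> u \<noteq> cls V \<tau> v" if "u \<in> V" "v \<in> V" "u \<noteq> v" for u v
    using that by (simp add: pg_edge cls_eq_iff)
  show "edges (pg V \<tau>) =
    {{x, y} |x y. \<exists>A\<in>cls V \<tau> ` V. \<exists>B\<in>cls V \<tau> ` V. A \<noteq> B \<and> x \<in> A \<and> y \<in> B}" (is "_ = ?R")
  proof (intro equalityI subsetI)
    fix e assume "e \<in> edges (pg V \<tau>)"
    then obtain u v where uv: "e = {u, v}" "u \<in> V" "v \<in> V" "u \<noteq> v" "adj (\<tau> u) (\<tau> v)"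
      by (auto simp: pg_def)
    then have "cls V \<tau> u \<noteq> cls V \<tau> v" by (simp add: cls_eq_iff)
    then show "e \<in> ?R" using uv in_cls by blast
  next
    fix e assume "e \<in> ?R"
    then obtain x y A B where *: "e = {x, y}" "A \<in> cls V \<tau> ` V" "B \<in> cls V \<tau> ` V" "A \<noteq> B" "x \<in> A" "y \<in> B"
      by blast
    then have "A = cls V \<tau> x" "B = cls V \<tau> y" "x \<in> V" "y \<in> V" using mem sub by auto
    then have "x \<noteq> y" "adj (\<tau> x) (\<tau> y)" using * cls_eq_iff[of x V y \<tau>] by auto
    then show "e \<in> edges (pg V \<tau>)" using * \<open>x \<in> V\<close> \<open>y \<in> V\<close> by (simp add: pg_edge)
  qed
qed

lemma complete_partite_pg: "finite V \<Longrightarrow> complete_partite (pg V \<tau>)"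
  using complete_partite_on_pg by (auto simp: complete_partite_def)

lemma partite_graph_pg:
  assumes "\<And>i v. v \<in> P i \<Longrightarrow> \<tau> v = i"
  shows "partite_graph P = pg (\<Union>i. P i) \<tau>"
proof -
  have key: "(\<exists>i j. u \<in> P i \<and> v \<in> P j \<and> (i \<noteq> j \<or> i = 0)) \<longleftrightarrow>
        u \<in> (\<Union>i. P i) \<and> v \<in> (\<Union>i. P i) \<and> adj (\<tau> u) (\<tau> v)" for u v
  proof -
    have a: "w \<in> P i \<longleftrightarrow> w \<in> (\<Union>i. P i) \<and> \<tau> w = i" for w i
      using assms[of w] by (metis UN_iff UNIV_I)
    show ?thesis by (subst (1 2) a) (auto simp: adj_def)
  qed
  show ?thesis unfolding partite_graph_def pg_def key by (simp only: conj_ac)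
qed

definition part_index :: "(nat \<Rightarrow> nat set) \<Rightarrow> nat \<Rightarrow> nat" where
  "part_index P v = (THE i. v \<in> P i)"

lemma part_index: "disjoint_family P \<Longrightarrow> v \<in> P i \<Longrightarrow> part_index P v = i"
  unfolding part_index_def by (rule the_equality) (auto simp: disjoint_family_on_def)

lemma partite_graph_index: "disjoint_family P \<Longrightarrow> partite_graph P = pg (\<Union>i. P i) (part_index P)"
  by (rule partite_graph_pg) (rule part_index)

lemma part_index_class: "disjoint_family P \<Longrightarrow> {v \<in> (\<Union>i. P i). part_index P v = i} = P i"
  using part_index by fastforce

text \<open>Merging into the universal type, rather than into one further part, keeps all changes
  inside the merged parts: pairs between different parts were edges already and remain so.\<close>

definition truncate :: "nat \<Rightarrow> nat \<Rightarrow> nat" where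
  "truncate M i = (if i \<le> M then i else 0)"

text \<open>Ordered pairs are counted. The relation \<open>R\<close> may be asymmetric, since only
  one order of each pair in \<open>D\<close> has to satisfy it; a typical choice lets
  \<open>R u v\<close> depend on \<open>v\<close> alone.\<close>

lemma card_doubletons_le:
  assumes "finite V" "\<And>u. u \<in> V \<Longrightarrow> real (card {v \<in> V. R u v}) \<le> s"
    and "D \<subseteq> {{u, v} | u v. u \<in> V \<and> v \<in> V \<and> R u v}"
  shows "real (card D) \<le> real (card V) * s"
proof -
  let ?S = "SIGMA u:V. {v \<in> V. R u v}"
  have fin: "finite ?S" using assms(1) by auto
  have "D \<subseteq> (\<lambda>(u, v). {u, v}) ` ?S" using assms(3) by auto
  then have "card D \<le> card ?S" using fin by (rule surj_card_le[rotated])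
  also have "\<dots> = (\<Sum>u\<in>V. card {v \<in> V. R u v})" using assms(1) by simp
  finally have "real (card D) \<le> (\<Sum>u\<in>V. real (card {v \<in> V. R u v}))"
    unfolding of_nat_sum[symmetric] of_nat_le_iff .
  also have "\<dots> \<le> (\<Sum>u\<in>V. s)" by (rule sum_mono) (rule assms)
  finally show ?thesis by simp
qed

text \<open>Only pairs inside a single part beyond \<open>M\<close> change, so a vertex meets at
  most \<open>s\<close> of them. The second claim keeps the changes away from roots whose type is at
  most \<open>M\<close>.\<close>

lemma truncate_edit:
  assumes "finite V" "\<And>i. i > M \<Longrightarrow> real (card {v \<in> V. \<tau> v = i}) \<le> s" "s \<ge> 0"
  shows "real (card (edit (pg V \<tau>) (pg V (\<lambda>v. truncate M (\<tau> v))))) \<le> real (card V) * s"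
    and "e \<in> edit (pg V \<tau>) (pg V (\<lambda>v. truncate M (\<tau> v))) \<Longrightarrow> v \<in> e \<Longrightarrow> \<tau> v > M"
proof -
  let ?D = "edit (pg V \<tau>) (pg V (\<lambda>v. truncate M (\<tau> v)))"
  have sub: "?D \<subseteq> {{u, v} | u v. u \<in> V \<and> v \<in> V \<and> \<tau> u = \<tau> v \<and> \<tau> u > M}"
  proof
    fix e assume e: "e \<in> ?D"
    then obtain u v where uv: "e = {u, v}" "u \<in> V" "v \<in> V" "u \<noteq> v" by (auto simp: pg_def)
    with e have "adj (\<tau> u) (\<tau> v) \<noteq> adj (truncate M (\<tau> u)) (truncate M (\<tau> v))"
      by (auto simp: pg_edge)
    then have "\<tau> u = \<tau> v" "\<tau> u > M" by (auto simp: adj_def truncate_def split: if_splits)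
    then show "e \<in> {{u, v} | u v. u \<in> V \<and> v \<in> V \<and> \<tau> u = \<tau> v \<and> \<tau> u > M}" using uv by blast
  qed
  show "\<tau> v > M" if "e \<in> ?D" "v \<in> e" using sub that by fastforce
  have "real (card {v \<in> V. \<tau> u = \<tau> v \<and> \<tau> u > M}) \<le> s" for u
  proof (cases "\<tau> u > M")
    case True
    then have "{v \<in> V. \<tau> u = \<tau> v \<and> \<tau> u > M} = {v \<in> V. \<tau> v = \<tau> u}" by auto
    then show ?thesis using assms(2)[OF True] by simp
  qed (use assms(3) in auto)
  then show "real (card ?D) \<le> real (card V) * s" using sub by (intro card_doubletons_le[OF assms(1)]) auto
qed

lemma ratio_bounds: "0 \<le> ratio V \<tau> a" "finite V \<Longrightarrow> ratio V \<tau> a \<le> 1"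
proof -
  show "0 \<le> ratio V \<tau> a" by (simp add: ratio_def)
  assume "finite V"
  then have "card {v \<in> V. \<tau> v = a} \<le> card V" by (intro card_mono) auto
  then show "ratio V \<tau> a \<le> 1" by (cases "card V = 0") (auto simp: ratio_def)
qed

text \<open>Over the common denominator the errors of numerator and denominator are nonnegative and
  enter with opposite signs, so the larger of the two bounds the difference.\<close>

lemma quotient_perturb:
  fixes a b n m r :: real
  assumes "0 \<le> b" "b \<le> a" "a \<le> b + r" "m \<le> n" "n \<le> m + r" "b \<le> m" "0 < m"
  shows "\<bar>b / m - a / n\<bar> \<le> r / m"
proof -
  have eq: "b / m - a / n = (b * (n - m) - (a - b) * m) / (n * m)"
    using assms by (simp add: field_simps)
  have "b * (n - m) \<le> m * r" using assms by (intro mult_mono) auto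
  moreover have "(a - b) * m \<le> r * m" using assms by (intro mult_right_mono) auto
  moreover have "0 \<le> b * (n - m)" "0 \<le> (a - b) * m" using assms by auto
  ultimately have "\<bar>b * (n - m) - (a - b) * m\<bar> \<le> r * m" by (simp add: abs_le_iff mult.commute)
  also have "\<dots> \<le> r * n" using assms by (intro mult_left_mono) auto
  finally have "\<bar>b / m - a / n\<bar> \<le> (r * n) / (n * m)"
  proof -
    assume *: "\<bar>b * (n - m) - (a - b) * m\<bar> \<le> r * n"
    have "n * m > 0" using assms by simp
    then show ?thesis unfolding eq abs_divide using divide_right_mono[OF *, of "n * m"] by simp
  qed
  also have "\<dots> = r / m" using assms by simp
  finally show ?thesis .
qed

lemma ratio_remove:
  assumes V: "finite V" "R \<subseteq> V" "card V > card R"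
  shows "\<bar>ratio (V - R) \<tau> a - ratio V \<tau> a\<bar> \<le> real (card R) / real (card V - card R)"
proof -
  let ?A = "{v \<in> V. \<tau> v = a}" and ?B = "{v \<in> V - R. \<tau> v = a}"
  have fR: "finite R" using V finite_subset by auto
  have "card ?A \<le> card (?B \<union> R)" using V fR by (intro card_mono) auto
  then have "card ?A \<le> card ?B + card R" by (meson card_Un_le order_trans)
  moreover have "card ?B \<le> card ?A" using V by (intro card_mono) auto
  moreover have "card ?B \<le> card (V - R)" using V by (intro card_mono) auto
  moreover have "card (V - R) = card V - card R" using V fR by (simp add: card_Diff_subset)
  ultimately show ?thesis unfolding ratio_def using V
    by (intro order_trans[OF quotient_perturb[where r = "real (card R)"]]) (auto simp: of_nat_diff)
qed

text \<open>Types \<open>(i, q)\<close> for rooted graphs. In \<open>Q1\<close>, \<open>q = 2\<close> marks the root and \<open>q \<in> {0, 1}\<close> tells whether a vertex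
  is a neighbour of the root. In \<open>Q2\<close>, \<open>q = 1, 2\<close> mark the two roots, whose adjacency is \<open>c\<close>.\<close>

definition Q1 :: "nat \<times> nat \<Rightarrow> nat \<times> nat \<Rightarrow> bool" where
  "Q1 s t = (if snd s = 2 then snd t = 1 else if snd t = 2 then snd s = 1 else adj (fst s) (fst t))"

definition Q2 :: "bool \<Rightarrow> nat \<times> nat \<Rightarrow> nat \<times> nat \<Rightarrow> bool" where
  "Q2 c s t = (if (snd s = 1 \<and> snd t = 2) \<or> (snd s = 2 \<and> snd t = 1) then c else adj (fst s) (fst t))"

definition nbr_type :: "graph \<Rightarrow> nat \<Rightarrow> (nat \<Rightarrow> nat) \<Rightarrow> nat \<Rightarrow> nat \<times> nat" where
  "nbr_type G z \<tau> v = (\<tau> v, of_bool ({z, v} \<in> edges G))"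

section \<open>Binomial normalisations against powers of \<open>n\<close>\<close>

lemma power_le_binomial:
  assumes "k \<ge> 1" "n \<ge> k"
  shows "real n ^ k \<le> real k ^ k * real (n choose k)"
proof -
  have "real n ^ k / real k ^ k \<le> real (n choose k)"
    using binomial_ge_n_over_k_pow_k[OF assms(2), where 'a = real] by (simp add: power_divide)
  then show ?thesis using assms by (simp add: field_simps)
qed

lemma binomial_le_power: "real (n choose k) \<le> real n ^ k"
  by (cases "k \<le> n") (auto simp: binomial_le_pow binomial_eq_0 simp flip: of_nat_power)

text \<open>The identity \<open>n * (n - 1 choose (k - 1)) = k * (n choose k)\<close> reduces this
  to the case without roots; the factor \<open>k^k\<close> only ends up in constants.\<close>

lemma power_le_binomial1:
  assumes "k \<ge> 1" "n \<ge> k"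
  shows "real n ^ k / real n \<le> real k ^ k * real (n - 1 choose (k - 1))"
proof -
  have "real n * real (n - 1 choose (k - 1)) = real k * real (n choose k)"
    using times_binomial_minus1_eq[of k n] assms by (metis of_nat_mult zero_less_one less_le_trans)
  moreover have "real (n choose k) \<le> real k * real (n choose k)" using assms(1)
    by (simp add: mult_le_cancel_right1)
  ultimately have "real (n choose k) \<le> real n * real (n - 1 choose (k - 1))" by simp
  then have "real k ^ k * real (n choose k) \<le> real k ^ k * (real n * real (n - 1 choose (k - 1)))"
    by (intro mult_left_mono) auto
  with power_le_binomial[OF assms] have "real n ^ k \<le> real k ^ k * real (n - 1 choose (k - 1)) * real n"
    by (simp add: mult_ac)
  then show ?thesis using assms by (subst pos_divide_le_eq) auto
qed

lemma power_le_binomial2: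
  assumes "k \<ge> 2" "n \<ge> k"
  shows "real n ^ k / real n ^ 2 \<le> real k ^ k * real (n - 2 choose (k - 2))"
proof -
  have "real n * real (n - 1 choose (k - 1)) = real k * real (n choose k)"
    using times_binomial_minus1_eq[of k n] assms by (metis of_nat_mult zero_less_numeral less_le_trans)
  moreover have "real (n - 1) * real (n - 2 choose (k - 2)) = real (k - 1) * real (n - 1 choose (k - 1))"
    unfolding of_nat_mult[symmetric] of_nat_eq_iff
    using times_binomial_minus1_eq[of "k - 1" "n - 1"] assms by (simp add: numeral_2_eq_2)
  moreover have "real (n choose k) \<le> real k * real (n choose k)" using assms(1)
    by (simp add: mult_le_cancel_right1)
  moreover have "real (n - 1 choose (k - 1)) \<le> real (k - 1) * real (n - 1 choose (k - 1))" using assms(1)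
    by (simp add: mult_le_cancel_right1)
  ultimately have "real (n choose k) \<le> real n * real (n - 1 choose (k - 1))"
    "real (n - 1 choose (k - 1)) \<le> real (n - 1) * real (n - 2 choose (k - 2))" by auto
  then have "real (n choose k) \<le> real n * (real (n - 1) * real (n - 2 choose (k - 2)))"
    by (meson mult_left_mono of_nat_0_le_iff order_trans)
  also have "\<dots> \<le> real n * (real n * real (n - 2 choose (k - 2)))"
    by (intro mult_left_mono mult_right_mono) auto
  finally have "real k ^ k * real (n choose k) \<le> real k ^ k * (real n * (real n * real (n - 2 choose (k - 2))))"
    by (intro mult_left_mono) auto
  with power_le_binomial[of k n] assms
  have "real n ^ k \<le> real k ^ k * (real n * (real n * real (n - 2 choose (k - 2))))" by linarith
  then show ?thesis using assms by (subst pos_divide_le_eq) (auto simp: power2_eq_square mult_ac)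
qed

section \<open>Density approximations with zero, one and two roots\<close>

context graph_param begin

lemma rsum_diff_disjoint:
  assumes "fin_graph G" "fin_graph G'" "verts G' = verts G" "R \<subseteq> verts G"
    and "\<And>e. e \<in> edit G G' \<Longrightarrow> e \<inter> R = {}"
  shows "\<bar>rs G R - rs G' R\<bar> \<le> 2 * B * (real (card (edit G G')) * (real (order G) ^ k / real (order G) ^ (2 + card R)))"
proof -
  have "finite R" using assms finite_subset by (auto simp: fin_graph_def)
  then have "card (e \<union> R) = 2 + card R" if "e \<in> edit G G'" for e
    using that assms by (subst card_Un_disjoint) (auto simp: fin_graph_def card_ge_0_finite)
  then have "(\<Sum>e\<in>edit G G'. real (order G) ^ k / real (order G) ^ card (e \<union> R)) =
    real (card (edit G G')) * (real (order G) ^ k / real (order G) ^ (2 + card R))" by simp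
  then show ?thesis using rsum_diff[OF assms(1-4)] by simp
qed

lemma Lambda_diff:
  assumes "fin_graph G" "fin_graph G'" "verts G' = verts G"
  shows "\<bar>\<Lambda> G - \<Lambda> G'\<bar> \<le> 2 * B * (real (card (edit G G')) * (real (order G) ^ k / real (order G) ^ 2))"
  using rsum_diff_disjoint[OF assms, of "{}"] by (simp add: Lambda_rsum)

lemma lam_diff:
  assumes "fin_graph G" "fin_graph G'" "verts G' = verts G" "order G \<ge> k"
  shows "\<bar>lam k \<gamma> G - lam k \<gamma> G'\<bar> \<le> 2 * B * real k ^ k * (real (card (edit G G')) / real (order G) ^ 2)"
proof -
  let ?n = "real (order G)" let ?b = "real (order G choose k)"
  have b: "?b > 0" using assms by (simp add: zero_less_binomial_iff)
  have n: "?n > 0" using assms k_pos by auto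
  have "\<bar>lam k \<gamma> G - lam k \<gamma> G'\<bar> = \<bar>\<Lambda> G - \<Lambda> G'\<bar> / ?b"
    using b assms(3) by (simp add: lam_def diff_divide_distrib[symmetric])
  also have "\<dots> \<le> 2 * B * (real (card (edit G G')) * (?n ^ k / ?n ^ 2)) / ?b"
    using Lambda_diff[OF assms(1-3)] b by (intro divide_right_mono) auto
  also have "\<dots> = 2 * B * (real (card (edit G G')) / ?n ^ 2) * (?n ^ k / ?b)" by simp
  also have "\<dots> \<le> 2 * B * (real (card (edit G G')) / ?n ^ 2) * real k ^ k"
    using power_le_binomial[OF k_pos assms(4)] b B_pos by (intro mult_left_mono) (auto simp: field_simps)
  finally show ?thesis by (simp add: mult_ac)
qed

lemma lam_abs_le: "fin_graph G \<Longrightarrow> \<bar>lam k \<gamma> G\<bar> \<le> B"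
proof -
  assume G: "fin_graph G"
  then have fV: "finite (verts G)" by (simp add: fin_graph_def)
  have "\<bar>\<Lambda> G\<bar> \<le> B * real (card {X. X \<subseteq> verts G \<and> card X = k})"
    unfolding Lambda_def by (rule abs_sum_le) (use G bound_induced in auto)
  also have "\<dots> = B * real (order G choose k)" using fV by (simp add: n_subsets)
  finally show ?thesis using B_pos by (cases "order G choose k = 0") (auto simp: lam_def field_simps abs_divide)
qed

text \<open>The sampling error and the Lipschitz bound are each made at most
  \<open>\<omega> / 2\<close>. The order of quantifiers matters: \<open>\<delta>\<close> and
  \<open>N\<close> are chosen from the type set, the number of roots and \<open>\<omega>\<close>,
  and then serve all relations, graphs, roots and target densities at once.\<close>

lemma dens_near:
  fixes S :: "'a set"
  assumes S: "finite S" and r: "r \<le> k" and \<omega>: "\<omega> > 0"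
  obtains \<delta> N where "\<delta> > 0" "\<And>Q (\<tau> :: nat \<Rightarrow> 'a) G \<rho> R y \<rho>t.
    \<lbrakk>typed Q \<tau> G; inj_on \<rho> {..<r}; \<rho> ` {..<r} = R; R \<subseteq> verts G; \<tau> ` (verts G - R) \<subseteq> S;
     card (verts G - R) \<ge> N; \<And>i. i < r \<Longrightarrow> \<tau> (\<rho> i) = \<rho>t i;
     \<And>a. a \<in> S \<Longrightarrow> 0 \<le> y a \<and> y a \<le> 1 \<and> \<bar>ratio (verts G - R) \<tau> a - y a\<bar> \<le> \<delta>\<rbrakk>
    \<Longrightarrow> \<bar>rs G R / real (card (verts G - R) choose (k - r)) - dn Q r \<rho>t S y\<bar> \<le> \<omega>"
proof -
  \<comment> \<open>The \<open>+ 1\<close> makes the Lipschitz constant positive even for empty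
    \<open>S\<close>.\<close>
  define L where "L = B * real (card S) ^ (k - r) * real k + 1"
  have L: "L > 0" unfolding L_def using B_pos by (intro add_nonneg_pos) auto
  define N where "N = max k (max 1 (nat \<lceil>4 * B * real k ^ 2 / \<omega>\<rceil>))"
  show ?thesis
  proof (rule that[of "\<omega> / (2 * L)" N])
    show "\<omega> / (2 * L) > 0" using \<omega> L by simp
    fix Q G \<rho> R y \<rho>t and \<tau> :: "nat \<Rightarrow> 'a"
    assume A: "typed Q \<tau> G" "inj_on \<rho> {..<r}" "\<rho> ` {..<r} = R" "R \<subseteq> verts G" "\<tau> ` (verts G - R) \<subseteq> S"
      "card (verts G - R) \<ge> N" "\<And>i. i < r \<Longrightarrow> \<tau> (\<rho> i) = \<rho>t i"
      and y: "\<And>a. a \<in> S \<Longrightarrow> 0 \<le> y a \<and> y a \<le> 1 \<and> \<bar>ratio (verts G - R) \<tau> a - y a\<bar> \<le> \<omega> / (2 * L)"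
    let ?W = "verts G - R" let ?n = "card ?W"
    have fW: "finite ?W" using A(1) by (auto simp: typed_def fin_graph_def)
    have n: "?n \<ge> k" "?n > 0" "real ?n \<ge> 4 * B * real k ^ 2 / \<omega>"
      using A(6) unfolding N_def by linarith+
    have eq: "dn Q r (\<lambda>i. \<tau> (\<rho> i)) S z = dn Q r \<rho>t S z" for z
      unfolding dens_def using A(7)
      by (intro sum.cong refl arg_cong2[where f = "(*)"] arg_cong[where f = \<gamma>] pattern_cong) auto
    have 1: "\<bar>rs G R / real (?n choose (k - r)) - dn Q r \<rho>t S (ratio ?W \<tau>)\<bar> \<le> 2 * B * real k ^ 2 / real ?n"
      using rsum_dens[OF A(1-4) r S A(5) refl n(1,2)] unfolding eq ratio_def .
    have "4 * B * real k ^ 2 \<le> \<omega> * real ?n" using n(3) \<omega> by (simp add: field_simps)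
    then have 2: "2 * B * real k ^ 2 / real ?n \<le> \<omega> / 2" using n(2) by (simp add: field_simps)
    have "\<bar>dn Q r \<rho>t S (ratio ?W \<tau>) - dn Q r \<rho>t S y\<bar> \<le> B * real (card S) ^ (k - r) * real k * (\<omega> / (2 * L))"
      using y ratio_bounds fW \<omega> L by (intro dens_lipschitz S) auto
    also have "\<dots> \<le> L * (\<omega> / (2 * L))" unfolding L_def using \<omega> L by (intro mult_right_mono) (auto simp: L_def)
    also have "\<dots> = \<omega> / 2" using L by simp
    finally show "\<bar>rs G R / real (?n choose (k - r)) - dn Q r \<rho>t S y\<bar> \<le> \<omega>" using 1 2 by linarith
  qed
qed

abbreviation "dens0 M y \<equiv> dn adj 0 (\<lambda>_. 0) {0..M} y"
abbreviation "dens1 M y \<equiv> dn Q1 1 (\<lambda>_. (0, 2)) ({0..M} \<times> {0, 1}) y"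
abbreviation "dens2 M y a b c \<equiv>
  dn (Q2 c) 2 (\<lambda>i. if i = 0 then (a, 1) else (b, 2)) ({0..M} \<times> {0}) (\<lambda>s. y (fst s))"

lemma lam_near:
  assumes \<omega>: "\<omega> > 0"
  obtains \<delta> N where "\<delta> > 0" "\<And>V \<tau> y. \<lbrakk>finite V; card V \<ge> N; \<tau> ` V \<subseteq> {0..M};
     \<And>i. i \<le> M \<Longrightarrow> 0 \<le> y i \<and> y i \<le> 1 \<and> \<bar>ratio V \<tau> i - y i\<bar> \<le> \<delta>\<rbrakk>
    \<Longrightarrow> \<bar>lam k \<gamma> (pg V \<tau>) - dens0 M y\<bar> \<le> \<omega>"
proof -
  obtain \<delta> N where d: "\<delta> > 0" "\<And>Q (\<tau> :: nat \<Rightarrow> nat) G \<rho> R y \<rho>t.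
    \<lbrakk>typed Q \<tau> G; inj_on \<rho> {..<0::nat}; \<rho> ` {..<0} = R; R \<subseteq> verts G; \<tau> ` (verts G - R) \<subseteq> {0..M};
     card (verts G - R) \<ge> N; \<And>i. i < 0 \<Longrightarrow> \<tau> (\<rho> i) = \<rho>t i;
     \<And>a. a \<in> {0..M} \<Longrightarrow> 0 \<le> y a \<and> y a \<le> 1 \<and> \<bar>ratio (verts G - R) \<tau> a - y a\<bar> \<le> \<delta>\<rbrakk>
    \<Longrightarrow> \<bar>rs G R / real (card (verts G - R) choose (k - 0)) - dn Q 0 \<rho>t {0..M} y\<bar> \<le> \<omega>"
    using dens_near[of "{0..M}" 0 \<omega>] \<omega> by (metis finite_atLeastAtMost le0)
  show ?thesis
  proof (rule that[OF d(1), of N])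
    fix V \<tau> y
    assume V: "finite V" "card V \<ge> N" "\<tau> ` V \<subseteq> {0..M}"
      "\<And>i. i \<le> M \<Longrightarrow> 0 \<le> y i \<and> y i \<le> 1 \<and> \<bar>ratio V \<tau> i - y i\<bar> \<le> \<delta>"
    show "\<bar>lam k \<gamma> (pg V \<tau>) - dens0 M y\<bar> \<le> \<omega>"
      using d(2)[OF typed_pg[OF V(1), of \<tau>], of "\<lambda>_. 0" "{}" "\<lambda>_. 0" y] V
      by (simp add: lam_def Lambda_rsum)
  qed
qed

text \<open>Adjacency to the root is absorbed into the types: \<open>(i, 0)\<close> and
  \<open>(i, 1)\<close> split the class \<open>i\<close>. Thus the neighbourhood of \<open>z\<close>
  may be arbitrary while the rest of the graph is complete partite.\<close>

lemma vertex_near: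
  assumes \<omega>: "\<omega> > 0"
  obtains \<delta> N where "\<delta> > 0" "\<And>G z \<tau> y. \<lbrakk>fin_graph G; z \<in> verts G; del_vertex G z = pg (verts G - {z}) \<tau>;
     order G > N; \<tau> ` (verts G - {z}) \<subseteq> {0..M};
     \<And>i q. i \<le> M \<Longrightarrow> q \<in> {0, 1} \<Longrightarrow>
       0 \<le> y (i, q) \<and> y (i, q) \<le> 1 \<and> \<bar>ratio (verts G - {z}) (nbr_type G z \<tau>) (i, q) - y (i, q)\<bar> \<le> \<delta>\<rbrakk>
    \<Longrightarrow> \<bar>rs G {z} / real (order G - 1 choose (k - 1)) - dens1 M y\<bar> \<le> \<omega>"
proof -
  let ?S = "{0..M} \<times> {0, 1 :: nat}"
  obtain \<delta> N where d: "\<delta> > 0" "\<And>Q (\<tau> :: nat \<Rightarrow> nat \<times> nat) G \<rho> R y \<rho>t.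
    \<lbrakk>typed Q \<tau> G; inj_on \<rho> {..<1::nat}; \<rho> ` {..<1} = R; R \<subseteq> verts G; \<tau> ` (verts G - R) \<subseteq> ?S;
     card (verts G - R) \<ge> N; \<And>i. i < 1 \<Longrightarrow> \<tau> (\<rho> i) = \<rho>t i;
     \<And>a. a \<in> ?S \<Longrightarrow> 0 \<le> y a \<and> y a \<le> 1 \<and> \<bar>ratio (verts G - R) \<tau> a - y a\<bar> \<le> \<delta>\<rbrakk>
    \<Longrightarrow> \<bar>rs G R / real (card (verts G - R) choose (k - 1)) - dn Q 1 \<rho>t ?S y\<bar> \<le> \<omega>"
    using dens_near[of ?S 1 \<omega>] \<omega> k_pos by (metis finite_SigmaI finite_atLeastAtMost finite.intros)
  show ?thesis
  proof (rule that[OF d(1), of N])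
    fix G z \<tau> y
    assume A: "fin_graph G" "z \<in> verts G" "del_vertex G z = pg (verts G - {z}) \<tau>"
     "order G > N" "\<tau> ` (verts G - {z}) \<subseteq> {0..M}"
     and y: "\<And>i q. i \<le> M \<Longrightarrow> q \<in> {0, 1} \<Longrightarrow>
       0 \<le> y (i, q) \<and> y (i, q) \<le> 1 \<and> \<bar>ratio (verts G - {z}) (nbr_type G z \<tau>) (i, q) - y (i, q)\<bar> \<le> \<delta>"
    \<comment> \<open>The first component of the root's type is a placeholder, as \<open>Q1\<close>
      does not read it.\<close>
    let ?t = "\<lambda>v. if v = z then (0, 2) else nbr_type G z \<tau> v"
    have E: "{u, v} \<in> edges G \<longleftrightarrow> adj (\<tau> u) (\<tau> v)" if "u \<in> verts G - {z}" "v \<in> verts G - {z}" "u \<noteq> v" for u v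
    proof -
      have "{u, v} \<in> edges G \<longleftrightarrow> {u, v} \<in> edges (del_vertex G z)"
        using that by (auto simp: del_vertex_def induced_def)
      then show ?thesis using that by (simp add: A(3) pg_edge)
    qed
    have ty: "typed Q1 ?t G"
      unfolding typed_def using A(1) E by (auto simp: Q1_def nbr_type_def insert_commute)
    have fr: "ratio (verts G - {z}) ?t a = ratio (verts G - {z}) (nbr_type G z \<tau>) a" for a
      unfolding ratio_def by (intro arg_cong2[where f = "(/)"] arg_cong[where f = real] arg_cong[where f = card]) auto
    have c: "card (verts G - {z}) = order G - 1" using A(1,2) by (simp add: fin_graph_def)
    have "\<bar>rs G {z} / real (card (verts G - {z}) choose (k - 1)) - dens1 M y\<bar> \<le> \<omega>"
    proof (rule d(2)[OF ty, of "\<lambda>_. z"])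
      show "(\<lambda>_. z) ` {..<1::nat} = {z}" by auto
      show "?t ` (verts G - {z}) \<subseteq> ?S" using A(5) by (auto simp: nbr_type_def)
      show "card (verts G - {z}) \<ge> N" using A(4) c by simp
      show "0 \<le> y a \<and> y a \<le> 1 \<and> \<bar>ratio (verts G - {z}) ?t a - y a\<bar> \<le> \<delta>" if "a \<in> ?S" for a
        unfolding fr using y[of "fst a" "snd a"] that by auto
    qed (use A in \<open>auto simp: inj_on_def\<close>)
    then show "\<bar>rs G {z} / real (order G - 1 choose (k - 1)) - dens1 M y\<bar> \<le> \<omega>"
      unfolding c .
  qed
qed

text \<open>Sets that miss \<open>u\<close> or \<open>v\<close> induce the same subgraph before and
  after the flip.\<close>

lemma Lambda_flip:
  assumes True: "finite (verts G)"
  shows "\<Lambda> G - \<Lambda> (flip_pair G u v) = rs G {u, v} - rs (flip_pair G u v) {u, v}"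
proof -
  let ?F = "flip_pair G u v"
  let ?A = "{X. X \<subseteq> verts G \<and> card X = k}" and ?T = "{X. {u, v} \<subseteq> X \<and> X \<subseteq> verts G \<and> card X = k}"
  have fin: "finite ?A" using True by (auto intro: finite_subset[of _ "Pow (verts G)"])
  have "(\<Sum>X\<in>?A. \<gamma> (induced G X) - \<gamma> (induced ?F X)) = (\<Sum>X\<in>?T. \<gamma> (induced G X) - \<gamma> (induced ?F X))"
  proof (rule sum.mono_neutral_right[OF fin])
    show "\<forall>X\<in>?A - ?T. \<gamma> (induced G X) - \<gamma> (induced ?F X) = 0"
    proof
      fix X assume "X \<in> ?A - ?T"
      then have "\<not> {u, v} \<subseteq> X" by auto
      then have "induced G X = induced ?F X" by (auto simp: induced_def flip_pair_def)
      then show "\<gamma> (induced G X) - \<gamma> (induced ?F X) = 0" by simp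
    qed
  qed auto
  then show ?thesis by (simp add: Lambda_def rsum_def sum_subtractf flip_pair_def)
qed

text \<open>The graph and its flip share all types and proportions; only the adjacency of the two
  roots, the parameter \<open>c\<close> of \<open>Q2\<close>, differs. So the derivative is
  approximated by a difference of two values of \<open>dens2\<close> at the same
  \<open>y\<close>.\<close>

lemma pair_near:
  assumes \<omega>: "\<omega> > 0" and k2: "k \<ge> 2"
  obtains \<delta> N where "\<delta> > 0" "\<And>V \<tau> u v y. \<lbrakk>finite V; u \<in> V; v \<in> V; u \<noteq> v; card V > N; \<tau> ` V \<subseteq> {0..M};
     \<And>i. i \<le> M \<Longrightarrow> 0 \<le> y i \<and> y i \<le> 1 \<and> \<bar>ratio V \<tau> i - y i\<bar> \<le> \<delta>\<rbrakk>
    \<Longrightarrow> \<bar>nabla_pair k \<gamma> (pg V \<tau>) u v -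
      (dens2 M y (\<tau> u) (\<tau> v) (adj (\<tau> u) (\<tau> v)) - dens2 M y (\<tau> u) (\<tau> v) (\<not> adj (\<tau> u) (\<tau> v)))\<bar> \<le> \<omega>"
proof -
  let ?S = "{0..M} \<times> {0 :: nat}"
  have "\<omega> / 2 > 0" using \<omega> by simp
  then obtain \<delta> N where d: "\<delta> > 0" "\<And>Q (\<tau> :: nat \<Rightarrow> nat \<times> nat) G \<rho> R y \<rho>t.
    \<lbrakk>typed Q \<tau> G; inj_on \<rho> {..<2::nat}; \<rho> ` {..<2} = R; R \<subseteq> verts G; \<tau> ` (verts G - R) \<subseteq> ?S;
     card (verts G - R) \<ge> N; \<And>i. i < 2 \<Longrightarrow> \<tau> (\<rho> i) = \<rho>t i;
     \<And>a. a \<in> ?S \<Longrightarrow> 0 \<le> y a \<and> y a \<le> 1 \<and> \<bar>ratio (verts G - R) \<tau> a - y a\<bar> \<le> \<delta>\<rbrakk>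
    \<Longrightarrow> \<bar>rs G R / real (card (verts G - R) choose (k - 2)) - dn Q 2 \<rho>t ?S y\<bar> \<le> \<omega> / 2"
    using dens_near[of ?S 2 "\<omega> / 2"] k2 by (metis finite_SigmaI finite_atLeastAtMost finite.intros)
  \<comment> \<open>Removing the two roots changes a proportion by at most
    \<open>2 / (card V - 2)\<close>, which the term \<open>4 / \<delta>\<close> brings down to
    \<open>\<delta> / 2\<close>.\<close>
  define N' where "N' = N + 2 + nat \<lceil>4 / \<delta>\<rceil>"
  show ?thesis
  proof (rule that[of "\<delta> / 2" N'])
    show "\<delta> / 2 > 0" using d(1) by simp
    fix V \<tau> u v y
    assume V: "finite V" "u \<in> V" "v \<in> V" "u \<noteq> v" "card V > N'" "\<tau> ` V \<subseteq> {0..M}"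
      and y: "\<And>i. i \<le> M \<Longrightarrow> 0 \<le> y i \<and> y i \<le> 1 \<and> \<bar>ratio V \<tau> i - y i\<bar> \<le> \<delta> / 2"
    let ?G = "pg V \<tau>" and ?R = "{u, v}"
    let ?F = "flip_pair ?G u v"
    let ?t = "\<lambda>w. (\<tau> w, if w = u then 1 else if w = v then 2 else 0 :: nat)"
    let ?\<rho> = "\<lambda>i :: nat. if i = 0 then u else v"
    have c: "card (V - ?R) = card V - 2" using V by (simp add: card_Diff_subset)
    have cN: "card V - 2 \<ge> N" "real (card V - 2) \<ge> 4 / \<delta>" using V(5) unfolding N'_def by linarith+
    have fgF: "fin_graph ?F" using V fin_graph_pg[OF V(1), of \<tau>]
      by (auto simp: flip_pair_def fin_graph_def)
    have tyG: "typed (Q2 (adj (\<tau> u) (\<tau> v))) ?t ?G"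
      unfolding typed_def using V by (auto simp: fin_graph_pg pg_edge Q2_def adj_commute)
    have tyF: "typed (Q2 (\<not> adj (\<tau> u) (\<tau> v))) ?t ?F"
      unfolding typed_def using V fgF
      by (auto simp: pg_edge Q2_def flip_pair_def doubleton_eq_iff adj_commute)
    have \<rho>: "inj_on ?\<rho> {..<2}" "?\<rho> ` {..<2} = ?R"
      using V(4) by (auto simp: inj_on_def lessThan_nat_numeral lessThan_Suc)
    have fr: "\<bar>ratio (V - ?R) ?t s - y (fst s)\<bar> \<le> \<delta>" if s: "s \<in> ?S" for s
    proof -
      have "ratio (V - ?R) ?t s = ratio (V - ?R) \<tau> (fst s)"
        unfolding ratio_def using s
        by (intro arg_cong2[where f = "(/)"] arg_cong[where f = real] arg_cong[where f = card]) auto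
      moreover have "\<bar>ratio (V - ?R) \<tau> (fst s) - ratio V \<tau> (fst s)\<bar> \<le> \<delta> / 2"
      proof -
        have "\<bar>ratio (V - ?R) \<tau> (fst s) - ratio V \<tau> (fst s)\<bar> \<le> 2 / real (card V - 2)"
          using ratio_remove[of V ?R \<tau> "fst s"] V cN unfolding N'_def by simp
        also have "\<dots> \<le> \<delta> / 2"
          using cN(2) d(1) V(5) unfolding N'_def by (simp add: field_simps)
        finally show ?thesis .
      qed
      moreover have "\<bar>ratio V \<tau> (fst s) - y (fst s)\<bar> \<le> \<delta> / 2" using y s by auto
      ultimately show ?thesis by linarith
    qed
    have tt: "?t (?\<rho> i) = (if i = 0 then (\<tau> u, 1) else (\<tau> v, 2))" if "i < 2" for i
      using V(4) by simp
    have im: "?t ` (V - ?R) \<subseteq> ?S" using V by auto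
    have 1: "\<bar>rs ?G ?R / real (card V - 2 choose (k - 2)) - dens2 M y (\<tau> u) (\<tau> v) (adj (\<tau> u) (\<tau> v))\<bar> \<le> \<omega> / 2"
      using d(2)[OF tyG \<rho>, of "\<lambda>i. if i = 0 then (\<tau> u, 1) else (\<tau> v, 2)" "\<lambda>s. y (fst s)"] V im cN c y fr tt
      by (auto simp: image_subset_iff)
    have 2: "\<bar>rs ?F ?R / real (card V - 2 choose (k - 2)) - dens2 M y (\<tau> u) (\<tau> v) (\<not> adj (\<tau> u) (\<tau> v))\<bar> \<le> \<omega> / 2"
      using d(2)[OF tyF \<rho>, of "\<lambda>i. if i = 0 then (\<tau> u, 1) else (\<tau> v, 2)" "\<lambda>s. y (fst s)"] V im cN c y fr tt
      by (auto simp: image_subset_iff flip_pair_def)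
    have "nabla_pair k \<gamma> ?G u v = rs ?G ?R / real (card V - 2 choose (k - 2)) - rs ?F ?R / real (card V - 2 choose (k - 2))"
      by (simp add: nabla_pair_def Lambda_flip V(1) diff_divide_distrib)
    then show "\<bar>nabla_pair k \<gamma> ?G u v -
      (dens2 M y (\<tau> u) (\<tau> v) (adj (\<tau> u) (\<tau> v)) - dens2 M y (\<tau> u) (\<tau> v) (\<not> adj (\<tau> u) (\<tau> v)))\<bar> \<le> \<omega>"
      using 1 2 by linarith
  qed
qed

end

section \<open>Realisations and limits\<close>

lemma partite_limits_nonneg: "x \<in> partite_limits \<Longrightarrow> 0 \<le> x i"
  by (cases "i = 0") (auto simp: partite_limits_def)

lemma partite_limits_antimono:
  assumes "x \<in> partite_limits" "1 \<le> i" "i \<le> j"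
  shows "x j \<le> x i"
  using assms(3)
proof (induction j rule: dec_induct)
  case (step m)
  then have "x (Suc m) \<le> x m" using assms(1,2) by (auto simp: partite_limits_def)
  then show ?case using step by simp
qed simp

lemma partite_limits_sum_le:
  assumes "x \<in> partite_limits" "finite F" "F \<subseteq> {1..}"
  shows "sum x F \<le> 1 - x 0"
proof -
  have "(x has_sum (1 - x 0)) {1..}" using assms(1) by (simp add: partite_limits_def)
  then have "x summable_on {1..}" "infsum x {1..} = 1 - x 0"
    by (auto simp: summable_on_def infsumI)
  then show ?thesis
    using finite_sum_le_infsum[of x "{1..}" F] assms partite_limits_nonneg by auto
qed

lemma partite_limits_le_1: "x \<in> partite_limits \<Longrightarrow> x i \<le> 1"
  using partite_limits_sum_le[of x "{i}"] partite_limits_sum_le[of x "{}"] partite_limits_nonneg[of x 0]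
  by (cases "i = 0") auto

text \<open>The first \<open>i\<close> entries are at least \<open>x i\<close> and sum to at most
  \<open>1\<close>. The resulting uniform smallness of late parts is what the truncation of
  realisations rests on.\<close>

lemma partite_limits_decay:
  assumes "x \<in> partite_limits"
  shows "real i * x i \<le> 1"
proof (cases "i = 0")
  case False
  have "real i * x i = (\<Sum>j\<in>{1..i}. x i)" by simp
  also have "\<dots> \<le> sum x {1..i}" by (rule sum_mono) (use partite_limits_antimono[OF assms] in auto)
  also have "\<dots> \<le> 1" using partite_limits_sum_le[OF assms, of "{1..i}"] partite_limits_nonneg[OF assms, of 0] by auto
  finally show ?thesis .
qed simp

lemma partite_limits_partial_sum:
  assumes "x \<in> partite_limits" "\<epsilon> > 0"
  obtains I where "sum x {1..I} > 1 - x 0 - \<epsilon>"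
proof -
  have "(x has_sum (1 - x 0)) {1..}" using assms(1) by (simp add: partite_limits_def)
  from has_sum_finite_approximation[OF this, of "\<epsilon> / 2"] assms(2)
  obtain F where F: "finite F" "F \<subseteq> {1..}" "dist (sum x F) (1 - x 0) \<le> \<epsilon> / 2" by auto
  have "sum x F \<le> sum x {1..Max (insert 0 F)}"
    using F partite_limits_nonneg[OF assms(1)] by (intro sum_mono2) auto
  moreover have "sum x F > 1 - x 0 - \<epsilon>" using F(3) assms(2) unfolding dist_real_def by linarith
  ultimately show ?thesis by (intro that[of "Max (insert 0 F)"]) linarith
qed

text \<open>Consecutive intervals are cut at the cumulative sizes \<open>S i\<close>. Whatever they
  leave over becomes \<open>P 0\<close>, which is empty as soon as some \<open>S I\<close> reaches
  \<open>n\<close>.\<close>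

lemma interval_family:
  fixes S :: "nat \<Rightarrow> nat"
  assumes S: "mono S" "S 0 = 0" "\<And>i. S i \<le> n"
    and P_def: "P = (\<lambda>i. if i = 0 then {1..n} - (\<Union>i\<in>{1..}. {S (i - 1)<..S i}) else {S (i - 1)<..S i})"
  shows "disjoint_family P" "(\<Union>i. P i) = {1..n}" "\<And>i. i \<ge> 1 \<Longrightarrow> card (P i) = S i - S (i - 1)"
    "\<And>I. S I = n \<Longrightarrow> P 0 = {}"
proof -
  have disj: "{S (i - 1)<..S i} \<inter> {S (j - 1)<..S j} = {}" if "1 \<le> i" "i < j" for i j
  proof -
    have "i \<le> j - 1" using that by simp
    then show ?thesis using monoD[OF S(1), of i "j - 1"] by auto
  qed
  show "disjoint_family P" unfolding disjoint_family_on_def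
  proof (intro ballI impI)
    fix i j :: nat assume "i \<noteq> j"
    then consider "i = 0" "j \<ge> 1" | "j = 0" "i \<ge> 1" | "1 \<le> i" "i < j" | "1 \<le> j" "j < i" by linarith
    then show "P i \<inter> P j = {}"
    proof cases
      case 3 then show ?thesis using disj[of i j] by (simp add: P_def)
    next
      case 4 then show ?thesis using disj[of j i] by (auto simp: P_def)
    qed (auto simp: P_def)
  qed
  have sub: "{S (i - 1)<..S i} \<subseteq> {1..n}" for i using S(3)[of i] by auto
  show "(\<Union>i. P i) = {1..n}"
  proof
    show "(\<Union>i. P i) \<subseteq> {1..n}" using sub by (auto simp: P_def)
    show "{1..n} \<subseteq> (\<Union>i. P i)"
    proof
      fix v assume v: "v \<in> {1..n}"
      show "v \<in> (\<Union>i. P i)"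
      proof (cases "v \<in> P 0")
        case False
        then obtain i where "i \<ge> 1" "v \<in> {S (i - 1)<..S i}" using v by (auto simp: P_def)
        then have "v \<in> P i" by (simp add: P_def)
        then show ?thesis by blast
      qed blast
    qed
  qed
  show "card (P i) = S i - S (i - 1)" if "i \<ge> 1" for i using that by (simp add: P_def)
  show "P 0 = {}" if "S I = n" for I
  proof -
    have "{0<..S i} \<subseteq> (\<Union>i\<in>{1..}. {S (i - 1)<..S i})" for i
    proof (induction i)
      case (Suc i)
      have "{0<..S (Suc i)} \<subseteq> {0<..S i} \<union> {S (Suc i - 1)<..S (Suc i)}" by auto
      also have "\<dots> \<subseteq> (\<Union>i\<in>{1..}. {S (i - 1)<..S i})"
        by (rule Un_least[OF Suc UN_upper]) simp
      finally show ?case .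
    qed (simp add: S)
    from this[of I] have "{1..n} \<subseteq> (\<Union>i\<in>{1..}. {S (i - 1)<..S i})"
      unfolding that One_nat_def atLeastSucAtMost_greaterThanAtMost .
    then show ?thesis unfolding P_def if_P[OF refl] Diff_eq_empty_iff .
  qed
qed

text \<open>If \<open>x 0 = 0\<close>, the partial sums are rounded up: rounding down would never exhaust \<open>{1..n}\<close> when
  infinitely many parts are positive.\<close>

lemma realisation_exists:
  assumes x: "x \<in> partite_limits"
  shows "\<exists>P. is_realisation n x P"
proof (cases "x 0 = 0")
  case True
  define T where "T i = sum x {1..i} * real n" for i
  define S where "S i = nat \<lceil>T i\<rceil>" for i
  have T0: "T 0 = 0" by (simp add: T_def)
  have Tstep: "T (Suc i) = T i + x (Suc i) * real n" for i
    by (simp add: T_def algebra_simps)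
  have Tmono: "mono T" unfolding mono_iff_le_Suc using Tstep partite_limits_nonneg[OF x] by simp
  have Tpos: "T i \<ge> 0" for i using monoD[OF Tmono, of 0 i] T0 by simp
  have Sm: "mono S" unfolding S_def using Tmono by (intro monoI nat_mono ceiling_mono) (auto dest: monoD)
  have Tn: "T i \<le> real n" for i
    using partite_limits_sum_le[OF x, of "{1..i}"] True mult_right_mono[of "sum x {1..i}" 1 "real n"]
    by (auto simp: T_def)
  have Sn: "S i \<le> n" for i
  proof -
    have "\<lceil>T i\<rceil> \<le> int n" using Tn[of i] by linarith
    then show ?thesis unfolding S_def by linarith
  qed
  define P where "P = (\<lambda>i. if i = 0 then {1..n} - (\<Union>i\<in>{1..}. {S (i - 1)<..S i}) else {S (i - 1)<..S i})"
  have S0: "S 0 = 0" by (simp add: S_def T0)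
  note fam = interval_family[OF Sm S0 Sn P_def]
  have SI: "\<exists>I. S I = n"
  proof (cases "n = 0")
    case True then show ?thesis using S0 by blast
  next
    case False
    then obtain I where I: "sum x {1..I} > 1 - x 0 - 1 / real n"
      using partite_limits_partial_sum[OF x, of "1 / real n"] by auto
    \<comment> \<open>A partial sum above \<open>n - 1\<close> is rounded up to \<open>n\<close>, so
      finitely many intervals exhaust the vertex set.\<close>
    have "real n - 1 < T I" using I False True by (simp add: T_def field_simps)
    then have "\<lceil>T I\<rceil> > int n - 1" by linarith
    then have "S I \<ge> n" unfolding S_def by linarith
    then show ?thesis using Sn[of I] by (intro exI[of _ I]) simp
  qed
  have "\<bar>real (card (P i)) - x i * real n\<bar> < 1" if "i \<ge> 1" for i
  proof -
    have "\<exists>j. i = Suc j" using \<open>i \<ge> 1\<close> by presburger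
    then obtain j where j: "i = Suc j" by blast
    have "card (P i) = S i - S j" using fam(3)[OF that] j by simp
    moreover have "S j \<le> S i" using monoD[OF Sm, of j i] j by simp
    ultimately have "real (card (P i)) = real (S i) - real (S j)" by simp
    moreover have Sr: "real (S l) = of_int \<lceil>T l\<rceil>" for l using Tpos[of l] by (simp add: S_def)
    moreover have "T i = T j + x i * real n" using Tstep j by simp
    ultimately show ?thesis using Sr[of i] Sr[of j] by linarith
  qed
  moreover have "P 0 = {}" using fam(4) SI by blast
  ultimately have "is_realisation n x P"
    unfolding is_realisation_def using fam(1,2) True by simp
  then show ?thesis by blast
next
  case False
  define s where "s i = (if x i * real n \<ge> 2 then nat \<lfloor>x i * real n\<rfloor> else 0)" for i
  have s_le: "real (s i) \<le> x i * real n" for i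
    using partite_limits_nonneg[OF x, of i] by (auto simp: s_def)
  define S where "S i = sum s {1..i}" for i
  have Sm: "mono S" unfolding mono_iff_le_Suc by (simp add: S_def)
  have S0: "S 0 = 0" by (simp add: S_def)
  have Sn: "S i \<le> n" for i
  proof -
    have "real (S i) \<le> (\<Sum>j\<in>{1..i}. x j * real n)" unfolding S_def of_nat_sum by (rule sum_mono) (rule s_le)
    also have "\<dots> = sum x {1..i} * real n" by (simp add: sum_distrib_right)
    also have "\<dots> \<le> 1 * real n"
      using partite_limits_sum_le[OF x, of "{1..i}"] partite_limits_nonneg[OF x, of 0]
      by (intro mult_right_mono) auto
    finally show ?thesis by simp
  qed
  define P where "P = (\<lambda>i. if i = 0 then {1..n} - (\<Union>i\<in>{1..}. {S (i - 1)<..S i}) else {S (i - 1)<..S i})"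
  note fam = interval_family[OF Sm S0 Sn P_def]
  have "card (P i) = s i" if "i \<ge> 1" for i
  proof -
    have "\<exists>j. i = Suc j" using \<open>i \<ge> 1\<close> by presburger
    then obtain j where "i = Suc j" by blast
    then show ?thesis using fam(3)[OF that] by (simp add: S_def)
  qed
  then have "is_realisation n x P"
    unfolding is_realisation_def using fam(1,2) False by (simp add: s_def)
  then show ?thesis by blast
qed

text \<open>All that is used about the arbitrarily chosen realisation. The error \<open>2\<close>
  covers both rounding rules: sizes are within \<open>1\<close> of \<open>x i * n\<close>, except
  that parts with \<open>x i * n < 2\<close> are dropped when \<open>x 0 > 0\<close>.\<close>

lemma realisation_facts:
  assumes x: "x \<in> partite_limits"
  defines "P \<equiv> \<lambda>n. realisation n x"
  shows "disjoint_family (P n)" "(\<Union>i. P n i) = {1..n}"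
    "i \<ge> 1 \<Longrightarrow> \<bar>real (card (P n i)) - x i * real n\<bar> \<le> 2"
    "x 0 * real n \<le> real (card (P n 0))"
    "x i = 0 \<Longrightarrow> P n i = {}"
proof -
  have R: "is_realisation n x (P n)"
    unfolding P_def realisation_def using realisation_exists[OF x, of n] by (rule someI_ex)
  show dj: "disjoint_family (P n)" and un: "(\<Union>i. P n i) = {1..n}"
    using R by (auto simp: is_realisation_def)
  have fin: "finite (P n i)" for i using un by (metis UNIV_I UN_upper finite_atLeastAtMost finite_subset)
  have c: "real (card (P n i)) \<le> x i * real n" if "i \<ge> 1" "x 0 \<noteq> 0" for i
    using R that partite_limits_nonneg[OF x, of i] unfolding is_realisation_def by auto
  show "\<bar>real (card (P n i)) - x i * real n\<bar> \<le> 2" if i: "i \<ge> 1" for i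
  proof (cases "x 0 = 0")
    case True
    then have "\<bar>real (card (P n i)) - x i * real n\<bar> < 1" using R i by (auto simp: is_realisation_def)
    then show ?thesis by simp
  next
    case False
    then have "card (P n i) = (if x i * real n \<ge> 2 then nat \<lfloor>x i * real n\<rfloor> else 0)"
      using R i by (auto simp: is_realisation_def)
    moreover have "x i * real n \<ge> 0" using partite_limits_nonneg[OF x] by simp
    ultimately show ?thesis by (auto split: if_splits) linarith
  qed
  show "x 0 * real n \<le> real (card (P n 0))"
  proof (cases "x 0 = 0")
    case False
    \<comment> \<open>Here parts are only ever rounded down, so the remaining vertices, at least
      \<open>x 0 * n\<close> of them, fall to \<open>P n 0\<close>. The index set is finite because
      one chosen vertex per nonempty part injects it into \<open>{1..n}\<close>.\<close>
    let ?I = "{i. i \<ge> 1 \<and> P n i \<noteq> {}}"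
    have fI: "finite ?I"
    proof (rule inj_on_finite[of "\<lambda>i. SOME v. v \<in> P n i" _ "{1..n}"])
      have s: "(SOME v. v \<in> P n i) \<in> P n i" if "i \<in> ?I" for i using that some_in_eq by blast
      show "inj_on (\<lambda>i. SOME v. v \<in> P n i) ?I"
        using s dj unfolding inj_on_def disjoint_family_on_def by (metis (no_types, lifting) IntI UNIV_I empty_iff)
      show "(\<lambda>i. SOME v. v \<in> P n i) ` ?I \<subseteq> {1..n}" using s un by blast
    qed simp
    have "{1..n} = P n 0 \<union> (\<Union>i\<in>?I. P n i)"
    proof -
      have "v \<in> P n 0 \<or> v \<in> (\<Union>i\<in>?I. P n i)" if "v \<in> P n j" for v j
        using that by (cases "j = 0") (auto simp: Suc_le_eq)
      then show ?thesis using un by blast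
    qed
    then have "n \<le> card (P n 0) + card (\<Union>i\<in>?I. P n i)" by (metis card_Un_le card_atLeastAtMost diff_Suc_1)
    also have "card (\<Union>i\<in>?I. P n i) \<le> (\<Sum>i\<in>?I. card (P n i))" by (rule card_UN_le[OF fI])
    finally have "real n \<le> real (card (P n 0)) + (\<Sum>i\<in>?I. real (card (P n i)))"
      by (simp flip: of_nat_sum of_nat_add)
    also have "(\<Sum>i\<in>?I. real (card (P n i))) \<le> (\<Sum>i\<in>?I. x i * real n)"
      by (rule sum_mono) (use c False in auto)
    also have "\<dots> = sum x ?I * real n" by (simp add: sum_distrib_right)
    also have "\<dots> \<le> (1 - x 0) * real n"
      using partite_limits_sum_le[OF x fI] by (intro mult_right_mono) auto
    finally show ?thesis by (simp add: algebra_simps)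
  qed simp
  show "P n i = {}" if i: "x i = 0" for i
  proof (cases "i = 0")
    case True then show ?thesis using R i by (auto simp: is_realisation_def)
  next
    case False
    have "card (P n i) = 0"
    proof (cases "x 0 = 0")
      case True
      then have "\<bar>real (card (P n i)) - x i * real n\<bar> < 1"
        using R \<open>i \<noteq> 0\<close> by (auto simp: is_realisation_def)
      then show ?thesis using i by simp
    next
      case f0: False
      then have "card (P n i) = (if x i * real n \<ge> 2 then nat \<lfloor>x i * real n\<rfloor> else 0)"
        using R \<open>i \<noteq> 0\<close> by (auto simp: is_realisation_def)
      then show ?thesis using i by simp
    qed
    then show ?thesis using fin by simp
  qed
qed

text \<open>All parts beyond \<open>M\<close> are turned into universal vertices, which leaves finitely many types.\<close>

definition tail_merge :: "nat \<Rightarrow> (nat \<Rightarrow> real) \<Rightarrow> nat \<Rightarrow> real" where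
  "tail_merge M x i = (if i = 0 then 1 - sum x {1..M} else x i)"

lemma tail_merge_bounds:
  assumes "x \<in> partite_limits"
  shows "0 \<le> tail_merge M x i \<and> tail_merge M x i \<le> 1"
proof -
  have "0 \<le> sum x {1..M}" by (rule sum_nonneg) (rule partite_limits_nonneg[OF assms])
  moreover have "sum x {1..M} \<le> 1"
    using partite_limits_sum_le[OF assms, of "{1..M}"] partite_limits_nonneg[OF assms, of 0] by auto
  ultimately show ?thesis
    using partite_limits_nonneg[OF assms] partite_limits_le_1[OF assms] by (auto simp: tail_merge_def)
qed

text \<open>Convergence of structured graphs of growing order. The last clause makes late parts
  uniformly small, which convergence of each single proportion does not give. No proportion is
  prescribed for \<open>P j 0\<close>: universal vertices and many vanishing parts have the same
  effect in the limit and together account for \<open>x 0\<close>.\<close>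

definition converges_to :: "(nat \<Rightarrow> nat \<Rightarrow> nat set) \<Rightarrow> (nat \<Rightarrow> real) \<Rightarrow> bool" where
  "converges_to P x \<longleftrightarrow> x \<in> partite_limits \<and>
     (\<forall>j. disjoint_family (P j) \<and> finite (\<Union>i. P j i)) \<and>
     filterlim (\<lambda>j. card (\<Union>i. P j i)) at_top sequentially \<and>
     (\<forall>i\<ge>1. (\<lambda>j. real (card (P j i)) / real (card (\<Union>i. P j i))) \<longlonglongrightarrow> x i) \<and>
     (\<forall>\<epsilon>>0. \<exists>M0. \<forall>M\<ge>M0. \<forall>\<^sub>F j in sequentially.
        \<forall>i>M. real (card (P j i)) \<le> \<epsilon> * real (card (\<Union>i. P j i)))"

lemma realisation_ratio_tendsto:
  assumes x: "x \<in> partite_limits" and i: "i \<ge> 1"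
  shows "(\<lambda>n. real (card (realisation n x i)) / real n) \<longlonglongrightarrow> x i"
proof (rule LIMSEQ_I)
  fix r :: real assume r: "r > 0"
  have "norm (real (card (realisation n x i)) / real n - x i) < r" if n: "n > nat \<lceil>2 / r\<rceil>" for n
  proof -
    have n0: "real n > 2 / r" "real n > 0" using n by linarith+
    have "real (card (realisation n x i)) / real n - x i = (real (card (realisation n x i)) - x i * real n) / real n"
      using n0 by (simp add: field_simps)
    then have "norm (real (card (realisation n x i)) / real n - x i) \<le> 2 / real n"
      using realisation_facts(3)[OF x i, of n] by (simp add: abs_divide divide_right_mono)
    also have "\<dots> < r" using n0 r by (simp add: field_simps)
    finally show ?thesis .
  qed
  then show "\<exists>no. \<forall>n\<ge>no. norm (real (card (realisation n x i)) / real n - x i) < r"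
    by (intro exI[of _ "Suc (nat \<lceil>2 / r\<rceil>)"]) auto
qed

text \<open>For the tail clause, \<open>i * x i \<le> 1\<close> makes the ideal size of a late part
  at most half of \<open>\<epsilon> * n\<close>, and the rounding error \<open>2\<close> is at most
  the other half once \<open>n \<ge> 4 / \<epsilon>\<close>, uniformly in \<open>i\<close>.\<close>

lemma converges_to_realisation:
  assumes x: "x \<in> partite_limits"
  shows "converges_to (\<lambda>n. realisation n x) x"
proof -
  note F = realisation_facts[OF x]
  have un: "card (\<Union>i. realisation n x i) = n" for n by (simp add: F(2))
  have "\<exists>M0. \<forall>M\<ge>M0. \<forall>\<^sub>F n in sequentially. \<forall>i>M. real (card (realisation n x i)) \<le> \<epsilon> * real n"
    if \<epsilon>: "\<epsilon> > 0" for \<epsilon> :: real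
  proof (intro exI allI impI)
    fix M assume M: "M \<ge> nat \<lceil>2 / \<epsilon>\<rceil>"
    show "\<forall>\<^sub>F n in sequentially. \<forall>i>M. real (card (realisation n x i)) \<le> \<epsilon> * real n"
      using eventually_ge_at_top[of "nat \<lceil>4 / \<epsilon>\<rceil>"]
    proof eventually_elim
      case (elim n)
      show ?case
      proof (intro allI impI)
        fix i assume i: "i > M"
        have n: "real n \<ge> 4 / \<epsilon>" using elim by linarith
        have i': "real i \<ge> 2 / \<epsilon>" using i M by linarith
        have "2 / \<epsilon> * x i \<le> real i * x i"
          using i' partite_limits_nonneg[OF x, of i] by (rule mult_right_mono)
        then have "2 / \<epsilon> * x i \<le> 1" using partite_limits_decay[OF x, of i] by linarith
        then have "x i \<le> \<epsilon> / 2" using \<epsilon> by (simp add: field_simps)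
        then have "x i * real n \<le> \<epsilon> / 2 * real n" by (intro mult_right_mono) auto
        moreover have "2 \<le> \<epsilon> / 2 * real n" using n \<epsilon> by (simp add: field_simps)
        ultimately show "real (card (realisation n x i)) \<le> \<epsilon> * real n"
          using F(3)[of i n] i by (simp add: field_simps)
      qed
    qed
  qed
  then show ?thesis
    unfolding converges_to_def un using F(1,2) x realisation_ratio_tendsto[OF x] filterlim_ident by auto
qed

section \<open>Type proportions after truncation\<close>

lemma sum_ratio:
  assumes "finite V" "V \<noteq> {}" "finite S" "\<tau> ` V \<subseteq> S"
  shows "sum (ratio V \<tau>) S = 1"
proof -
  have "(\<Sum>i\<in>S. card {v \<in> V. \<tau> v = i}) = card V"
    using sum.group[OF assms(1,3,4), of "\<lambda>_. 1 :: nat"] by simp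
  then have "(\<Sum>i\<in>S. real (card {v \<in> V. \<tau> v = i})) = real (card V)"
    by (simp flip: of_nat_sum)
  then show ?thesis using assms by (simp add: ratio_def flip: sum_divide_distrib)
qed

lemma truncate_le: "truncate M i \<le> M"
  by (simp add: truncate_def)

lemma truncated_ratio_tendsto:
  assumes P: "converges_to P x" and i: "i \<le> M"
  shows "(\<lambda>j. ratio (\<Union>i. P j i) (\<lambda>v. truncate M (part_index (P j) v)) i) \<longlonglongrightarrow> tail_merge M x i"
proof -
  let ?r = "\<lambda>j. ratio (\<Union>i. P j i) (\<lambda>v. truncate M (part_index (P j) v))"
  have dj: "disjoint_family (P j)" "finite (\<Union>i. P j i)" for j using P by (auto simp: converges_to_def)
  have eq: "?r j i = real (card (P j i)) / real (card (\<Union>i. P j i))" if "1 \<le> i" "i \<le> M" for i j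
  proof -
    have "{v \<in> (\<Union>i. P j i). truncate M (part_index (P j) v) = i} = {v \<in> (\<Union>i. P j i). part_index (P j) v = i}"
      using that by (auto simp: truncate_def split: if_splits)
    then show ?thesis unfolding ratio_def using part_index_class[OF dj(1), of j i] by simp
  qed
  have lim: "(\<lambda>j. ?r j i) \<longlonglongrightarrow> x i" if "1 \<le> i" "i \<le> M" for i
    unfolding eq[OF that] using P that by (auto simp: converges_to_def)
  show ?thesis
  proof (cases "i = 0")
    case False then show ?thesis using lim i by (simp add: tail_merge_def)
  next
    case True
    \<comment> \<open>The proportion of the merged type is obtained as the complement of the
      finitely many others.\<close>
    have "(\<lambda>j. 1 - (\<Sum>i\<in>{1..M}. ?r j i)) \<longlonglongrightarrow> 1 - sum x {1..M}"
      by (intro tendsto_intros lim) auto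
    moreover have "\<forall>\<^sub>F j in sequentially. 1 - (\<Sum>i\<in>{1..M}. ?r j i) = ?r j 0"
    proof -
      have "\<forall>\<^sub>F j in sequentially. card (\<Union>i. P j i) \<ge> 1"
        using P unfolding converges_to_def filterlim_at_top by blast
      then show ?thesis
      proof eventually_elim
        case (elim j)
        then have "(\<Union>i. P j i) \<noteq> {}" by (metis card.empty not_one_le_zero)
        then have "sum (?r j) {0..M} = 1"
          using dj(2) by (intro sum_ratio) (auto simp: truncate_le)
        moreover have "{0..M} = insert 0 {1..M}" by auto
        ultimately show ?case by simp
      qed
    qed
    ultimately show ?thesis using True by (simp add: tail_merge_def tendsto_cong)
  qed
qed

lemma truncated_ratio_near:
  assumes "converges_to P x" "\<delta> > 0"
  shows "\<forall>\<^sub>F j in sequentially. \<forall>i\<in>{0..M}.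
    \<bar>ratio (\<Union>i. P j i) (\<lambda>v. truncate M (part_index (P j) v)) i - tail_merge M x i\<bar> \<le> \<delta>"
proof (subst eventually_ball_finite_distrib)
  show "\<forall>i\<in>{0..M}. \<forall>\<^sub>F j in sequentially.
    \<bar>ratio (\<Union>i. P j i) (\<lambda>v. truncate M (part_index (P j) v)) i - tail_merge M x i\<bar> \<le> \<delta>"
  proof
    fix i assume "i \<in> {0..M}"
    then have "i \<le> M" by simp
    from tendstoD[OF truncated_ratio_tendsto[OF assms(1) this] assms(2)]
    show "\<forall>\<^sub>F j in sequentially.
      \<bar>ratio (\<Union>i. P j i) (\<lambda>v. truncate M (part_index (P j) v)) i - tail_merge M x i\<bar> \<le> \<delta>"
      by eventually_elim (simp add: dist_real_def)
  qed
qed simp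

text \<open>An interchange of limits: if for all large \<open>M\<close> the sequence
  \<open>f\<close> is eventually within \<open>\<epsilon>\<close> of \<open>a M\<close>, then
  \<open>f\<close> is Cauchy and \<open>a\<close> tends to its limit. A second sequence approximated
  by the same numbers shares this limit, whose value need not be known.\<close>

lemma approximable_limits:
  fixes f g a :: "nat \<Rightarrow> real"
  assumes f: "\<And>\<epsilon>. \<epsilon> > 0 \<Longrightarrow> \<exists>M0. \<forall>M\<ge>M0. \<forall>\<^sub>F j in sequentially. \<bar>f j - a M\<bar> \<le> \<epsilon>"
    and g: "\<And>\<epsilon>. \<epsilon> > 0 \<Longrightarrow> \<exists>M0. \<forall>M\<ge>M0. \<forall>\<^sub>F j in sequentially. \<bar>g j - a M\<bar> \<le> \<epsilon>"
  obtains l where "f \<longlonglongrightarrow> l" "g \<longlonglongrightarrow> l" "a \<longlonglongrightarrow> l"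
proof -
  have "Cauchy f"
  proof (rule metric_CauchyI)
    fix e :: real assume "e > 0"
    then obtain M where "\<forall>\<^sub>F j in sequentially. \<bar>f j - a M\<bar> \<le> e / 3" using f[of "e / 3"] by auto
    then obtain N where N: "\<And>j. j \<ge> N \<Longrightarrow> \<bar>f j - a M\<bar> \<le> e / 3" by (auto simp: eventually_sequentially)
    have "dist (f m) (f n) < e" if "m \<ge> N" "n \<ge> N" for m n
      using N[OF that(1)] N[OF that(2)] \<open>e > 0\<close> unfolding dist_real_def by linarith
    then show "\<exists>N. \<forall>m\<ge>N. \<forall>n\<ge>N. dist (f m) (f n) < e" by blast
  qed
  then obtain l where l: "f \<longlonglongrightarrow> l" by (auto simp: Cauchy_convergent_iff convergent_def)
  have a: "\<exists>M0. \<forall>M\<ge>M0. \<bar>a M - l\<bar> \<le> \<epsilon>" if "\<epsilon> > 0" for \<epsilon>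
  proof -
    from f[OF that] obtain M0 where M0: "\<And>M. M \<ge> M0 \<Longrightarrow> \<forall>\<^sub>F j in sequentially. \<bar>f j - a M\<bar> \<le> \<epsilon>" by blast
    have "\<bar>a M - l\<bar> \<le> \<epsilon>" if "M \<ge> M0" for M
    proof -
      have "(\<lambda>j. \<bar>f j - a M\<bar>) \<longlonglongrightarrow> \<bar>l - a M\<bar>" by (intro tendsto_intros l)
      then have "\<bar>l - a M\<bar> \<le> \<epsilon>" using M0[OF that] by (rule tendsto_upperbound) simp
      then show ?thesis by (simp add: abs_minus_commute)
    qed
    then show ?thesis by blast
  qed
  have al: "a \<longlonglongrightarrow> l"
  proof (rule LIMSEQ_I)
    fix r :: real assume "r > 0"
    with a[of "r / 2"] obtain M0 where "\<forall>M\<ge>M0. \<bar>a M - l\<bar> \<le> r / 2" by auto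
    then show "\<exists>no. \<forall>n\<ge>no. norm (a n - l) < r" using \<open>r > 0\<close> by (intro exI[of _ M0]) fastforce
  qed
  have "g \<longlonglongrightarrow> l"
  proof (rule LIMSEQ_I)
    fix r :: real assume r: "r > 0"
    with a[of "r / 3"] obtain M0 where M0: "\<forall>M\<ge>M0. \<bar>a M - l\<bar> \<le> r / 3" by auto
    from g[of "r / 3"] r obtain M1 where M1: "\<forall>M\<ge>M1. \<forall>\<^sub>F j in sequentially. \<bar>g j - a M\<bar> \<le> r / 3" by auto
    define M where "M = max M0 M1"
    have "\<forall>\<^sub>F j in sequentially. \<bar>g j - a M\<bar> \<le> r / 3" using M1 by (simp add: M_def)
    then obtain N where N: "\<And>j. j \<ge> N \<Longrightarrow> \<bar>g j - a M\<bar> \<le> r / 3" by (auto simp: eventually_sequentially)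
    have "\<bar>a M - l\<bar> \<le> r / 3" using M0 by (simp add: M_def)
    then have "norm (g j - l) < r" if "j \<ge> N" for j using N[OF that] r unfolding real_norm_def by linarith
    then show "\<exists>no. \<forall>n\<ge>no. norm (g n - l) < r" by blast
  qed
  with l al show ?thesis using that by blast
qed

section \<open>Existence of the limits of \<open>lam\<close> and of the pair derivatives\<close>

context graph_param begin

text \<open>Two errors of \<open>\<epsilon> / 2\<close>: truncation edits at most
  \<open>e * n^2\<close> pairs, with \<open>e\<close> fixed before \<open>M\<close>, and the
  truncated graph has finitely many types. How large the order must be for the second error depends
  on \<open>M\<close>, so \<open>M\<close> is fixed before the order grows.\<close>

lemma lam_truncate:
  assumes P: "converges_to P x" and \<epsilon>: "\<epsilon> > 0"
  shows "\<exists>M0. \<forall>M\<ge>M0. \<forall>\<^sub>F j in sequentially.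
    \<bar>lam k \<gamma> (partite_graph (P j)) - dens0 M (tail_merge M x)\<bar> \<le> \<epsilon>"
proof -
  define e where "e = \<epsilon> / (2 * (2 * B * real k ^ k))"
  have e: "e > 0" unfolding e_def using \<epsilon> B_pos k_pos by simp
  let ?V = "\<lambda>j. (\<Union>i. P j i)" and ?\<tau> = "\<lambda>j. part_index (P j)"
  have dj: "disjoint_family (P j)" "finite (?V j)" for j using P by (auto simp: converges_to_def)
  have x: "x \<in> partite_limits" using P by (simp add: converges_to_def)
  obtain M0 where M0: "\<And>M. M \<ge> M0 \<Longrightarrow> \<forall>\<^sub>F j in sequentially. \<forall>i>M. real (card (P j i)) \<le> e * real (card (?V j))"
    using P e unfolding converges_to_def by meson
  have "\<forall>\<^sub>F j in sequentially. \<bar>lam k \<gamma> (partite_graph (P j)) - dens0 M (tail_merge M x)\<bar> \<le> \<epsilon>"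
    if M: "M \<ge> M0" for M
  proof -
    have "\<epsilon> / 2 > 0" using \<epsilon> by simp
    from lam_near[OF this, of M] obtain \<delta> N where d: "\<delta> > 0" and near: "\<And>V \<tau> y. \<lbrakk>finite V; card V \<ge> N; \<tau> ` V \<subseteq> {0..M};
     \<And>i. i \<le> M \<Longrightarrow> 0 \<le> y i \<and> y i \<le> 1 \<and> \<bar>ratio V \<tau> i - y i\<bar> \<le> \<delta>\<rbrakk>
      \<Longrightarrow> \<bar>lam k \<gamma> (pg V \<tau>) - dens0 M y\<bar> \<le> \<epsilon> / 2" by metis
    note r = truncated_ratio_near[OF P d, of M]
    have n: "\<forall>\<^sub>F j in sequentially. card (?V j) \<ge> max N k"
      using P unfolding converges_to_def filterlim_at_top by blast
    from M0[OF M] r n show ?thesis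
    proof eventually_elim
      case (elim j)
      let ?G = "pg (?V j) (?\<tau> j)" and ?G' = "pg (?V j) (\<lambda>v. truncate M (?\<tau> j v))"
      let ?n = "card (?V j)"
      have n: "?n \<ge> k" "?n \<ge> 1" "?n \<ge> N" using elim k_pos by auto
      have "real (card {v \<in> ?V j. ?\<tau> j v = i}) \<le> e * real ?n" if "i > M" for i
        using elim(1) that part_index_class[OF dj(1)] by metis
      then have D: "real (card (edit ?G ?G')) \<le> real ?n * (e * real ?n)"
        using truncate_edit(1)[OF dj(2)[of j], of M "?\<tau> j" "e * real ?n"] e by auto
      have "\<bar>lam k \<gamma> ?G - lam k \<gamma> ?G'\<bar> \<le> 2 * B * real k ^ k * (real (card (edit ?G ?G')) / real ?n ^ 2)"
        using lam_diff[of ?G ?G'] fin_graph_pg[OF dj(2)] n by simp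
      also have "\<dots> \<le> 2 * B * real k ^ k * e"
        using D n B_pos by (intro mult_left_mono) (auto simp: field_simps power2_eq_square)
      also have "\<dots> = \<epsilon> / 2" unfolding e_def using B_pos k_pos by (simp add: field_simps)
      finally have 1: "\<bar>lam k \<gamma> ?G - lam k \<gamma> ?G'\<bar> \<le> \<epsilon> / 2" .
      have 2: "\<bar>lam k \<gamma> ?G' - dens0 M (tail_merge M x)\<bar> \<le> \<epsilon> / 2"
        using elim n dj(2) tail_merge_bounds[OF x] by (intro near) (auto simp: truncate_le)
      show ?case using 1 2 unfolding partite_graph_index[OF dj(1)] by linarith
    qed
  qed
  then show ?thesis by blast
qed

text \<open>The given sequence and the realisations are approximated by the same numbers
  \<open>dens0 M (tail_merge M x)\<close>. Hence the limit in \<open>lam_lim\<close> exists and is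
  reached along every converging sequence, whatever the rounding.\<close>

lemma converges_to_lam:
  assumes P: "converges_to P x"
  shows "(\<lambda>j. lam k \<gamma> (partite_graph (P j))) \<longlonglongrightarrow> lam_lim k \<gamma> x"
proof -
  have x: "x \<in> partite_limits" using P by (simp add: converges_to_def)
  obtain l where "(\<lambda>j. lam k \<gamma> (partite_graph (P j))) \<longlonglongrightarrow> l"
    "(\<lambda>n. lam k \<gamma> (partite_graph (realisation n x))) \<longlonglongrightarrow> l"
    by (rule approximable_limits[OF lam_truncate[OF P] lam_truncate[OF converges_to_realisation[OF x]]])
  then show ?thesis unfolding lam_lim_def by (simp add: limI)
qed

abbreviation "ddiff M y a b \<equiv> dens2 M y a b (adj a b) - dens2 M y a b (\<not> adj a b)"

text \<open>The choice made inside \<open>nabla_pair_lim\<close>, given a name so that its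
  membership properties can be stated for large \<open>n\<close>.\<close>

definition pair_at :: "(nat \<Rightarrow> real) \<Rightarrow> nat \<Rightarrow> nat \<Rightarrow> nat \<Rightarrow> nat \<times> nat" where
  "pair_at x i1 i2 n = (SOME p. fst p \<in> realisation n x i1 \<and> snd p \<in> realisation n x i2 \<and> fst p \<noteq> snd p)"

lemma realisation_large_part:
  assumes x: "x \<in> partite_limits" and i: "x i > 0"
  shows "\<forall>\<^sub>F n in sequentially. card (realisation n x i) \<ge> 2"
  using eventually_ge_at_top[of "nat \<lceil>4 / x i\<rceil>"]
proof eventually_elim
  case (elim n)
  have "real n \<ge> 4 / x i" using elim by linarith
  then have "x i * real n \<ge> 4" using i by (simp add: field_simps)
  then have "real (card (realisation n x i)) \<ge> 2"
    using realisation_facts(3)[OF x, of i n] realisation_facts(4)[OF x, of n] by (cases "i = 0") auto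
  then show ?case by simp
qed

lemma pair_at:
  assumes x: "x \<in> partite_limits" and i: "x i1 > 0" "x i2 > 0"
  shows "\<forall>\<^sub>F n in sequentially. fst (pair_at x i1 i2 n) \<in> realisation n x i1 \<and>
     snd (pair_at x i1 i2 n) \<in> realisation n x i2 \<and> fst (pair_at x i1 i2 n) \<noteq> snd (pair_at x i1 i2 n)"
  using realisation_large_part[OF x i(1)] realisation_large_part[OF x i(2)]
proof eventually_elim
  case (elim n)
  obtain u where u: "u \<in> realisation n x i1" using elim(1) by fastforce
  have "realisation n x i2 - {u} \<noteq> {}"
  proof
    assume "realisation n x i2 - {u} = {}"
    then have "card (realisation n x i2) \<le> card {u}" by (intro card_mono) auto
    then show False using elim(2) by simp
  qed
  then obtain v where "v \<in> realisation n x i2" "v \<noteq> u" by blast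
  then have "\<exists>p. fst p \<in> realisation n x i1 \<and> snd p \<in> realisation n x i2 \<and> fst p \<noteq> snd p"
    using u by (intro exI[of _ "(u, v)"]) auto
  then show ?case unfolding pair_at_def by (rule someI_ex)
qed

text \<open>Once \<open>M\<close> is at least \<open>i1\<close> and \<open>i2\<close>, truncation
  alters no pair at the two roots. Its at most \<open>e * n^2\<close> edits then change a doubly
  rooted sum by order \<open>e * n^(k-2)\<close>, a small multiple of the scale of the
  derivative.\<close>

lemma nabla_pair_truncate:
  assumes k2: "k \<ge> 2" and x: "x \<in> partite_limits" and i: "x i1 > 0" "x i2 > 0" and \<epsilon>: "\<epsilon> > 0"
  shows "\<exists>M0. \<forall>M\<ge>M0. \<forall>\<^sub>F n in sequentially.
    \<bar>nabla_pair k \<gamma> (partite_graph (realisation n x)) (fst (pair_at x i1 i2 n)) (snd (pair_at x i1 i2 n))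
      - ddiff M (tail_merge M x) i1 i2\<bar> \<le> \<epsilon>"
proof -
  \<comment> \<open>Half the value of the case without roots, because two comparisons are made, one
    for the graph and one for its flip.\<close>
  define e where "e = \<epsilon> / (2 * (4 * B * real k ^ k))"
  have e: "e > 0" unfolding e_def using \<epsilon> B_pos k_pos by simp
  let ?P = "\<lambda>n. realisation n x"
  let ?V = "\<lambda>n. (\<Union>i. ?P n i)" and ?\<tau> = "\<lambda>n. part_index (?P n)"
  have P: "converges_to ?P x" by (rule converges_to_realisation[OF x])
  have dj: "disjoint_family (?P n)" "finite (?V n)" "?V n = {1..n}" "card (?V n) = n" for n
    using P realisation_facts(2)[OF x] by (auto simp: converges_to_def)
  obtain M0 where M0: "\<And>M. M \<ge> M0 \<Longrightarrow> \<forall>\<^sub>F j in sequentially. \<forall>i>M. real (card (?P j i)) \<le> e * real (card (?V j))"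
    using P e unfolding converges_to_def by meson
  have "\<forall>\<^sub>F n in sequentially.
    \<bar>nabla_pair k \<gamma> (partite_graph (realisation n x)) (fst (pair_at x i1 i2 n)) (snd (pair_at x i1 i2 n))
      - ddiff M (tail_merge M x) i1 i2\<bar> \<le> \<epsilon>"
    if "M \<ge> max M0 (max i1 i2)" for M
  proof -
    have M: "M \<ge> M0" "M \<ge> i1" "M \<ge> i2" using that by auto
    have "\<epsilon> / 2 > 0" using \<epsilon> by simp
    from pair_near[OF this k2, of M] obtain \<delta> N where d: "\<delta> > 0" and near: "\<And>V \<tau> u v y. \<lbrakk>finite V; u \<in> V; v \<in> V; u \<noteq> v; card V > N; \<tau> ` V \<subseteq> {0..M};
     \<And>i. i \<le> M \<Longrightarrow> 0 \<le> y i \<and> y i \<le> 1 \<and> \<bar>ratio V \<tau> i - y i\<bar> \<le> \<delta>\<rbrakk>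
    \<Longrightarrow> \<bar>nabla_pair k \<gamma> (pg V \<tau>) u v - ddiff M y (\<tau> u) (\<tau> v)\<bar> \<le> \<epsilon> / 2" by metis
    note r = truncated_ratio_near[OF P d, of M]
    from M0[OF M(1)] r eventually_gt_at_top[of "max N k"] pair_at[OF x i] show ?thesis
    proof eventually_elim
      case (elim n)
      let ?\<tau>' = "\<lambda>v. truncate M (?\<tau> n v)"
      let ?G = "pg (?V n) (?\<tau> n)" and ?G' = "pg (?V n) ?\<tau>'"
      let ?u = "fst (pair_at x i1 i2 n)" and ?v = "snd (pair_at x i1 i2 n)"
      let ?F = "flip_pair ?G ?u ?v" and ?F' = "flip_pair ?G' ?u ?v"
      let ?b = "real (n - 2 choose (k - 2))"
      have n: "n \<ge> k" "n > N" using elim by auto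
      have uv: "?u \<in> ?V n" "?v \<in> ?V n" "?u \<noteq> ?v" using elim(4) by blast+
      have tt: "?\<tau> n ?u = i1" "?\<tau> n ?v = i2" using elim(4) part_index[OF dj(1)] by auto
      have fg: "fin_graph ?G" "fin_graph ?G'" using fin_graph_pg[OF dj(2)] by auto
      have fgF: "fin_graph ?F" "fin_graph ?F'" using fg uv by (auto simp: fin_graph_def flip_pair_def)
      have "real (card {v \<in> ?V n. ?\<tau> n v = i}) \<le> e * real n" if "i > M" for i
        using elim(1) that part_index_class[OF dj(1)] dj(4) by metis
      note te = truncate_edit[OF dj(2)[of n], of M "?\<tau> n" "e * real n", OF this]
      have D: "real (card (edit ?G ?G')) \<le> real n * (e * real n)"
        using te(1) e dj(4)[of n] by simp
      have dis: "e' \<inter> {?u, ?v} = {}" if "e' \<in> edit ?G ?G'" for e'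
        using te(2)[OF _ _ that] tt M e by fastforce
      \<comment> \<open>Both graphs are flipped at the same pair, so the set of differing pairs does
        not change.\<close>
      have eF: "edit ?F ?F' = edit ?G ?G'" by (auto simp: flip_pair_def)
      have b: "2 * B * (real (card (edit ?G ?G')) * (real n ^ k / real n ^ 4)) \<le> \<epsilon> / 4 * ?b"
      proof -
        have "2 * B * (real (card (edit ?G ?G')) * (real n ^ k / real n ^ 4)) \<le>
          2 * B * ((real n * (e * real n)) * (real n ^ k / real n ^ 4))"
          using D B_pos by (intro mult_left_mono mult_right_mono) auto
        also have "\<dots> = 2 * B * e * (real n ^ k / real n ^ 2)"
          using n k_pos by (simp add: field_simps power_numeral_reduce power2_eq_square)
        also have "\<dots> \<le> 2 * B * e * (real k ^ k * ?b)"
          using power_le_binomial2[OF k2 n(1)] B_pos e by (intro mult_left_mono) auto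
        also have "\<dots> = \<epsilon> / 4 * ?b" unfolding e_def using B_pos k_pos by (simp add: field_simps)
        finally show ?thesis .
      qed
      have c2: "card {?u, ?v} = 2" using uv by simp
      have b0: "?b > 0" using n k2 by (simp add: zero_less_binomial_iff)
      have "\<bar>rs ?G {?u, ?v} - rs ?G' {?u, ?v}\<bar> \<le> \<epsilon> / 4 * ?b"
        using rsum_diff_disjoint[OF fg, of "{?u, ?v}"] dis uv b c2 dj(4)[of n] by simp
      moreover have "\<bar>rs ?F {?u, ?v} - rs ?F' {?u, ?v}\<bar> \<le> \<epsilon> / 4 * ?b"
        using rsum_diff_disjoint[OF fgF, of "{?u, ?v}"] dis uv b c2 dj(4)[of n] unfolding eF
        by (simp add: flip_pair_def)
      ultimately have "\<bar>(rs ?G {?u, ?v} - rs ?F {?u, ?v}) - (rs ?G' {?u, ?v} - rs ?F' {?u, ?v})\<bar> \<le> \<epsilon> / 2 * ?b"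
        by linarith
      then have "\<bar>((rs ?G {?u, ?v} - rs ?F {?u, ?v}) - (rs ?G' {?u, ?v} - rs ?F' {?u, ?v})) / ?b\<bar> \<le> \<epsilon> / 2"
        unfolding abs_divide using b0 by (simp add: divide_le_eq)
      then have 1: "\<bar>nabla_pair k \<gamma> ?G ?u ?v - nabla_pair k \<gamma> ?G' ?u ?v\<bar> \<le> \<epsilon> / 2"
        using dj(2)[of n] dj(4)[of n] by (simp add: nabla_pair_def Lambda_flip uv(3) diff_divide_distrib)
      have "\<bar>nabla_pair k \<gamma> ?G' ?u ?v - ddiff M (tail_merge M x) (?\<tau>' ?u) (?\<tau>' ?v)\<bar> \<le> \<epsilon> / 2"
        using elim(2) n dj(2,4) uv tail_merge_bounds[OF x] by (intro near) (auto simp: truncate_le)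
      then have 2: "\<bar>nabla_pair k \<gamma> ?G' ?u ?v - ddiff M (tail_merge M x) i1 i2\<bar> \<le> \<epsilon> / 2"
        unfolding tt truncate_def if_P[OF M(2)] if_P[OF M(3)] .
      show ?case using 1 2 unfolding partite_graph_index[OF dj(1)] by linarith
    qed
  qed
  then show ?thesis by blast
qed

lemma nabla_pair_lim_approx:
  assumes "k \<ge> 2" "x \<in> partite_limits" "x i1 > 0" "x i2 > 0"
  shows "(\<lambda>M. ddiff M (tail_merge M x) i1 i2) \<longlonglongrightarrow> nabla_pair_lim k \<gamma> x i1 i2"
proof -
  obtain l where l: "(\<lambda>n. nabla_pair k \<gamma> (partite_graph (realisation n x)) (fst (pair_at x i1 i2 n)) (snd (pair_at x i1 i2 n))) \<longlonglongrightarrow> l"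
    "(\<lambda>M. ddiff M (tail_merge M x) i1 i2) \<longlonglongrightarrow> l"
    by (rule approximable_limits[OF nabla_pair_truncate[OF assms] nabla_pair_truncate[OF assms]])
  have "nabla_pair_lim k \<gamma> x i1 i2 = l"
    unfolding nabla_pair_lim_def Let_def using limI[OF l(1)] by (simp add: pair_at_def)
  then show ?thesis using l(2) by simp
qed

end

section \<open>Vertex derivatives and finiteness of the support\<close>

lemma partite_limits_finite_sum:
  assumes x: "x \<in> partite_limits" and s: "supp x \<subseteq> {0..M}"
  shows "sum x {1..M} = 1 - x 0"
proof -
  have z: "x i = 0" if "i > M" for i
  proof -
    have "i \<notin> supp x" using s that by auto
    then show ?thesis using partite_limits_nonneg[OF x, of i] by (simp add: supp_def)
  qed
  have "(x has_sum (1 - x 0)) {1..}" using x by (simp add: partite_limits_def)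
  also have "(x has_sum (1 - x 0)) {1..} \<longleftrightarrow> (x has_sum (1 - x 0)) {1..M}"
    by (rule has_sum_cong_neutral) (auto simp: z)
  finally show ?thesis by (simp add: has_sum_finite_iff)
qed

lemma tail_merge_eq:
  assumes "x \<in> partite_limits" "supp x \<subseteq> {0..M}"
  shows "tail_merge M x = x"
  using partite_limits_finite_sum[OF assms] by (auto simp: tail_merge_def fun_eq_iff)

lemma supp_nonempty:
  assumes x: "x \<in> partite_limits"
  shows "supp x \<noteq> {}"
proof
  assume e: "supp x = {}"
  have "x i = 0" for i
  proof -
    have "i \<notin> supp x" using e by blast
    then show ?thesis using partite_limits_nonneg[OF x, of i] by (simp add: supp_def)
  qed
  then show False using partite_limits_finite_sum[OF x, of 0] e by simp
qed

lemma supp_1: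
  assumes x: "x \<in> partite_limits" and "i \<in> supp x" "i \<ge> 1"
  shows "1 \<in> supp x"
  using partite_limits_antimono[OF x, of 1 i] assms by (simp add: supp_def)

lemma add_vertex_facts:
  assumes dj: "disjoint_family P" and fin: "finite (\<Union>i. P i)" and u: "u \<notin> (\<Union>i. P i)"
    and \<alpha>: "0 \<le> \<alpha>" "\<alpha> \<le> 1"
  obtains A where "A \<subseteq> P 0" "card A = nat \<lfloor>\<alpha> * real (card (P 0))\<rfloor>"
    "fin_graph (add_vertex P b \<alpha> u)" "verts (add_vertex P b \<alpha> u) = insert u (\<Union>i. P i)"
    "del_vertex (add_vertex P b \<alpha> u) u = pg (\<Union>i. P i) (part_index P)"
    "\<And>v i. v \<in> P i \<Longrightarrow> {u, v} \<in> edges (add_vertex P b \<alpha> u) \<longleftrightarrow> (i \<noteq> 0 \<and> b i) \<or> v \<in> A"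
proof -
  let ?V = "\<Union>i. P i"
  define A where "A = (SOME A. A \<subseteq> P 0 \<and> card A = nat \<lfloor>\<alpha> * real (card (P 0))\<rfloor>)"
  have "\<alpha> * real (card (P 0)) \<le> 1 * real (card (P 0))" using \<alpha> by (intro mult_right_mono) auto
  then have "nat \<lfloor>\<alpha> * real (card (P 0))\<rfloor> \<le> card (P 0)" by linarith
  then obtain A' where "A' \<subseteq> P 0" "card A' = nat \<lfloor>\<alpha> * real (card (P 0))\<rfloor>"
    using obtain_subset_with_card_n by metis
  then have "\<exists>A. A \<subseteq> P 0 \<and> card A = nat \<lfloor>\<alpha> * real (card (P 0))\<rfloor>" by blast
  then have A: "A \<subseteq> P 0" "card A = nat \<lfloor>\<alpha> * real (card (P 0))\<rfloor>"
    unfolding A_def by (rule someI2_ex, blast)+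
  define N where "N = (\<Union>i\<in>{i. i \<ge> 1 \<and> b i}. P i) \<union> A"
  have NV: "N \<subseteq> ?V" using A(1) by (auto simp: N_def)
  let ?p = "pg ?V (part_index P)"
  have G: "add_vertex P b \<alpha> u = (insert u ?V, edges ?p \<union> {{u, v} | v. v \<in> N})"
    unfolding add_vertex_def Let_def A_def[symmetric] N_def[symmetric] partite_graph_index[OF dj] by simp
  have pE: "e \<subseteq> ?V" if "e \<in> edges ?p" for e using that by (auto simp: pg_def)
  have "fin_graph ?p" using fin by (rule fin_graph_pg)
  moreover have "card {u, v} = 2" if "v \<in> N" for v
    using that NV u by (cases "u = v") auto
  ultimately have fg: "fin_graph (add_vertex P b \<alpha> u)"
    unfolding G fin_graph_def using NV u by auto
  have dv: "del_vertex (add_vertex P b \<alpha> u) u = ?p"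
    unfolding G del_vertex_def induced_def using u pE by (auto simp: prod_eq_iff)
  have adj: "{u, v} \<in> edges (add_vertex P b \<alpha> u) \<longleftrightarrow> (i \<noteq> 0 \<and> b i) \<or> v \<in> A" if v: "v \<in> P i" for v i
  proof -
    have "{u, v} \<in> edges (add_vertex P b \<alpha> u) \<longleftrightarrow> v \<in> N"
      unfolding G using pE[of "{u, v}"] u v by (auto simp: doubleton_eq_iff)
    moreover have "v \<in> P j \<longleftrightarrow> j = i" for j using part_index[OF dj, of v] v by auto
    ultimately show ?thesis by (auto simp: N_def)
  qed
  show ?thesis by (rule that[OF A fg _ dv adj]) (simp_all add: G)
qed

text \<open>Limiting proportions of the types \<open>(i, q)\<close> seen from the attached vertex,
  \<open>q = 1\<close> marking its neighbours: a part lies wholly on one side, the universal class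
  is split according to \<open>\<alpha>\<close>.\<close>

definition attach_ratio :: "(nat \<Rightarrow> real) \<Rightarrow> (nat \<Rightarrow> bool) \<Rightarrow> real \<Rightarrow> nat \<times> nat \<Rightarrow> real" where
  "attach_ratio x b \<alpha> = (\<lambda>(i, q). if i = 0 then (if q = 1 then \<alpha> * x 0 else (1 - \<alpha>) * x 0)
     else if (q = 1) = b i then x i else 0)"

lemma attach_ratio_bounds:
  assumes x: "x \<in> partite_limits" and \<alpha>: "0 \<le> \<alpha>" "\<alpha> \<le> 1"
  shows "0 \<le> attach_ratio x b \<alpha> s \<and> attach_ratio x b \<alpha> s \<le> 1"
proof -
  have "0 \<le> x i" "x i \<le> 1" for i using partite_limits_nonneg[OF x] partite_limits_le_1[OF x] by auto
  then show ?thesis using \<alpha> mult_le_one[of \<alpha> "x 0"] mult_le_one[of "1 - \<alpha>" "x 0"]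
    by (cases s) (auto simp: attach_ratio_def)
qed

lemma attach_ratio_tendsto:
  assumes x: "x \<in> partite_limits" "supp x \<subseteq> {0..M}" and i: "i \<le> M" and q: "q \<in> {0, 1}"
    and \<alpha>: "0 \<le> \<alpha>" "\<alpha> \<le> 1" and u: "\<And>n. u n \<notin> (\<Union>i. realisation n x i)"
  shows "(\<lambda>n. ratio (\<Union>i. realisation n x i)
     (nbr_type (add_vertex (realisation n x) b \<alpha> (u n)) (u n) (part_index (realisation n x))) (i, q))
     \<longlonglongrightarrow> attach_ratio x b \<alpha> (i, q)"
proof -
  let ?P = "\<lambda>n. realisation n x"
  let ?V = "\<lambda>n. (\<Union>i. ?P n i)"
  let ?G = "\<lambda>n. add_vertex (?P n) b \<alpha> (u n)"
  let ?t = "\<lambda>n. nbr_type (?G n) (u n) (part_index (?P n))"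
  have P: "converges_to ?P x" by (rule converges_to_realisation[OF x(1)])
  have dj: "disjoint_family (?P n)" "finite (?V n)" "card (?V n) = n" for n
    using P realisation_facts(2)[OF x(1)] by (auto simp: converges_to_def)
  have fP: "finite (?P n i)" for n i using dj(2)[of n] by (rule rev_finite_subset) blast
  have mem: "v \<in> ?P n i \<longleftrightarrow> v \<in> ?V n \<and> part_index (?P n) v = i" for v n i
    using part_index_class[OF dj(1), of n i] by blast
  have lim: "(\<lambda>n. real (card (?P n i)) / real n) \<longlonglongrightarrow> x i" for i
  proof (cases "i = 0")
    case False then show ?thesis using realisation_ratio_tendsto[OF x(1), of i] by simp
  next
    case True
    \<comment> \<open>Convergence of realisations says nothing directly about \<open>P n 0\<close>.
      As parts of density zero are empty, no part beyond \<open>M\<close> occurs, truncation changes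
      nothing, and the proportion of the merged type is that of \<open>P n 0\<close>.\<close>
    have "ratio (?V n) (\<lambda>v. truncate M (part_index (?P n) v)) 0 = real (card (?P n 0)) / real n" for n
    proof -
      have "truncate M (part_index (?P n) v) = part_index (?P n) v" if "v \<in> ?V n" for v
      proof -
        from that obtain j where j: "v \<in> ?P n j" by blast
        then have "x j \<noteq> 0" using realisation_facts(5)[OF x(1), of j n] by auto
        then have "j \<in> supp x" using partite_limits_nonneg[OF x(1), of j] by (simp add: supp_def)
        then show ?thesis using x(2) part_index[OF dj(1) j] by (auto simp: truncate_def)
      qed
      then have "{v \<in> ?V n. truncate M (part_index (?P n) v) = 0} = {v \<in> ?V n. part_index (?P n) v = 0}"
        by (intro Collect_cong conj_cong refl) simp
      also have "\<dots> = ?P n 0" by (rule part_index_class[OF dj(1)])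
      finally have "{v \<in> ?V n. truncate M (part_index (?P n) v) = 0} = ?P n 0" .
      then show ?thesis by (simp add: ratio_def dj(3))
    qed
    then show ?thesis using truncated_ratio_tendsto[OF P, of 0 M] tail_merge_eq[OF x] True by simp
  qed
  show ?thesis
  proof (cases "i = 0")
    case False
    have "ratio (?V n) (?t n) (i, q) = (if (q = 1) = b i then real (card (?P n i)) / real n else 0)" for n
    proof -
      obtain A where A: "A \<subseteq> ?P n 0"
        "\<And>v i. v \<in> ?P n i \<Longrightarrow> {u n, v} \<in> edges (?G n) \<longleftrightarrow> (i \<noteq> 0 \<and> b i) \<or> v \<in> A"
        using add_vertex_facts[OF dj(1,2) u \<alpha>] by metis
      have "?t n v = (i, q) \<longleftrightarrow> v \<in> ?P n i \<and> (q = 1) = b i" if v: "v \<in> ?V n" for v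
      proof (cases "v \<in> ?P n i")
        case True
        then have "v \<notin> ?P n 0" using False mem[of v n i] mem[of v n 0] by simp
        then have "v \<notin> A" using A(1) by blast
        then have "{u n, v} \<in> edges (?G n) \<longleftrightarrow> b i" using A(2)[OF True] False by simp
        then show ?thesis using True mem[of v n i] q by (auto simp: nbr_type_def)
      next
        case f: False
        then show ?thesis using mem[of v n i] v by (auto simp: nbr_type_def)
      qed
      then have "{v \<in> ?V n. ?t n v = (i, q)} = (if (q = 1) = b i then ?P n i else {})"
        using mem[of _ n i] by auto
      then show ?thesis by (simp add: ratio_def dj(3))
    qed
    then show ?thesis using lim[of i] False by (simp add: attach_ratio_def)
  next
    case True
    let ?c = "\<lambda>n. real (card (?P n 0))"
    let ?a = "\<lambda>n. real (nat \<lfloor>\<alpha> * ?c n\<rfloor>)"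
    have eq: "ratio (?V n) (?t n) (0, q) = (if q = 1 then ?a n / real n else (?c n - ?a n) / real n)" for n
    proof -
      obtain A where A: "A \<subseteq> ?P n 0" "card A = nat \<lfloor>\<alpha> * ?c n\<rfloor>"
        "\<And>v i. v \<in> ?P n i \<Longrightarrow> {u n, v} \<in> edges (?G n) \<longleftrightarrow> (i \<noteq> 0 \<and> b i) \<or> v \<in> A"
        using add_vertex_facts[OF dj(1,2) u \<alpha>] by metis
      have "?t n v = (0, q) \<longleftrightarrow> v \<in> ?P n 0 \<and> (q = 1) = (v \<in> A)" if v: "v \<in> ?V n" for v
      proof (cases "v \<in> ?P n 0")
        case True
        then show ?thesis using mem[of v n 0] q A(3)[OF True] by (auto simp: nbr_type_def)
      next
        case f: False
        then show ?thesis using mem[of v n 0] v by (auto simp: nbr_type_def)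
      qed
      then have "{v \<in> ?V n. ?t n v = (0, q)} = (if q = 1 then A else ?P n 0 - A)"
        using mem[of _ n 0] A(1) by auto
      moreover have "finite A" using A(1) fP finite_subset by blast
      moreover have "card A \<le> card (?P n 0)" using A(1) fP by (rule card_mono[rotated])
      ultimately show ?thesis using A(1,2) by (simp add: ratio_def dj(3) card_Diff_subset of_nat_diff)
    qed
    have a: "(\<lambda>n. ?a n / real n) \<longlonglongrightarrow> \<alpha> * x 0"
    proof (rule tendsto_sandwich[of "\<lambda>n. \<alpha> * (?c n / real n) - 1 / real n" _ _ "\<lambda>n. \<alpha> * (?c n / real n)"])
      have nn: "0 \<le> \<alpha> * ?c n" for n using \<alpha> by simp
      have f: "\<alpha> * ?c n - 1 \<le> ?a n" "?a n \<le> \<alpha> * ?c n" for n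
        using nn[of n] by linarith+
      show "\<forall>\<^sub>F n in sequentially. \<alpha> * (?c n / real n) - 1 / real n \<le> ?a n / real n"
        using divide_right_mono[OF f(1) of_nat_0_le_iff] by (auto simp: diff_divide_distrib)
      show "\<forall>\<^sub>F n in sequentially. ?a n / real n \<le> \<alpha> * (?c n / real n)"
        using divide_right_mono[OF f(2) of_nat_0_le_iff] by auto
      show "(\<lambda>n. \<alpha> * (?c n / real n)) \<longlonglongrightarrow> \<alpha> * x 0" by (intro tendsto_intros lim)
      have "(\<lambda>n. \<alpha> * (?c n / real n) - 1 / real n) \<longlonglongrightarrow> \<alpha> * x 0 - 0"
        by (intro tendsto_intros lim lim_1_over_n)
      then show "(\<lambda>n. \<alpha> * (?c n / real n) - 1 / real n) \<longlonglongrightarrow> \<alpha> * x 0" by simp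
    qed
    show ?thesis
    proof (cases "q = 1")
      case True
      then show ?thesis using a eq \<open>i = 0\<close> by (simp add: attach_ratio_def)
    next
      case False
      have "(\<lambda>n. ?c n / real n - ?a n / real n) \<longlonglongrightarrow> x 0 - \<alpha> * x 0" by (intro tendsto_diff a lim)
      moreover have "ratio (?V n) (?t n) (i, q) = ?c n / real n - ?a n / real n" for n
        using eq[of n] False \<open>i = 0\<close> by (simp add: diff_divide_distrib)
      moreover have "attach_ratio x b \<alpha> (i, q) = x 0 - \<alpha> * x 0"
        using False \<open>i = 0\<close> by (simp add: attach_ratio_def left_diff_distrib)
      ultimately show ?thesis by simp
    qed
  qed
qed

section \<open>Vertex derivatives as differences of densities\<close>

context graph_param begin

text \<open>Sets avoiding \<open>z\<close> induce the same subgraph in both graphs, so a change of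
  one neighbourhood is seen by the sums rooted there alone.\<close>

lemma Lambda_vertex:
  assumes V: "finite (verts G)" "verts G' = verts G" and d: "del_vertex G z = del_vertex G' z"
  shows "\<Lambda> G - \<Lambda> G' = rs G {z} - rs G' {z}"
proof -
  let ?A = "{X. X \<subseteq> verts G \<and> card X = k}" and ?T = "{X. {z} \<subseteq> X \<and> X \<subseteq> verts G \<and> card X = k}"
  have fin: "finite ?A" using V by (auto intro: finite_subset[of _ "Pow (verts G)"])
  have "(\<Sum>X\<in>?A. \<gamma> (induced G X) - \<gamma> (induced G' X)) = (\<Sum>X\<in>?T. \<gamma> (induced G X) - \<gamma> (induced G' X))"
  proof (rule sum.mono_neutral_right[OF fin])
    show "\<forall>X\<in>?A - ?T. \<gamma> (induced G X) - \<gamma> (induced G' X) = 0"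
    proof
      fix X assume X: "X \<in> ?A - ?T"
      have eq: "{e \<in> edges H. e \<subseteq> X} = {e \<in> edges (del_vertex H z). e \<subseteq> X}" if "verts H = verts G" for H
        using X that by (auto simp: del_vertex_def induced_def)
      have "induced G X = induced G' X" unfolding induced_def using eq[of G] eq[of G'] V(2) d by simp
      then show "\<gamma> (induced G X) - \<gamma> (induced G' X) = 0" by simp
    qed
  qed auto
  then show ?thesis by (simp add: Lambda_def rsum_def sum_subtractf V(2))
qed

text \<open>Finite support leaves finitely many types, so the derivative is an exact difference of
  singly rooted densities. In this form it can be compared with graphs that are merely close to a
  realisation.\<close>

lemma nabla_vertex_lim_eq:
  assumes x: "x \<in> partite_limits" "supp x \<subseteq> {0..M}" and \<alpha>: "0 \<le> \<alpha>" "\<alpha> \<le> 1"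
  shows "nabla_vertex_lim k \<gamma> b \<alpha> x = dens1 M (attach_ratio x (e_vec 1) 1) - dens1 M (attach_ratio x b \<alpha>)"
proof -
  let ?P = "\<lambda>n. realisation n x"
  let ?V = "\<lambda>n. (\<Union>i. ?P n i)"
  define u where "u n = (SOME u. u \<notin> ?V n)" for n
  have P: "converges_to ?P x" by (rule converges_to_realisation[OF x(1)])
  have dj: "disjoint_family (?P n)" "finite (?V n)" "card (?V n) = n" for n
    using P realisation_facts(2)[OF x(1)] by (auto simp: converges_to_def)
  have u: "u n \<notin> ?V n" for n
    unfolding u_def using ex_new_if_finite[OF infinite_UNIV_nat dj(2)[of n]] by (rule someI_ex)
  have lim: "(\<lambda>n. rs (add_vertex (?P n) b \<alpha> (u n)) {u n} / real (n choose (k - 1))) \<longlonglongrightarrow> dens1 M (attach_ratio x b \<alpha>)"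
    if \<alpha>: "0 \<le> \<alpha>" "\<alpha> \<le> 1" for b \<alpha>
  proof (rule LIMSEQ_I)
    fix r :: real assume "r > 0"
    then have "r / 2 > 0" by simp
    from vertex_near[OF this, of M] obtain \<delta> N where d: "\<delta> > 0" and near: "\<And>G z \<tau> y. \<lbrakk>fin_graph G; z \<in> verts G; del_vertex G z = pg (verts G - {z}) \<tau>;
     order G > N; \<tau> ` (verts G - {z}) \<subseteq> {0..M};
     \<And>i q. i \<le> M \<Longrightarrow> q \<in> {0, 1} \<Longrightarrow>
       0 \<le> y (i, q) \<and> y (i, q) \<le> 1 \<and> \<bar>ratio (verts G - {z}) (nbr_type G z \<tau>) (i, q) - y (i, q)\<bar> \<le> \<delta>\<rbrakk>
    \<Longrightarrow> \<bar>rs G {z} / real (order G - 1 choose (k - 1)) - dens1 M y\<bar> \<le> r / 2" by metis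
    let ?G = "\<lambda>n. add_vertex (?P n) b \<alpha> (u n)"
    let ?t = "\<lambda>n. nbr_type (?G n) (u n) (part_index (?P n))"
    have "\<forall>\<^sub>F n in sequentially. \<forall>s\<in>{0..M} \<times> {0, 1}. \<bar>ratio (?V n) (?t n) s - attach_ratio x b \<alpha> s\<bar> \<le> \<delta>"
    proof (subst eventually_ball_finite_distrib)
      show "\<forall>s\<in>{0..M} \<times> {0, 1}. \<forall>\<^sub>F n in sequentially. \<bar>ratio (?V n) (?t n) s - attach_ratio x b \<alpha> s\<bar> \<le> \<delta>"
      proof
        fix s assume "s \<in> {0..M} \<times> {0, 1 :: nat}"
        then have "(\<lambda>n. ratio (?V n) (?t n) s) \<longlonglongrightarrow> attach_ratio x b \<alpha> s"
          using attach_ratio_tendsto[OF x _ _ \<alpha> u, of "fst s" "snd s" b] by auto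
        from tendstoD[OF this d] show "\<forall>\<^sub>F n in sequentially. \<bar>ratio (?V n) (?t n) s - attach_ratio x b \<alpha> s\<bar> \<le> \<delta>"
          by eventually_elim (simp add: dist_real_def)
      qed
    qed simp
    with eventually_ge_at_top[of N]
    have "\<forall>\<^sub>F n in sequentially. norm (rs (?G n) {u n} / real (n choose (k - 1)) - dens1 M (attach_ratio x b \<alpha>)) < r"
    proof eventually_elim
      case (elim n)
      have G: "fin_graph (?G n)" "verts (?G n) = insert (u n) (?V n)" "del_vertex (?G n) (u n) = pg (?V n) (part_index (?P n))"
        using add_vertex_facts[OF dj(1,2) u \<alpha>, of n b] by metis+
      have VV: "verts (?G n) - {u n} = ?V n" using G(2) u by auto
      have o: "order (?G n) = Suc n" using G(2) u dj(2,3)[of n] by simp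
      have "\<bar>rs (?G n) {u n} / real (order (?G n) - 1 choose (k - 1)) - dens1 M (attach_ratio x b \<alpha>)\<bar> \<le> r / 2"
      proof (rule near)
        show "fin_graph (?G n)" by (rule G)
        show "u n \<in> verts (?G n)" using G(2) by simp
        show "del_vertex (?G n) (u n) = pg (verts (?G n) - {u n}) (part_index (?P n))" unfolding VV by (rule G)
        show "order (?G n) > N" using o elim by simp
        show "part_index (?P n) ` (verts (?G n) - {u n}) \<subseteq> {0..M}"
        proof (unfold VV, intro subsetI)
          fix i assume "i \<in> part_index (?P n) ` ?V n"
          then obtain v j where vj: "v \<in> ?P n j" "i = part_index (?P n) v" by blast
          then have "x j \<noteq> 0" using realisation_facts(5)[OF x(1), of j n] by auto
          then have "j \<in> supp x" using partite_limits_nonneg[OF x(1), of j] by (simp add: supp_def)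
          then show "i \<in> {0..M}" using x(2) part_index[OF dj(1) vj(1)] vj by auto
        qed
        show "0 \<le> attach_ratio x b \<alpha> (i, q) \<and> attach_ratio x b \<alpha> (i, q) \<le> 1 \<and>
          \<bar>ratio (verts (?G n) - {u n}) (?t n) (i, q) - attach_ratio x b \<alpha> (i, q)\<bar> \<le> \<delta>" if "i \<le> M" "q \<in> {0, 1}" for i q
          unfolding VV using elim that attach_ratio_bounds[OF x(1) \<alpha>] by auto
      qed
      then show ?case using o \<open>r > 0\<close> by simp
    qed
    then show "\<exists>no. \<forall>n\<ge>no. norm (rs (?G n) {u n} / real (n choose (k - 1)) - dens1 M (attach_ratio x b \<alpha>)) < r"
      by (simp add: eventually_sequentially)
  qed
  have "nabla_vertex k \<gamma> b \<alpha> (?P n) = rs (add_vertex (?P n) (e_vec 1) 1 (u n)) {u n} / real (n choose (k - 1))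
      - rs (add_vertex (?P n) b \<alpha> (u n)) {u n} / real (n choose (k - 1))" for n
  proof -
    have G: "fin_graph (add_vertex (?P n) b \<alpha> (u n))" "verts (add_vertex (?P n) b \<alpha> (u n)) = insert (u n) (?V n)"
      "del_vertex (add_vertex (?P n) b \<alpha> (u n)) (u n) = pg (?V n) (part_index (?P n))" if "0 \<le> \<alpha>" "\<alpha> \<le> 1" for b \<alpha>
      using add_vertex_facts[OF dj(1,2) u that, of n b] by metis+
    have "\<Lambda> (add_vertex (?P n) (e_vec 1) 1 (u n)) - \<Lambda> (add_vertex (?P n) b \<alpha> (u n))
      = rs (add_vertex (?P n) (e_vec 1) 1 (u n)) {u n} - rs (add_vertex (?P n) b \<alpha> (u n)) {u n}"
      using G[of 1 "e_vec 1"] G[OF \<alpha>, of b] dj(2)[of n] by (intro Lambda_vertex) auto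
    then show ?thesis
      unfolding nabla_vertex_def Let_def partite_graph_index[OF dj(1)] verts_pg u_def[symmetric] dj(3)
      by (simp add: diff_divide_distrib)
  qed
  then have "(\<lambda>n. nabla_vertex k \<gamma> b \<alpha> (?P n)) \<longlonglongrightarrow> dens1 M (attach_ratio x (e_vec 1) 1) - dens1 M (attach_ratio x b \<alpha>)"
    using tendsto_diff[OF lim[of 1 "e_vec 1"] lim[OF \<alpha>, of b]] by simp
  then show ?thesis unfolding nabla_vertex_lim_def by (rule limI)
qed

text \<open>For \<open>k = 1\<close> no \<open>k\<close>-set contains two vertices, so all pair
  derivatives vanish, contrary to the positive lower bound at some index of the nonempty
  support.\<close>

lemma str1_k_ge_2:
  assumes x: "x \<in> partite_limits" and s: "str1 k \<gamma> c x" "c > 0"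
  shows "k \<ge> 2"
proof (rule ccontr)
  assume "\<not> k \<ge> 2"
  then have k1: "k = 1" using k_pos by simp
  obtain i where i: "i \<in> supp x" using supp_nonempty[OF x] by blast
  then have xi: "x i > 0" by (simp add: supp_def)
  have rs0: "rs G {u, v} = 0" if "u \<noteq> v" for G u v
  proof -
    have "{X. {u, v} \<subseteq> X \<and> X \<subseteq> verts G \<and> card X = k} = {}"
      using that k1 by (auto simp: card_1_singleton_iff)
    then show ?thesis unfolding rsum_def by (simp only: sum.empty)
  qed
  have "\<forall>\<^sub>F n in sequentially. nabla_pair k \<gamma> (partite_graph (realisation n x)) (fst (pair_at x i i n)) (snd (pair_at x i i n)) = 0"
    using pair_at[OF x xi xi]
  proof eventually_elim
    case (elim n)
    have "finite (verts (partite_graph (realisation n x)))"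
      using realisation_facts(2)[OF x, of n] by (simp add: partite_graph_def)
    then show ?case using elim by (simp add: nabla_pair_def Lambda_flip rs0)
  qed
  then have "(\<lambda>n. nabla_pair k \<gamma> (partite_graph (realisation n x)) (fst (pair_at x i i n)) (snd (pair_at x i i n))) \<longlonglongrightarrow> 0"
    by (rule tendsto_eventually)
  then have "nabla_pair_lim k \<gamma> x i i = 0"
    unfolding nabla_pair_lim_def Let_def by (intro limI) (simp add: pair_at_def)
  moreover have "nabla_pair_lim k \<gamma> x i i \<ge> c" using s(1) i unfolding str1_def by blast
  ultimately show False using s(2) by simp
qed

text \<open>With the adjacency \<open>c\<close> of the roots fixed, root types \<open>(i, i)\<close>
  and \<open>(i, j)\<close> can be told apart only by a further vertex of type \<open>i\<close> or
  \<open>j\<close>. Sampling one has weight at most \<open>k * (y i + y j)\<close>, and a differing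
  pattern costs at most \<open>2 * B\<close>.\<close>

lemma dens2_similar:
  assumes k2: "k \<ge> 2" and y: "\<And>a. a \<le> M \<Longrightarrow> 0 \<le> y a" "sum y {0..M} = 1"
    and ij: "1 \<le> i" "1 \<le> j" "i \<le> M" "j \<le> M"
  shows "\<bar>dens2 M y i i c - dens2 M y i j c\<bar> \<le> 2 * B * real k * (y i + y j)"
proof -
  let ?S = "{0..M} \<times> {0 :: nat}" and ?I = "{2..<k}"
  let ?F = "?I \<rightarrow>\<^sub>E ?S"
  let ?p = "\<lambda>b t. pattern k (Q2 c) (\<lambda>l. if l < 2 then (if l = 0 then (i, 1) else (b, 2)) else t l)"
  \<comment> \<open>\<open>h l\<close> is the weight in which position \<open>l\<close> is forced to
    have type \<open>i\<close> or \<open>j\<close>. The sum over \<open>l\<close> of the resulting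
    products dominates the weight of the tuples that matter, and each product factorises over the
    positions.\<close>
  define h where "h l m s = y (fst s) * (if m = l then of_bool (fst s = i \<or> fst s = j) else 1)" for l m :: nat and s :: "nat \<times> nat"
  have fin: "finite ?F" by (auto intro: finite_PiE)
  have tS: "fst (t l) \<le> M" "snd (t l) = 0" if "t \<in> ?F" "l \<in> ?I" for t l
    using that by (auto simp: PiE_iff mem_Times_iff)
  have sumS: "sum f ?S = (\<Sum>a\<in>{0..M}. f (a, 0))" for f :: "nat \<times> nat \<Rightarrow> real"
  proof -
    have "?S = (\<lambda>a. (a, 0)) ` {0..M}" by auto
    moreover have "inj_on (\<lambda>a. (a, 0 :: nat)) {0..M}" by (auto simp: inj_on_def)
    ultimately show ?thesis by (simp only: sum.reindex o_def)
  qed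
  have S1: "(\<Sum>s\<in>?S. y (fst s)) = 1"
    using y(2) by (simp add: sumS)
  have S2: "(\<Sum>s\<in>?S. y (fst s) * of_bool (fst s = i \<or> fst s = j)) \<le> y i + y j"
  proof -
    have "(\<Sum>s\<in>?S. y (fst s) * of_bool (fst s = i \<or> fst s = j)) = (\<Sum>a\<in>{0..M}. y a * of_bool (a = i \<or> a = j))"
      by (simp add: sumS)
    also have "\<dots> \<le> (\<Sum>a\<in>{0..M}. (if a = i then y a else 0) + (if a = j then y a else 0))"
      by (rule sum_mono) (use y(1) in auto)
    also have "\<dots> = y i + y j" using ij by (simp add: sum.distrib)
    finally show ?thesis .
  qed
  have h0: "h l m s \<ge> 0" if "s \<in> ?S" for l m s unfolding h_def using y(1) that by auto
  have key: "\<bar>\<gamma> (?p i t) - \<gamma> (?p j t)\<bar> * (\<Prod>m\<in>?I. y (fst (t m))) \<le> 2 * B * (\<Sum>l\<in>?I. \<Prod>m\<in>?I. h l m (t m))"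
    if t: "t \<in> ?F" for t
  proof (cases "\<exists>l\<in>?I. fst (t l) = i \<or> fst (t l) = j")
    case True
    then obtain l where l: "l \<in> ?I" "fst (t l) = i \<or> fst (t l) = j" by blast
    have "(\<Prod>m\<in>?I. y (fst (t m))) = (\<Prod>m\<in>?I. h l m (t m))"
      by (rule prod.cong) (use l in \<open>auto simp: h_def\<close>)
    also have "\<dots> = (\<Sum>l\<in>{l}. \<Prod>m\<in>?I. h l m (t m))" by simp
    also have "\<dots> \<le> (\<Sum>l\<in>?I. \<Prod>m\<in>?I. h l m (t m))"
      using l t h0 by (intro sum_mono2 prod_nonneg) (auto simp: PiE_iff)
    finally have 1: "(\<Prod>m\<in>?I. y (fst (t m))) \<le> (\<Sum>l\<in>?I. \<Prod>m\<in>?I. h l m (t m))" .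
    have 2: "\<bar>\<gamma> (?p i t) - \<gamma> (?p j t)\<bar> \<le> 2 * B"
      using bound_pattern[of "Q2 c" "\<lambda>l. if l < 2 then (if l = 0 then (i, 1) else (i, 2)) else t l"]
        bound_pattern[of "Q2 c" "\<lambda>l. if l < 2 then (if l = 0 then (i, 1) else (j, 2)) else t l"] by linarith
    show ?thesis using 1 2 tS[OF t] y(1) B_pos by (intro mult_mono prod_nonneg) auto
  next
    case False
    have "?p i t = ?p j t"
    proof -
      have "Q2 c (if l < 2 then (if l = 0 then (i, 1) else (i, 2)) else t l) (if m < 2 then (if m = 0 then (i, 1) else (i, 2)) else t m)
        \<longleftrightarrow> Q2 c (if l < 2 then (if l = 0 then (i, 1) else (j, 2)) else t l) (if m < 2 then (if m = 0 then (i, 1) else (j, 2)) else t m)"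
        if lm: "l < k" "m < k" "l \<noteq> m" for l m
      proof -
        have a: "fst (t l) \<noteq> i" "fst (t l) \<noteq> j" "snd (t l) = 0" if "\<not> l < 2" "l < k" for l
          using False tS(2)[OF t, of l] that by auto
        consider "l < 2" "m < 2" | "l < 2" "\<not> m < 2" | "\<not> l < 2" "m < 2" | "\<not> l < 2" "\<not> m < 2" by blast
        then show ?thesis
        proof cases
          case 1 then show ?thesis using lm by (auto simp: Q2_def)
        next
          case 2 then show ?thesis using a[of m] lm ij by (auto simp: Q2_def adj_def)
        next
          case 3 then show ?thesis using a[of l] lm ij by (auto simp: Q2_def adj_def)
        next
          case 4 then show ?thesis by simp
        qed
      qed
      then show ?thesis unfolding pattern_def by (intro arg_cong[where f = "Pair {..<k}"] Collect_cong) blast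
    qed
    moreover have "0 \<le> 2 * B * (\<Sum>l\<in>?I. \<Prod>m\<in>?I. h l m (t m))"
      using t h0 B_pos by (intro mult_nonneg_nonneg sum_nonneg prod_nonneg) (auto simp: PiE_iff)
    ultimately show ?thesis by simp
  qed
  have "\<bar>dens2 M y i i c - dens2 M y i j c\<bar> = \<bar>\<Sum>t\<in>?F. (\<gamma> (?p i t) - \<gamma> (?p j t)) * (\<Prod>m\<in>?I. y (fst (t m)))\<bar>"
    unfolding dens_def sum_subtractf[symmetric] left_diff_distrib ..
  also have "\<dots> \<le> (\<Sum>t\<in>?F. \<bar>(\<gamma> (?p i t) - \<gamma> (?p j t)) * (\<Prod>m\<in>?I. y (fst (t m)))\<bar>)" by (rule sum_abs)
  also have "\<dots> = (\<Sum>t\<in>?F. \<bar>\<gamma> (?p i t) - \<gamma> (?p j t)\<bar> * (\<Prod>m\<in>?I. y (fst (t m))))"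
  proof (intro sum.cong refl)
    fix t assume t: "t \<in> ?F"
    have "0 \<le> (\<Prod>m\<in>?I. y (fst (t m)))" using tS(1)[OF t] y(1) by (intro prod_nonneg) auto
    then show "\<bar>(\<gamma> (?p i t) - \<gamma> (?p j t)) * (\<Prod>m\<in>?I. y (fst (t m)))\<bar> = \<bar>\<gamma> (?p i t) - \<gamma> (?p j t)\<bar> * (\<Prod>m\<in>?I. y (fst (t m)))"
      unfolding abs_mult by simp
  qed
  also have "\<dots> \<le> (\<Sum>t\<in>?F. 2 * B * (\<Sum>l\<in>?I. \<Prod>m\<in>?I. h l m (t m)))" by (rule sum_mono) (rule key)
  also have "\<dots> = 2 * B * (\<Sum>l\<in>?I. \<Sum>t\<in>?F. \<Prod>m\<in>?I. h l m (t m))"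
    unfolding sum_distrib_left[symmetric] by (subst sum.swap) (rule refl)
  also have "\<dots> = 2 * B * (\<Sum>l\<in>?I. \<Prod>m\<in>?I. \<Sum>s\<in>?S. h l m s)"
    by (subst prod_sum_PiE) auto
  also have "\<dots> \<le> 2 * B * (\<Sum>l\<in>?I. y i + y j)"
  proof (intro mult_left_mono sum_mono)
    fix l assume l: "l \<in> ?I"
    have "(\<Prod>m\<in>?I. \<Sum>s\<in>?S. h l m s) = (\<Sum>s\<in>?S. h l l s) * (\<Prod>m\<in>?I - {l}. \<Sum>s\<in>?S. h l m s)"
      by (rule prod.remove) (use l in auto)
    also have "(\<Prod>m\<in>?I - {l}. \<Sum>s\<in>?S. h l m s) = 1"
      by (rule prod.neutral) (use S1 in \<open>auto simp: h_def\<close>)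
    finally show "(\<Prod>m\<in>?I. \<Sum>s\<in>?S. h l m s) \<le> y i + y j" using S2 by (simp add: h_def)
  qed (use B_pos in auto)
  also have "\<dots> \<le> 2 * B * (real k * (y i + y j))"
    using B_pos y(1)[OF ij(3)] y(1)[OF ij(4)] by (auto intro!: mult_right_mono)
  finally show ?thesis by (simp add: mult.assoc)
qed

text \<open>Inside a tiny part a missing pair and between two tiny parts an edge are flipped into each
  other, so infinitely many parts would force the two pair derivatives to cancel in the limit.\<close>

lemma str1_finite_supp:
  assumes x: "x \<in> partite_limits" and s: "str1 k \<gamma> c x" "c > 0"
  shows "finite (supp x)"
proof (rule ccontr)
  assume inf: "infinite (supp x)"
  have k2: "k \<ge> 2" by (rule str1_k_ge_2[OF x s])
  \<comment> \<open>\<open>N\<close> is so large that two parts beyond it satisfy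
    \<open>4 * B * k * (x i + x j) < c\<close>.\<close>
  obtain N where N: "8 * B * real k / c < real N" using reals_Archimedean2 by blast
  have big: "\<exists>i\<in>supp x. i > m" for m :: nat
    using inf by (metis finite_nat_set_iff_bounded_le linorder_not_le)
  obtain i where i: "i \<in> supp x" "i > N" using big by blast
  obtain j where j: "j \<in> supp x" "j > i" using big by blast
  have pos: "x i > 0" "x j > 0" using i j by (auto simp: supp_def)
  have "8 * B * real k / c > 0" using s(2) B_pos k_pos by simp
  with N have N0: "real N > 0" by linarith
  have small: "x l \<le> 1 / real N" if "l > N" for l
  proof -
    have "real N * x l \<le> real l * x l" using that pos partite_limits_nonneg[OF x] by (intro mult_right_mono) auto
    then have "real N * x l \<le> 1" using partite_limits_decay[OF x, of l] by linarith
    then show ?thesis using N0 by (simp add: field_simps)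
  qed
  have "\<forall>\<^sub>F M in sequentially. ddiff M (tail_merge M x) i i + ddiff M (tail_merge M x) i j \<le> 4 * B * real k * (x i + x j)"
    using eventually_ge_at_top[of j]
  proof eventually_elim
    case (elim M)
    have M: "1 \<le> i" "1 \<le> j" "i \<le> M" "j \<le> M" using elim i j by auto
    have s1: "sum (tail_merge M x) {0..M} = 1"
    proof -
      have "{0..M} = insert 0 {1..M}" by auto
      moreover have "sum (tail_merge M x) {1..M} = sum x {1..M}" by (rule sum.cong) (auto simp: tail_merge_def)
      ultimately show ?thesis by (simp add: tail_merge_def)
    qed
    have e: "tail_merge M x i = x i" "tail_merge M x j = x j" using M by (auto simp: tail_merge_def)
    have a: "adj i i = False" "adj i j = True" using M j by (auto simp: adj_def)
    have "0 \<le> tail_merge M x l" for l using tail_merge_bounds[OF x] by blast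
    \<comment> \<open>Inside part \<open>i\<close> a pair is a non-edge, between \<open>i\<close>
      and \<open>j\<close> an edge. Adding the two derivatives matches terms of equal root
      adjacency, and \<open>D\<close> is applied once for each adjacency.\<close>
    note D = dens2_similar[OF k2 this s1 M, unfolded e]
    show ?case using D[of True] D[of False] unfolding a not_True_eq_False not_False_eq_True
      by linarith
  qed
  moreover have "(\<lambda>M. ddiff M (tail_merge M x) i i + ddiff M (tail_merge M x) i j) \<longlonglongrightarrow>
    nabla_pair_lim k \<gamma> x i i + nabla_pair_lim k \<gamma> x i j"
    using nabla_pair_lim_approx[OF k2 x] pos by (intro tendsto_add) auto
  ultimately have "nabla_pair_lim k \<gamma> x i i + nabla_pair_lim k \<gamma> x i j \<le> 4 * B * real k * (x i + x j)"
    by (intro tendsto_upperbound) auto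
  moreover have "nabla_pair_lim k \<gamma> x i i \<ge> c" "nabla_pair_lim k \<gamma> x i j \<ge> c"
    using s(1) i j by (auto simp: str1_def)
  moreover have "4 * B * real k * (x i + x j) \<le> 4 * B * real k * (2 / real N)"
    using small[of i] small[of j] i j B_pos by (intro mult_left_mono) auto
  moreover have "4 * B * real k * (2 / real N) < c" using N N0 s(2) by (simp add: field_simps)
  ultimately show False using s(2) by linarith
qed

end

section \<open>Compactness\<close>

text \<open>Listing the parts by decreasing size makes limits of the proportions antitone, as a
  partite limit requires. Universal vertices appear here as parts of size one, and
  \<open>P 0\<close> is empty.\<close>

lemma complete_partite_sorted:
  assumes H: "complete_partite H"
  obtains P where "disjoint_family P" "(\<Union>i. P i) = verts H" "partite_graph P = H" "P 0 = {}"
    "\<And>i. i \<ge> 1 \<Longrightarrow> card (P (Suc i)) \<le> card (P i)"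
proof -
  obtain \<P> where fg: "fin_graph H" and part: "partition_on (verts H) \<P>"
    and E: "edges H = {{x, y} | x y. \<exists>A\<in>\<P>. \<exists>B\<in>\<P>. A \<noteq> B \<and> x \<in> A \<and> y \<in> B}"
    using H unfolding complete_partite_def complete_partite_on_def by (elim exE conjE)
  have fV: "finite (verts H)" using fg by (simp add: fin_graph_def)
  have "finite \<P>" using finite_elements[OF fV part] .
  then obtain xs where xs: "set xs = \<P>" "distinct xs" using finite_distinct_list by blast
  define ys where "ys = sort_key (\<lambda>A. - int (card A)) xs"
  have ys: "set ys = \<P>" "distinct ys" "sorted (map (\<lambda>A. - int (card A)) ys)"
    using xs by (simp_all add: ys_def)
  define P where "P i = (if 1 \<le> i \<and> i \<le> length ys then ys ! (i - 1) else {})" for i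
  have Pmem: "P i \<in> \<P>" if "1 \<le> i" "i \<le> length ys" for i
  proof -
    have "ys ! (i - 1) \<in> set ys" by (rule nth_mem) (use that in linarith)
    then show ?thesis using that ys(1) by (simp add: P_def)
  qed
  have Pex: "\<exists>i. 1 \<le> i \<and> i \<le> length ys \<and> P i = A" if A: "A \<in> \<P>" for A
  proof -
    from A have "A \<in> set ys" using ys(1) by simp
    then obtain l where "l < length ys" "ys ! l = A" by (auto simp: in_set_conv_nth)
    then show ?thesis by (intro exI[of _ "Suc l"]) (simp add: P_def)
  qed
  have Pne: "1 \<le> i \<and> i \<le> length ys" if "v \<in> P i" for v i
    using that by (auto simp: P_def split: if_splits)
  have inj: "i = j" if "P i = P j" "v \<in> P i" for v i j
  proof -
    have i: "1 \<le> i \<and> i \<le> length ys" "1 \<le> j \<and> j \<le> length ys" using Pne that by auto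
    then have "ys ! (i - 1) = ys ! (j - 1)" using that(1) by (simp add: P_def)
    then have "i - 1 = j - 1" using nth_eq_iff_index_eq[OF ys(2), of "i - 1" "j - 1"] i by auto
    then show ?thesis using i by linarith
  qed
  have dis: "A \<inter> B = {}" if "A \<in> \<P>" "B \<in> \<P>" "A \<noteq> B" for A B
    using partition_onD2[OF part] that by (auto simp: disjoint_def)
  have uniq: "i = j" if "v \<in> P i" "v \<in> P j" for v i j
  proof -
    have "P i \<in> \<P>" "P j \<in> \<P>" using Pmem Pne that by blast+
    then have "P i = P j" using dis that by blast
    then show ?thesis using inj that by blast
  qed
  have dj: "disjoint_family P" unfolding disjoint_family_on_def using uniq by blast
  have un: "(\<Union>i. P i) = verts H"
  proof -
    have "(\<Union>i. P i) = \<Union>\<P>"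
    proof (intro equalityI subsetI)
      fix v assume "v \<in> (\<Union>i. P i)"
      then obtain i where "v \<in> P i" by blast
      then show "v \<in> \<Union>\<P>" using Pmem[of i] Pne by blast
    next
      fix v assume "v \<in> \<Union>\<P>"
      then show "v \<in> (\<Union>i. P i)" using Pex by blast
    qed
    then show ?thesis using partition_onD1[OF part] by simp
  qed
  have P0: "P 0 = {}" by (simp add: P_def)
  have "snd (partite_graph P) = edges H"
  proof (intro equalityI subsetI)
    fix e assume "e \<in> snd (partite_graph P)"
    then obtain u v i j where *: "e = {u, v}" "u \<noteq> v" "u \<in> P i" "v \<in> P j" "i \<noteq> j \<or> i = 0"
      by (auto simp: partite_graph_def)
    then have "i \<noteq> j" using P0 by auto
    then have "P i \<noteq> P j" using inj * by blast
    moreover have "P i \<in> \<P>" "P j \<in> \<P>" using Pmem Pne * by blast+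
    ultimately show "e \<in> edges H" unfolding E using * by blast
  next
    fix e assume "e \<in> edges H"
    then obtain x y A B where *: "e = {x, y}" "A \<in> \<P>" "B \<in> \<P>" "A \<noteq> B" "x \<in> A" "y \<in> B" unfolding E by blast
    obtain i j where ij: "P i = A" "P j = B" using Pex * by blast
    then have "i \<noteq> j" using * by auto
    moreover have "x \<noteq> y" using dis * by blast
    ultimately show "e \<in> snd (partite_graph P)"
      unfolding partite_graph_def snd_conv using * ij by blast
  qed
  then have pH: "partite_graph P = H" using un by (simp add: prod_eq_iff partite_graph_def)
  have "card (P (Suc i)) \<le> card (P i)" if "i \<ge> 1" for i
  proof (cases "Suc i \<le> length ys")
    case True
    have "map (\<lambda>A. - int (card A)) ys ! (i - 1) \<le> map (\<lambda>A. - int (card A)) ys ! i"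
      by (rule sorted_nth_mono[OF ys(3)]) (use True in auto)
    then show ?thesis using True that by (simp add: P_def)
  next
    case False
    then show ?thesis by (simp add: P_def)
  qed
  then show ?thesis using that[OF dj un pH P0] by blast
qed

lemma diagonal_convergent:
  fixes f :: "nat \<Rightarrow> nat \<Rightarrow> real"
  assumes f: "\<And>j i. 0 \<le> f j i \<and> f j i \<le> 1"
  obtains r where "strict_mono r" "\<And>i. convergent (\<lambda>j. f (r j) i)"
proof -
  interpret subseqs "\<lambda>i s. convergent (\<lambda>j. f (s j) i)"
  proof
    fix n and s :: "nat \<Rightarrow> nat" assume "strict_mono s"
    have "compact {0..1 :: real}" by simp
    then have "seq_compact {0..1 :: real}" by (simp add: compact_eq_seq_compact_metric)
    then obtain l r where "strict_mono r" "((\<lambda>j. f (s j) n) \<circ> r) \<longlonglongrightarrow> l"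
      using f by (metis (no_types, lifting) seq_compactE atLeastAtMost_iff)
    then show "\<exists>r'. strict_mono r' \<and> convergent (\<lambda>j. f ((s \<circ> r') j) n)"
      by (auto simp: convergent_def o_def)
  qed
  have "convergent (\<lambda>j. f (diagseq j) i)" for i
  proof -
    \<comment> \<open>The diagonal sequence is a subsequence of the one chosen for coordinate
      \<open>i\<close> only from index \<open>Suc i\<close> on, whence the shift.\<close>
    have "convergent (\<lambda>j. f ((diagseq \<circ> ((+) (Suc i))) j) i)"
    proof (rule diagseq_holds)
      fix r s :: "nat \<Rightarrow> nat" and n assume "strict_mono r" "convergent (\<lambda>j. f (s j) n)"
      then show "convergent (\<lambda>j. f ((s \<circ> r) j) n)"
        using convergent_subseq_convergent[of "\<lambda>j. f (s j) n" r] by (simp add: o_def)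
    qed
    then obtain l where "(\<lambda>j. f (diagseq (j + Suc i)) i) \<longlonglongrightarrow> l"
      by (auto simp: convergent_def o_def add.commute)
    then have "(\<lambda>j. f (diagseq j) i) \<longlonglongrightarrow> l" by (rule LIMSEQ_offset)
    then show ?thesis by (auto simp: convergent_def)
  qed
  then show ?thesis using that[OF subseq_diagseq] by blast
qed

lemma card_parts_sum_le:
  assumes "disjoint_family P" "finite (\<Union>i. P i)" "finite I"
  shows "(\<Sum>i\<in>I. card (P i)) \<le> card (\<Union>i. P i)"
proof -
  have fin: "finite (P i)" for i using assms(2) by (rule rev_finite_subset) blast
  have "(\<Sum>i\<in>I. card (P i)) = card (\<Union>i\<in>I. P i)"
    using assms(1) fin by (intro card_UN_disjoint[symmetric] assms(3)) (auto simp: disjoint_family_on_def)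
  also have "\<dots> \<le> card (\<Union>i. P i)" by (rule card_mono[OF assms(2)]) blast
  finally show ?thesis .
qed

text \<open>Compactness of the partite limits. All proportions converge along a diagonal
  subsequence, and mass that escapes to ever later parts is assigned to \<open>x 0\<close>. As sizes
  decrease, part \<open>i\<close> has proportion at most \<open>1 / i\<close>, which gives the
  uniform tail.\<close>

lemma converges_to_subsequence:
  assumes P: "\<And>j. disjoint_family (P j)" "\<And>j. finite (\<Union>i. P j i)" "\<And>j i. i \<ge> 1 \<Longrightarrow> card (P j (Suc i)) \<le> card (P j i)"
    and n: "filterlim (\<lambda>j. card (\<Union>i. P j i)) at_top sequentially"
  obtains r x where "strict_mono r" "converges_to (\<lambda>j. P (r j)) x"
proof -
  define n where "n j = card (\<Union>i. P j i)" for j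
  define f where "f j i = real (card (P j i)) / real (n j)" for j i
  have sum_le: "(\<Sum>i\<in>I. f j i) \<le> 1" if "finite I" for I j
  proof -
    have "(\<Sum>i\<in>I. real (card (P j i))) \<le> real (n j)"
      using card_parts_sum_le[OF P(1,2) that, of j] by (simp add: n_def flip: of_nat_sum)
    then show ?thesis unfolding f_def sum_divide_distrib[symmetric]
      by (cases "n j = 0") (auto simp: divide_le_eq)
  qed
  have f0: "0 \<le> f j i" for j i by (simp add: f_def)
  have f1: "f j i \<le> 1" for j i using sum_le[of "{i}" j] by simp
  have fdec: "f j (Suc i) \<le> f j i" if "i \<ge> 1" for j i
    unfolding f_def using P(3)[OF that, of j] by (simp add: divide_right_mono)
  have fdec': "f j l \<le> f j i" if "i \<ge> 1" "i \<le> l" for j i l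
    using that(2)
  proof (induction l rule: dec_induct)
    case (step m)
    then show ?case using fdec[of m j] that(1) by simp
  qed simp
  obtain r where r: "strict_mono r" "\<And>i. convergent (\<lambda>j. f (r j) i)"
    using diagonal_convergent[of f] f0 f1 by blast
  define g where "g i = lim (\<lambda>j. f (r j) i)" for i
  have g: "(\<lambda>j. f (r j) i) \<longlonglongrightarrow> g i" for i using r(2)[of i] by (simp add: g_def convergent_LIMSEQ_iff)
  have g0: "0 \<le> g i" for i by (rule LIMSEQ_le_const[OF g]) (use f0 in auto)
  have gdec: "g (Suc i) \<le> g i" if "i \<ge> 1" for i
    by (rule LIMSEQ_le[OF g g]) (use fdec[OF that] in auto)
  have gsum: "sum g I \<le> 1" if "finite I" for I
  proof (rule LIMSEQ_le_const2)
    show "(\<lambda>j. \<Sum>i\<in>I. f (r j) i) \<longlonglongrightarrow> sum g I" by (intro tendsto_sum g)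
    show "\<exists>N. \<forall>j\<ge>N. (\<Sum>i\<in>I. f (r j) i) \<le> 1" using sum_le[OF that] by blast
  qed
  have smb: "g summable_on {1..}"
  proof (rule nonneg_bdd_above_summable_on)
    show "bdd_above (sum g ` {F. F \<subseteq> {1..} \<and> finite F})" using gsum by (auto intro!: bdd_aboveI[of _ 1])
  qed (rule g0)
  define s where "s = infsum g {1..}"
  have s1: "s \<le> 1" unfolding s_def
    by (rule infsum_le_finite_sums[OF smb]) (use gsum in auto)
  define x where "x i = (if i = 0 then 1 - s else g i)" for i
  have "(g has_sum s) {1..}" unfolding s_def using smb by simp
  then have "(x has_sum s) {1..}" by (rule has_sum_cong[THEN iffD1, rotated]) (simp add: x_def)
  moreover have "0 \<le> s" unfolding s_def by (rule infsum_nonneg) (rule g0)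
  ultimately have x: "x \<in> partite_limits"
    unfolding partite_limits_def using g0 gdec by (simp add: x_def s1)
  have "converges_to (\<lambda>j. P (r j)) x"
    unfolding converges_to_def
  proof (intro conjI allI impI)
    show "x \<in> partite_limits" by (rule x)
    show "disjoint_family (P (r j))" "finite (\<Union>i. P (r j) i)" for j using P by auto
    show "filterlim (\<lambda>j. card (\<Union>i. P (r j) i)) at_top sequentially"
      using filterlim_compose[OF n filterlim_subseq[OF r(1)]] .
    show "(\<lambda>j. real (card (P (r j) i)) / real (card (\<Union>i. P (r j) i))) \<longlonglongrightarrow> x i" if "1 \<le> i" for i
      using g[of i] that by (simp add: f_def n_def x_def)
    fix \<epsilon> :: real assume \<epsilon>: "\<epsilon> > 0"
    show "\<exists>M0. \<forall>M\<ge>M0. \<forall>\<^sub>F j in sequentially. \<forall>i>M. real (card (P (r j) i)) \<le> \<epsilon> * real (card (\<Union>i. P (r j) i))"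
    proof (intro exI allI impI always_eventually)
      fix M j i :: nat assume M: "M \<ge> nat \<lceil>1 / \<epsilon>\<rceil>" "i > M"
      have i: "real i \<ge> 1 / \<epsilon>" using M by linarith
      have "real i * f (r j) i = (\<Sum>l\<in>{1..i}. f (r j) i)" by simp
      also have "\<dots> \<le> (\<Sum>l\<in>{1..i}. f (r j) l)" by (rule sum_mono) (use fdec' in auto)
      also have "\<dots> \<le> 1" by (rule sum_le) simp
      finally have "real i * f (r j) i \<le> 1" .
      moreover have "1 / \<epsilon> * f (r j) i \<le> real i * f (r j) i" using i f0 by (rule mult_right_mono)
      ultimately have "1 / \<epsilon> * f (r j) i \<le> 1" by linarith
      then have fe: "f (r j) i \<le> \<epsilon>" using \<epsilon> by (simp add: field_simps)
      show "real (card (P (r j) i)) \<le> \<epsilon> * real (card (\<Union>i. P (r j) i))"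
      proof (cases "n (r j) = 0")
        case True
        then have "card (P (r j) i) = 0"
          using card_parts_sum_le[OF P(1,2), of "{i}" "r j"] by (simp add: n_def)
        then show ?thesis using \<epsilon> by simp
      next
        case False
        then show ?thesis using fe by (simp add: f_def n_def divide_le_eq)
      qed
    qed
  qed
  with r(1) show ?thesis using that by blast
qed

text \<open>Types are taken from \<open>supp x\<close> only, so that (Str1) and (Str2) apply to
  every type that occurs. Proportions and wrong pairs are bounded separately, so that a small edit
  preserves closeness with the same \<open>\<tau>\<close>.\<close>

definition close_to :: "real \<Rightarrow> (nat \<Rightarrow> real) \<Rightarrow> graph \<Rightarrow> bool" where
  "close_to \<delta> x G \<longleftrightarrow> (\<exists>\<tau>. \<tau> ` verts G \<subseteq> supp x \<and> (\<forall>i\<in>supp x. \<bar>ratio (verts G) \<tau> i - x i\<bar> \<le> \<delta>) \<and>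
     real (card (edit G (pg (verts G) \<tau>))) \<le> \<delta> * real (order G) ^ 2)"

lemma card_edit_triangle:
  assumes "fin_graph G" "fin_graph H"
  shows "real (card (edit G K)) \<le> real (card (edit G H)) + real (card (edit H K))"
proof (cases "finite (edges K)")
  case True
  have "card (edit G K) \<le> card (edit G H \<union> edit H K)"
    using True finite_edges[OF assms(1)] finite_edges[OF assms(2)] by (intro card_mono) auto
  also have "\<dots> \<le> card (edit G H) + card (edit H K)" by (rule card_Un_le)
  finally show ?thesis by linarith
next
  case False
  then have "infinite (edit G K)"
    using finite_edges[OF assms(1)] by (metis Diff_infinite_finite Un_infinite sup_commute)
  then show ?thesis by simp
qed

text \<open>Parts outside the finite support have vanishing proportion, so their vertices are
  retyped cheaply: as universal vertices if \<open>x 0 > 0\<close>, and otherwise as vertices of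
  part \<open>1\<close>, since type \<open>0\<close> is then not in the support.\<close>

lemma converges_to_close:
  assumes P: "converges_to P x" and fs: "finite (supp x)" and \<delta>: "\<delta> > 0"
  shows "\<forall>\<^sub>F j in sequentially. close_to \<delta> x (partite_graph (P j))"
proof -
  have x: "x \<in> partite_limits" using P by (simp add: converges_to_def)
  let ?V = "\<lambda>j. (\<Union>i. P j i)"
  have dj: "disjoint_family (P j)" "finite (?V j)" for j using P by (auto simp: converges_to_def)
  define m where "m = Max (insert 0 (supp x))"
  have sm: "supp x \<subseteq> {0..m}" using fs by (auto simp: m_def)
  have pos: "i \<in> supp x" if "1 \<le> i" "i \<le> m" for i
  proof -
    have "m \<in> insert 0 (supp x)" unfolding m_def using fs by (intro Max_in) auto
    then have "x m > 0" using that by (auto simp: supp_def)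
    then show ?thesis using partite_limits_antimono[OF x that] by (simp add: supp_def)
  qed
  define t0 where "t0 = (if x 0 > 0 then 0 else 1 :: nat)"
  have t0: "t0 \<in> supp x"
  proof (cases "x 0 > 0")
    case False
    obtain i where i: "i \<in> supp x" using supp_nonempty[OF x] by blast
    then have "i \<ge> 1" using False by (cases i) (auto simp: supp_def)
    then show ?thesis using supp_1[OF x i] False by (simp add: t0_def)
  qed (simp add: t0_def supp_def)
  define T where "T j v = truncate m (part_index (P j) v)" for j v
  define \<tau> where "\<tau> j v = (if T j v = 0 then t0 else T j v)" for j v
  have Tle: "T j v \<le> m" for j v by (simp add: T_def truncate_le)
  have lim: "(\<lambda>j. ratio (?V j) (T j) i) \<longlonglongrightarrow> x i" if "i \<le> m" for i
    unfolding T_def using truncated_ratio_tendsto[OF P that] tail_merge_eq[OF x sm] by simp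
  \<comment> \<open>The uniform tail covers the parts beyond some \<open>M\<close>; the finitely
    many between \<open>m\<close> and \<open>M\<close> are handled one by one, their limits being
    \<open>0\<close>.\<close>
  have tail: "\<forall>\<^sub>F j in sequentially. \<forall>i>m. real (card (P j i)) \<le> \<delta> / 2 * real (card (?V j))"
  proof -
    obtain M where M: "\<forall>\<^sub>F j in sequentially. \<forall>i>M. real (card (P j i)) \<le> \<delta> / 2 * real (card (?V j))"
      using P \<delta> unfolding converges_to_def by (meson half_gt_zero order_refl)
    have "\<forall>\<^sub>F j in sequentially. \<forall>i\<in>{m<..M}. real (card (P j i)) \<le> \<delta> / 2 * real (card (?V j))"
    proof (subst eventually_ball_finite_distrib)
      show "\<forall>i\<in>{m<..M}. \<forall>\<^sub>F j in sequentially. real (card (P j i)) \<le> \<delta> / 2 * real (card (?V j))"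
      proof
        fix i assume i: "i \<in> {m<..M}"
        then have "i \<notin> supp x" using sm by auto
        then have "x i = 0" using partite_limits_nonneg[OF x, of i] by (simp add: supp_def)
        then have "(\<lambda>j. real (card (P j i)) / real (card (?V j))) \<longlonglongrightarrow> 0"
        proof -
          have "\<forall>i\<ge>1. (\<lambda>j. real (card (P j i)) / real (card (?V j))) \<longlonglongrightarrow> x i"
            using P unfolding converges_to_def by (elim conjE)
          from this[rule_format, of i] i show ?thesis by (simp add: \<open>x i = 0\<close>)
        qed
        from tendstoD[OF this, of "\<delta> / 2"] \<delta>
        have "\<forall>\<^sub>F j in sequentially. real (card (P j i)) / real (card (?V j)) < \<delta> / 2" by simp
        then show "\<forall>\<^sub>F j in sequentially. real (card (P j i)) \<le> \<delta> / 2 * real (card (?V j))"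
        proof eventually_elim
          case (elim j)
          show ?case
          proof (cases "card (?V j) = 0")
            case True
            then show ?thesis using card_parts_sum_le[OF dj, of "{i}" j] by simp
          next
            case False
            then show ?thesis using elim by (simp add: divide_less_eq less_imp_le)
          qed
        qed
      qed
    qed simp
    with M show ?thesis
    proof eventually_elim
      case (elim j)
      show ?case
      proof (intro allI impI)
        fix i assume "i > m"
        then show "real (card (P j i)) \<le> \<delta> / 2 * real (card (?V j))"
          using elim by (cases "i > M") auto
      qed
    qed
  qed
  have r: "\<forall>\<^sub>F j in sequentially. \<forall>i\<in>{0..m}. \<bar>ratio (?V j) (T j) i - x i\<bar> \<le> \<delta> / 2"
  proof (subst eventually_ball_finite_distrib)
    show "\<forall>i\<in>{0..m}. \<forall>\<^sub>F j in sequentially. \<bar>ratio (?V j) (T j) i - x i\<bar> \<le> \<delta> / 2"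
    proof
      fix i assume "i \<in> {0..m}"
      then have "(\<lambda>j. ratio (?V j) (T j) i) \<longlonglongrightarrow> x i" using lim by simp
      from tendstoD[OF this, of "\<delta> / 2"] \<delta> show "\<forall>\<^sub>F j in sequentially. \<bar>ratio (?V j) (T j) i - x i\<bar> \<le> \<delta> / 2"
        by (simp add: dist_real_def eventually_mono less_imp_le)
    qed
  qed simp
  from tail r show ?thesis
  proof eventually_elim
    case (elim j)
    let ?n = "real (card (?V j))"
    have fgs: "fin_graph (pg (?V j) t)" for t using fin_graph_pg[OF dj(2)] .
    have im: "\<tau> j ` ?V j \<subseteq> supp x"
      using t0 pos Tle[of j] by (auto simp: \<tau>_def Suc_le_eq)
    have e1: "real (card (edit (pg (?V j) (part_index (P j))) (pg (?V j) (T j)))) \<le> ?n * (\<delta> / 2 * ?n)"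
      unfolding T_def using elim(1) \<delta> part_index_class[OF dj(1), of j]
      by (intro truncate_edit(1)[OF dj(2)]) auto
    have rat: "\<bar>ratio (?V j) (\<tau> j) i - x i\<bar> \<le> \<delta>" if i: "i \<in> supp x" for i
    proof (cases "x 0 > 0")
      case True
      then have "\<tau> j = T j" by (auto simp: \<tau>_def t0_def fun_eq_iff)
      then have "\<bar>ratio (?V j) (\<tau> j) i - x i\<bar> \<le> \<delta> / 2" using elim(2) i sm by auto
      then show ?thesis using \<delta> by linarith
    next
      case False
      then have x0: "x 0 = 0" using partite_limits_nonneg[OF x, of 0] by simp
      have i0: "i \<noteq> 0" using i x0 by (cases "i = 0") (auto simp: supp_def)
      have "ratio (?V j) (\<tau> j) i = ratio (?V j) (T j) i + (if i = 1 then ratio (?V j) (T j) 0 else 0)"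
      proof (cases "i = 1")
        case True
        have "{v \<in> ?V j. \<tau> j v = 1} = {v \<in> ?V j. T j v = 1} \<union> {v \<in> ?V j. T j v = 0}"
          using False by (auto simp: \<tau>_def t0_def)
        moreover have "card ({v \<in> ?V j. T j v = 1} \<union> {v \<in> ?V j. T j v = 0}) = card {v \<in> ?V j. T j v = 1} + card {v \<in> ?V j. T j v = 0}"
        proof (rule card_Un_disjoint)
          show "finite {v \<in> ?V j. T j v = 1}" "finite {v \<in> ?V j. T j v = 0}"
            by (rule finite_subset[OF _ dj(2)[of j]], blast)+
        qed auto
        ultimately show ?thesis using True by (simp add: ratio_def add_divide_distrib)
      next
        case i1: False
        have "{v \<in> ?V j. \<tau> j v = i} = {v \<in> ?V j. T j v = i}"
          using False i1 i0 by (auto simp: \<tau>_def t0_def)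
        then show ?thesis using i1 by (simp add: ratio_def)
      qed
      moreover have "\<bar>ratio (?V j) (T j) i - x i\<bar> \<le> \<delta> / 2" using elim(2) i sm by auto
      moreover have "\<bar>ratio (?V j) (T j) 0 - x 0\<bar> \<le> \<delta> / 2" using elim(2)[rule_format, of 0] by simp
      then have "\<bar>if i = 1 then ratio (?V j) (T j) 0 else 0\<bar> \<le> \<delta> / 2" unfolding x0 using \<delta> by simp
      ultimately show ?thesis by linarith
    qed
    have e2: "real (card (edit (pg (?V j) (T j)) (pg (?V j) (\<tau> j)))) \<le> ?n * (\<delta> / 2 * ?n)"
    proof (cases "x 0 > 0")
      case True
      then have "\<tau> j = T j" by (auto simp: \<tau>_def t0_def fun_eq_iff)
      then show ?thesis using \<delta> by simp
    next
      case False
      then have x0: "x 0 = 0" using partite_limits_nonneg[OF x, of 0] by simp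
      have "\<bar>ratio (?V j) (T j) 0 - x 0\<bar> \<le> \<delta> / 2" using elim(2)[rule_format, of 0] by simp
      then have "\<bar>ratio (?V j) (T j) 0\<bar> \<le> \<delta> / 2" unfolding x0 by simp
      then have c: "real (card {v \<in> ?V j. T j v = 0}) \<le> \<delta> / 2 * ?n"
      proof (cases "?n = 0")
        case True
        then have "?V j = {}" using dj(2)[of j] by simp
        then show ?thesis by simp
      qed (auto simp: ratio_def divide_le_eq)
      have "real (card (edit (pg (?V j) (T j)) (pg (?V j) (\<tau> j)))) \<le> real (card (?V j)) * (\<delta> / 2 * ?n)"
      proof (rule card_doubletons_le[OF dj(2), where R = "\<lambda>u v. T j v = 0"])
        show "edit (pg (?V j) (T j)) (pg (?V j) (\<tau> j)) \<subseteq> {{u, v} |u v. u \<in> ?V j \<and> v \<in> ?V j \<and> T j v = 0}"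
        proof
          fix e assume e: "e \<in> edit (pg (?V j) (T j)) (pg (?V j) (\<tau> j))"
          then obtain u v where uv: "e = {u, v}" "u \<in> ?V j" "v \<in> ?V j" "u \<noteq> v" by (auto simp: pg_def)
          have "({u, v} \<in> edges (pg (?V j) (T j))) \<noteq> ({u, v} \<in> edges (pg (?V j) (\<tau> j)))"
            using e unfolding uv(1) by blast
          then have "adj (T j u) (T j v) \<noteq> adj (\<tau> j u) (\<tau> j v)" unfolding pg_edge[OF uv(2-4)] .
          then have "T j v = 0 \<or> T j u = 0" unfolding \<tau>_def by (auto split: if_splits)
          then show "e \<in> {{u, v} |u v. u \<in> ?V j \<and> v \<in> ?V j \<and> T j v = 0}"
          proof
            assume "T j v = 0" then show ?thesis using uv by blast
          next
            assume "T j u = 0" then show ?thesis using uv by (intro CollectI exI[of _ v] exI[of _ u]) auto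
          qed
        qed
      qed (rule c)
      then show ?thesis .
    qed
    have "real (card (edit (pg (?V j) (part_index (P j))) (pg (?V j) (\<tau> j)))) \<le> \<delta> * ?n ^ 2"
      using card_edit_triangle[OF fgs[of "part_index (P j)"] fgs[of "T j"], of "pg (?V j) (\<tau> j)"] e1 e2
      by (simp add: power2_eq_square algebra_simps)
    then show ?case unfolding close_to_def partite_graph_index[OF dj(1)] verts_pg
      using im rat by blast
  qed
qed

section \<open>Isomorphism invariance and extremal values\<close>

lemma graph_image_induced:
  assumes "inj_on \<sigma> (verts G)" "fin_graph G" "X \<subseteq> verts G"
  shows "induced (graph_image \<sigma> G) (\<sigma> ` X) = graph_image \<sigma> (induced G X)"
proof -
  have "{e \<in> (`) \<sigma> ` edges G. e \<subseteq> \<sigma> ` X} = (`) \<sigma> ` {e \<in> edges G. e \<subseteq> X}"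
  proof (intro equalityI subsetI)
    fix e assume "e \<in> {e \<in> (`) \<sigma> ` edges G. e \<subseteq> \<sigma> ` X}"
    then obtain d where d: "d \<in> edges G" "e = \<sigma> ` d" "\<sigma> ` d \<subseteq> \<sigma> ` X" by blast
    moreover have "d \<subseteq> verts G" using d assms(2) by (auto simp: fin_graph_def)
    ultimately have "d \<subseteq> X" using assms(1,3) by (simp add: inj_on_image_subset_iff)
    then show "e \<in> (`) \<sigma> ` {e \<in> edges G. e \<subseteq> X}" using d by blast
  qed blast
  then show ?thesis by (simp add: induced_def graph_image_def)
qed

lemma fin_graph_image:
  assumes "inj_on \<sigma> (verts G)" "fin_graph G"
  shows "fin_graph (graph_image \<sigma> G)"
proof -
  have "card (\<sigma> ` e) = 2" if "e \<in> edges G" for e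
    using that assms by (subst card_image) (auto simp: fin_graph_def intro: inj_on_subset)
  then show ?thesis using assms(2) by (auto simp: fin_graph_def graph_image_def)
qed

context graph_param begin

lemma Lambda_graph_image:
  assumes inj: "inj_on \<sigma> (verts G)" and fg: "fin_graph G"
  shows "\<Lambda> (graph_image \<sigma> G) = \<Lambda> G"
proof -
  let ?A = "{X. X \<subseteq> verts G \<and> card X = k}"
  have c: "card (\<sigma> ` X) = card X" if "X \<subseteq> verts G" for X
    using that inj by (intro card_image) (rule inj_on_subset)
  have im: "{Y. Y \<subseteq> \<sigma> ` verts G \<and> card Y = k} = (`) \<sigma> ` ?A"
  proof (intro equalityI subsetI)
    fix Y assume Y: "Y \<in> {Y. Y \<subseteq> \<sigma> ` verts G \<and> card Y = k}"
    then obtain X where X: "X \<subseteq> verts G" "Y = \<sigma> ` X" by (auto simp: subset_image_iff)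
    then show "Y \<in> (`) \<sigma> ` ?A" using Y c[OF X(1)] by auto
  qed (auto simp: c)
  have "inj_on ((`) \<sigma>) ?A"
    using inj by (intro inj_onI) (auto simp: inj_on_image_eq_iff)
  then have "\<Lambda> (graph_image \<sigma> G) = (\<Sum>X\<in>?A. \<gamma> (induced (graph_image \<sigma> G) (\<sigma> ` X)))"
    unfolding Lambda_def using im by (simp add: graph_image_def sum.reindex)
  also have "\<dots> = (\<Sum>X\<in>?A. \<gamma> (induced G X))"
  proof (rule sum.cong[OF refl])
    fix X assume X: "X \<in> ?A"
    have i: "induced (graph_image \<sigma> G) (\<sigma> ` X) = graph_image \<sigma> (induced G X)"
      using X by (intro graph_image_induced inj fg) auto
    have injX: "inj_on \<sigma> (verts (induced G X))" using X inj by (auto simp: induced_def intro: inj_on_subset)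
    have fgX: "fin_graph (induced G X)" using X by (intro fin_graph_induced fg) auto
    have "graph_iso (induced G X) (graph_image \<sigma> (induced G X))"
      unfolding graph_iso_def using injX by blast
    moreover have "order (induced G X) = k" using X by (simp add: induced_def)
    ultimately show "\<gamma> (induced (graph_image \<sigma> G) (\<sigma> ` X)) = \<gamma> (induced G X)"
      unfolding i using iso fgX fin_graph_image[OF injX fgX] unfolding iso_invariant_def by metis
  qed
  finally show ?thesis by (simp add: Lambda_def)
qed

text \<open>The set in \<open>lam_ext\<close> ranges over graphs on all vertex sets of size
  \<open>n\<close>. Relabelling by \<open>{..<n}\<close> shows that it is finite, so that
  \<open>Max\<close> is meaningful.\<close>

lemma lam_le_lam_ext:
  assumes "fin_graph G" "order G = n"
  shows "lam k \<gamma> G \<le> lam_ext k \<gamma> n"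
proof -
  let ?S = "{lam k \<gamma> G | G. fin_graph G \<and> order G = n}"
  have "?S \<subseteq> lam k \<gamma> ` ({{..<n}} \<times> Pow (Pow {..<n}))"
  proof
    fix l assume "l \<in> ?S"
    then obtain G where G: "l = lam k \<gamma> G" "fin_graph G" "order G = n" by blast
    then have "finite (verts G)" by (simp add: fin_graph_def)
    then obtain \<sigma> where \<sigma>: "bij_betw \<sigma> (verts G) {..<n}"
      using ex_bij_betw_finite_nat G(3) by (metis atLeast0LessThan)
    then have inj: "inj_on \<sigma> (verts G)" "\<sigma> ` verts G = {..<n}" by (auto simp: bij_betw_def)
    have v: "verts (graph_image \<sigma> G) = {..<n}" using inj by (simp add: graph_image_def)
    have "lam k \<gamma> (graph_image \<sigma> G) = l"
      using Lambda_graph_image[OF inj(1) G(2)] G v by (simp add: lam_def)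
    moreover have "edges (graph_image \<sigma> G) \<subseteq> Pow {..<n}"
      using fin_graph_image[OF inj(1) G(2)] v by (auto simp: fin_graph_def)
    ultimately show "l \<in> lam k \<gamma> ` ({{..<n}} \<times> Pow (Pow {..<n}))"
      using v by (intro image_eqI[of _ _ "graph_image \<sigma> G"]) (auto simp: mem_Times_iff)
  qed
  moreover have "finite (lam k \<gamma> ` ({{..<n}} \<times> Pow (Pow {..<n})))"
    by (intro finite_imageI finite_cartesian_product) auto
  ultimately have "finite ?S" using finite_subset by blast
  moreover have "lam k \<gamma> G \<in> ?S" using assms by blast
  ultimately show ?thesis unfolding lam_ext_def by (rule Max_ge)
qed

lemma fin_partite_graph: "disjoint_family P \<Longrightarrow> finite (\<Union>i. P i) \<Longrightarrow> fin_graph (partite_graph P)"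
  by (simp add: partite_graph_index fin_graph_pg)

lemma fin_graph_realisation: "x \<in> partite_limits \<Longrightarrow> fin_graph (partite_graph (realisation n x))"
  by (rule fin_partite_graph) (auto simp: realisation_facts)

lemma lam_lim_le_lam_max:
  assumes "x \<in> partite_limits"
  shows "lam_lim k \<gamma> x \<le> lam_max k \<gamma>"
  unfolding lam_max_def
proof (rule cSUP_upper[OF assms])
  have "lam_lim k \<gamma> x \<le> B" if x: "x \<in> partite_limits" for x
  proof (rule LIMSEQ_le_const2[OF converges_to_lam[OF converges_to_realisation[OF x]]])
    have "lam k \<gamma> (partite_graph (realisation n x)) \<le> B" for n
      using lam_abs_le[OF fin_graph_realisation[OF x, of n]] by linarith
    then show "\<exists>N. \<forall>n\<ge>N. lam k \<gamma> (partite_graph (realisation n x)) \<le> B" by simp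
  qed
  then show "bdd_above (lam_lim k \<gamma> ` partite_limits)" by (auto intro!: bdd_aboveI[of _ B])
qed

lemma partite_limits_nonempty: "partite_limits \<noteq> {}"
proof -
  have "((\<lambda>i. if i = 0 then 1 else 0) has_sum (0 :: real)) {1 :: nat..}"
    by (rule has_sum_0) auto
  then have "(\<lambda>i. if i = 0 then 1 else 0) \<in> partite_limits" by (simp add: partite_limits_def)
  then show ?thesis by blast
qed

lemma lam_max_approx:
  assumes "\<epsilon> > 0"
  shows "\<exists>x\<in>partite_limits. \<exists>n0. \<forall>n\<ge>n0. lam k \<gamma> (partite_graph (realisation n x)) \<ge> lam_max k \<gamma> - \<epsilon>"
proof -
  have "lam_max k \<gamma> - \<epsilon> / 2 < lam_max k \<gamma>" using assms by simp
  then have "\<exists>l\<in>lam_lim k \<gamma> ` partite_limits. lam_max k \<gamma> - \<epsilon> / 2 < l"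
    by (intro less_cSupD) (simp_all add: partite_limits_nonempty flip: lam_max_def)
  then obtain x where x: "x \<in> partite_limits" "lam_lim k \<gamma> x > lam_max k \<gamma> - \<epsilon> / 2"
    by blast
  have "\<forall>\<^sub>F n in sequentially. lam k \<gamma> (partite_graph (realisation n x)) > lam_lim k \<gamma> x - \<epsilon> / 2"
    using converges_to_lam[OF converges_to_realisation[OF x(1)]] assms by (intro order_tendstoD(1)) auto
  then obtain n0 where n0: "\<And>n. n \<ge> n0 \<Longrightarrow> lam k \<gamma> (partite_graph (realisation n x)) > lam_lim k \<gamma> x - \<epsilon> / 2"
    by (auto simp: eventually_sequentially)
  have "\<forall>n\<ge>n0. lam k \<gamma> (partite_graph (realisation n x)) \<ge> lam_max k \<gamma> - \<epsilon>"
  proof (intro allI impI)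
    fix n assume "n0 \<le> n"
    then have "lam k \<gamma> (partite_graph (realisation n x)) > lam_lim k \<gamma> x - \<epsilon> / 2" by (rule n0)
    then show "lam k \<gamma> (partite_graph (realisation n x)) \<ge> lam_max k \<gamma> - \<epsilon>"
      using x(2) by linarith
  qed
  then show ?thesis using x(1) by blast
qed

text \<open>Realisations of a nearly optimal limit are competitors in the maximum.\<close>

lemma lam_ext_ge_lam_max:
  assumes "\<epsilon> > 0"
  shows "\<exists>n0. \<forall>n\<ge>n0. lam_ext k \<gamma> n \<ge> lam_max k \<gamma> - \<epsilon>"
proof -
  obtain x n0 where x: "x \<in> partite_limits"
    "\<And>n. n \<ge> n0 \<Longrightarrow> lam k \<gamma> (partite_graph (realisation n x)) \<ge> lam_max k \<gamma> - \<epsilon>"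
    using lam_max_approx[OF assms] by blast
  have "lam k \<gamma> (partite_graph (realisation n x)) \<le> lam_ext k \<gamma> n" for n
    using realisation_facts(2)[OF x(1), of n]
    by (intro lam_le_lam_ext fin_graph_realisation x(1)) (simp add: partite_graph_def)
  then show ?thesis using x(2) by (meson order_trans)
qed

text \<open>Joins the sorted families, the convergent subsequence and the continuity of
  \<open>lam\<close>, for use against sequences of supposed counterexamples.\<close>

lemma complete_partite_compact:
  assumes H: "\<And>j. complete_partite (H j)" "\<And>j. order (H j) \<ge> j"
  obtains r P x where "strict_mono r" "converges_to P x" "\<And>j. partite_graph (P j) = H (r j)"
    "(\<lambda>j. lam k \<gamma> (H (r j))) \<longlonglongrightarrow> lam_lim k \<gamma> x"
proof -
  have "\<forall>j. \<exists>P. disjoint_family P \<and> (\<Union>i. P i) = verts (H j) \<and> partite_graph P = H j \<and>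
    (\<forall>i\<ge>1. card (P (Suc i)) \<le> card (P i))"
    using complete_partite_sorted[OF H(1)] by metis
  then obtain P where P: "\<And>j. disjoint_family (P j)" "\<And>j. (\<Union>i. P j i) = verts (H j)" "\<And>j. partite_graph (P j) = H j"
    "\<And>j i. i \<ge> 1 \<Longrightarrow> card (P j (Suc i)) \<le> card (P j i)"
    by metis
  have fin: "finite (\<Union>i. P j i)" for j
    using H(1)[of j] P(2)[of j] by (auto simp: complete_partite_def complete_partite_on_def fin_graph_def)
  have "filterlim (\<lambda>j. card (\<Union>i. P j i)) at_top sequentially"
    unfolding P(2) by (rule filterlim_at_top_mono[OF filterlim_ident]) (use H(2) in auto)
  from converges_to_subsequence[OF P(1) fin P(4) this]
  obtain r x where r: "strict_mono r" "converges_to (\<lambda>j. P (r j)) x" by blast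
  show ?thesis by (rule that[OF r]) (use P(3) converges_to_lam[OF r(2)] in auto)
qed

text \<open>Counterexamples of growing order would subconverge to a partite limit whose value
  exceeds the supremum.\<close>

lemma complete_partite_lam_upper:
  assumes "\<epsilon> > 0"
  shows "\<exists>n0. \<forall>H. complete_partite H \<and> order H \<ge> n0 \<longrightarrow> lam k \<gamma> H \<le> lam_max k \<gamma> + \<epsilon>"
proof (rule ccontr)
  assume "\<not> ?thesis"
  then have "\<forall>n0. \<exists>H. complete_partite H \<and> order H \<ge> n0 \<and> lam k \<gamma> H > lam_max k \<gamma> + \<epsilon>" by (meson not_le)
  then obtain H where H: "\<And>j. complete_partite (H j)" "\<And>j. order (H j) \<ge> j" "\<And>j. lam k \<gamma> (H j) > lam_max k \<gamma> + \<epsilon>"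
    by metis
  obtain r P x where "strict_mono r" and r: "converges_to P x" "\<And>j. partite_graph (P j) = H (r j)"
    "(\<lambda>j. lam k \<gamma> (H (r j))) \<longlonglongrightarrow> lam_lim k \<gamma> x"
    by (rule complete_partite_compact[OF H(1,2)]) (rule that)
  have "lam_max k \<gamma> + \<epsilon> \<le> lam_lim k \<gamma> x"
    by (rule LIMSEQ_le_const[OF r(3)]) (use H(3) in \<open>simp add: less_imp_le\<close>)
  moreover have "lam_lim k \<gamma> x \<le> lam_max k \<gamma>"
    using r(1) by (intro lam_lim_le_lam_max) (simp add: converges_to_def)
  ultimately show False using assms by simp
qed

text \<open>Counterexamples with values tending to \<open>lam_max\<close> or more subconverge to a
  limit that is itself optimal, and they are eventually close to it because its support is
  finite.\<close>

lemma complete_partite_near_OPT: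
  assumes fs: "\<And>x. x \<in> OPT k \<gamma> \<Longrightarrow> finite (supp x)" and \<delta>: "\<delta> > 0"
  shows "\<exists>\<epsilon>>0. \<exists>n0. \<forall>H. complete_partite H \<and> order H \<ge> n0 \<and> lam k \<gamma> H \<ge> lam_max k \<gamma> - \<epsilon> \<longrightarrow>
    (\<exists>x\<in>OPT k \<gamma>. close_to \<delta> x H)"
proof (rule ccontr)
  assume neg: "\<not> ?thesis"
  have "\<exists>H. complete_partite H \<and> order H \<ge> j \<and> lam k \<gamma> H \<ge> lam_max k \<gamma> - 1 / real (Suc j) \<and>
     \<not> (\<exists>x\<in>OPT k \<gamma>. close_to \<delta> x H)" for j
  proof -
    have "1 / real (Suc j) > 0" by simp
    then show ?thesis using neg by blast
  qed
  then obtain H where H: "\<And>j. complete_partite (H j)" "\<And>j. order (H j) \<ge> j"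
    "\<And>j. lam k \<gamma> (H j) \<ge> lam_max k \<gamma> - 1 / real (Suc j)" "\<And>j. \<not> (\<exists>x\<in>OPT k \<gamma>. close_to \<delta> x (H j))"
    by metis
  obtain r P x where r: "strict_mono r" "converges_to P x" "\<And>j. partite_graph (P j) = H (r j)"
    "(\<lambda>j. lam k \<gamma> (H (r j))) \<longlonglongrightarrow> lam_lim k \<gamma> x"
    by (rule complete_partite_compact[OF H(1,2)]) (rule that)
  have x: "x \<in> partite_limits" using r(2) by (simp add: converges_to_def)
  have "(\<lambda>j. lam_max k \<gamma> - 1 / real (Suc j)) \<longlonglongrightarrow> lam_max k \<gamma> - 0"
    by (intro tendsto_intros LIMSEQ_Suc[OF lim_1_over_n])
  then have "(\<lambda>j. lam_max k \<gamma> - 1 / real (Suc (r j))) \<longlonglongrightarrow> lam_max k \<gamma>"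
    using LIMSEQ_subseq_LIMSEQ[OF _ r(1), of "\<lambda>j. lam_max k \<gamma> - 1 / real (Suc j)" "lam_max k \<gamma>"]
    by (simp add: o_def)
  then have "lam_max k \<gamma> \<le> lam_lim k \<gamma> x"
    by (rule LIMSEQ_le[OF _ r(4)]) (use H(3) in simp)
  then have "x \<in> OPT k \<gamma>" using lam_lim_le_lam_max[OF x] x by (simp add: OPT_def)
  moreover have "\<forall>\<^sub>F j in sequentially. close_to \<delta> x (H (r j))"
    using converges_to_close[OF r(2) fs[OF \<open>x \<in> OPT k \<gamma>\<close>] \<delta>] by (simp add: r(3))
  then obtain j where "close_to \<delta> x (H (r j))" by (auto simp: eventually_sequentially)
  ultimately show False using H(4) by blast
qed

end

section \<open>Stability near an optimal limit\<close>

definition near :: "(nat \<Rightarrow> real) \<Rightarrow> real \<Rightarrow> nat set \<Rightarrow> (nat \<Rightarrow> nat) \<Rightarrow> bool" where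
  "near x \<delta> V \<tau> \<longleftrightarrow> finite V \<and> \<tau> ` V \<subseteq> supp x \<and> (\<forall>i\<in>supp x. \<bar>ratio V \<tau> i - x i\<bar> \<le> \<delta>)"

lemma near_ratio:
  assumes x: "x \<in> partite_limits" and n: "near x \<delta> V \<tau>" and \<delta>: "\<delta> \<ge> 0"
  shows "\<bar>ratio V \<tau> i - x i\<bar> \<le> \<delta>"
proof (cases "i \<in> supp x")
  case True then show ?thesis using n by (simp add: near_def)
next
  case False
  then have "x i = 0" using partite_limits_nonneg[OF x, of i] by (simp add: supp_def)
  moreover have "{v \<in> V. \<tau> v = i} = {}" using n False by (auto simp: near_def)
  then have "ratio V \<tau> i = 0" unfolding ratio_def by (simp only: card.empty of_nat_0 div_0)
  ultimately show ?thesis using \<delta> by simp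
qed

lemma ratio_retype:
  assumes V: "finite V" "Z \<subseteq> V" and eq: "\<And>v. v \<in> V - Z \<Longrightarrow> \<tau>' v = \<tau> v"
  shows "\<bar>ratio V \<tau>' i - ratio V \<tau> i\<bar> \<le> real (card Z) / real (card V)"
proof -
  have fZ: "finite Z" using V finite_subset by blast
  have le: "card {v \<in> V. \<sigma> v = i} \<le> card {v \<in> V. \<rho> v = i} + card Z"
    if "\<And>v. v \<in> V - Z \<Longrightarrow> \<sigma> v = \<rho> v" for \<sigma> \<rho> :: "nat \<Rightarrow> 'a"
  proof -
    have "card {v \<in> V. \<sigma> v = i} \<le> card ({v \<in> V. \<rho> v = i} \<union> Z)"
      using V fZ that by (intro card_mono) auto
    then show ?thesis using card_Un_le[of "{v \<in> V. \<rho> v = i}" Z] by linarith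
  qed
  have "\<bar>real (card {v \<in> V. \<tau>' v = i}) - real (card {v \<in> V. \<tau> v = i})\<bar> \<le> real (card Z)"
    using le[of \<tau>' \<tau>, OF eq] le[of \<tau> \<tau>', OF eq[symmetric]] by linarith
  then show ?thesis unfolding ratio_def diff_divide_distrib[symmetric] abs_divide
    by (simp add: divide_right_mono)
qed

lemma near_retype:
  assumes n: "near x \<delta> V \<tau>" and Z: "Z \<subseteq> V" "real (card Z) \<le> \<zeta> * real (card V)" "\<zeta> \<ge> 0"
    and \<tau>': "\<tau>' ` V \<subseteq> supp x" "\<And>v. v \<in> V - Z \<Longrightarrow> \<tau>' v = \<tau> v"
  shows "near x (\<delta> + \<zeta>) V \<tau>'"
  unfolding near_def
proof (intro conjI ballI)
  show fV: "finite V" using n by (simp add: near_def)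
  show "\<tau>' ` V \<subseteq> supp x" by (rule \<tau>')
  fix i assume i: "i \<in> supp x"
  have "real (card Z) / real (card V) \<le> \<zeta>"
    using Z by (cases "card V = 0") (auto simp: divide_le_eq)
  then have "\<bar>ratio V \<tau>' i - ratio V \<tau> i\<bar> \<le> \<zeta>"
    using ratio_retype[of V Z \<tau>' \<tau> i, OF fV Z(1) \<tau>'(2)] by linarith
  moreover have "\<bar>ratio V \<tau> i - x i\<bar> \<le> \<delta>" using n i by (simp add: near_def)
  ultimately show "\<bar>ratio V \<tau>' i - x i\<bar> \<le> \<delta> + \<zeta>" by linarith
qed

lemma near_mono: "near x \<delta> V \<tau> \<Longrightarrow> \<delta> \<le> \<delta>' \<Longrightarrow> near x \<delta>' V \<tau>"
  by (auto simp: near_def)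

lemma edit_edge:
  assumes "fin_graph G" "fin_graph H" "verts H = verts G" "e \<in> edit G H"
  obtains u v where "e = {u, v}" "u \<noteq> v" "u \<in> verts G" "v \<in> verts G"
proof -
  have "e \<in> edges G \<or> e \<in> edges H" using assms(4) by blast
  then show ?thesis using edge_cases[OF assms(1), of e] edge_cases[OF assms(2), of e] assms(3) that by auto
qed

lemma finite_edit: "fin_graph G \<Longrightarrow> fin_graph H \<Longrightarrow> finite (edit G H)"
  using finite_edges by blast

lemma incident_edit:
  assumes "fin_graph G" "fin_graph H" "verts H = verts G" "v \<in> verts G"
  shows "card {e \<in> edit G H. v \<in> e} =
    card {w \<in> verts G - {v}. ({v, w} \<in> edges G) \<noteq> ({v, w} \<in> edges H)}"
proof -
  let ?S = "{w \<in> verts G - {v}. ({v, w} \<in> edges G) \<noteq> ({v, w} \<in> edges H)}"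
  have "{e \<in> edit G H. v \<in> e} = (\<lambda>w. {v, w}) ` ?S"
  proof (intro equalityI subsetI)
    fix e assume e: "e \<in> {e \<in> edit G H. v \<in> e}"
    then have e1: "e \<in> edit G H" "v \<in> e" by auto
    obtain a b where ab: "e = {a, b}" "a \<noteq> b" "a \<in> verts G" "b \<in> verts G"
      by (rule edit_edge[OF assms(1-3) e1(1)]) (rule that)
    define w where "w = (if v = a then b else a)"
    have w: "e = {v, w}" "w \<in> verts G - {v}" using ab e1(2) by (auto simp: w_def)
    have "({v, w} \<in> edges G) \<noteq> ({v, w} \<in> edges H)" using e1(1) unfolding w(1) by blast
    then show "e \<in> (\<lambda>w. {v, w}) ` ?S" using w by blast
  qed auto
  moreover have "inj_on (\<lambda>w. {v, w}) ?S" by (auto simp: inj_on_def doubleton_eq_iff)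
  ultimately show ?thesis by (simp only: card_image)
qed

lemma handshake_le:
  assumes V: "finite V" and D: "finite D" "\<And>e. e \<in> D \<Longrightarrow> card e = 2"
  shows "(\<Sum>v\<in>V. card {e \<in> D. v \<in> e}) \<le> 2 * card D"
proof -
  have "(\<Sum>v\<in>V. card {e \<in> D. v \<in> e}) = (\<Sum>v\<in>V. \<Sum>e\<in>D. if v \<in> e then 1 else 0)"
    using D(1) by (simp add: sum.If_cases Int_def)
  also have "\<dots> = (\<Sum>e\<in>D. \<Sum>v\<in>V. if v \<in> e then 1 else 0)" by (rule sum.swap)
  also have "\<dots> \<le> (\<Sum>e\<in>D. 2)"
  proof (rule sum_mono)
    fix e assume e: "e \<in> D"
    have "finite e" using D(2)[OF e] by (simp add: card_ge_0_finite)
    then have "card {v \<in> V. v \<in> e} \<le> card e" by (intro card_mono) auto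
    then show "(\<Sum>v\<in>V. if v \<in> e then 1 else 0) \<le> (2 :: nat)"
      using D(2)[OF e] V by (simp add: sum.If_cases Int_def)
  qed
  finally show ?thesis by simp
qed

lemma edit_card_2:
  assumes "fin_graph G" "fin_graph H" "e \<in> edit G H"
  shows "card e = 2" "finite e"
  using assms by (auto simp: fin_graph_def card_ge_0_finite)

lemma del_vertex_pg: "del_vertex (pg V \<tau>) z = pg (V - {z}) \<tau>"
  unfolding del_vertex_def induced_def pg_def fst_conv snd_conv
  by (intro arg_cong[where f = "Pair (V - {z})"]) auto

lemma del_vertex_pg_upd: "del_vertex (pg V (\<tau>(z := i))) z = del_vertex (pg V \<tau>) z"
  unfolding del_vertex_pg by (rule pg_cong) auto

lemma del_vertex_edit:
  assumes "del_vertex G z = del_vertex H z" "fin_graph G" "fin_graph H" "verts H = verts G" "e \<in> edit G H"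
  shows "z \<in> e"
proof (rule ccontr)
  assume z: "z \<notin> e"
  have "e \<subseteq> verts G" using assms by (auto simp: fin_graph_def)
  then have "e \<subseteq> verts G - {z}" using z by blast
  then have "e \<in> edges K \<longleftrightarrow> e \<in> edges (del_vertex K z)" if "verts K = verts G" for K
    using that by (simp add: del_vertex_def induced_def)
  from this[of G] this[of H] show False using assms by auto
qed

lemma del_vertex_eqI:
  assumes "verts H = verts G" "\<And>e. z \<notin> e \<Longrightarrow> e \<in> edges G \<longleftrightarrow> e \<in> edges H"
  shows "del_vertex G z = del_vertex H z"
proof -
  have "{e \<in> edges G. e \<subseteq> verts G - {z}} = {e \<in> edges H. e \<subseteq> verts G - {z}}"
    using assms(2) by blast
  then show ?thesis unfolding del_vertex_def induced_def assms(1) by simp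
qed

section \<open>Effect of sparse edits on sums rooted at a pair or a vertex\<close>

context graph_param begin

text \<open>Edits away from the roots cost order \<open>n^(k-4)\<close> each and number at most
  \<open>a * n^2\<close>; edits at one root cost order \<open>n^(k-3)\<close> and number at most
  \<open>a * n\<close> per root. The pair \<open>{u, v}\<close> has to be excluded, as it alone
  would cost order \<open>n^(k-2)\<close> without the factor \<open>a\<close>.\<close>

lemma rsum_diff_pair:
  assumes fg: "fin_graph G" "fin_graph H" "verts H = verts G" and uv: "u \<in> verts G" "v \<in> verts G" "u \<noteq> v"
    and ne: "{u, v} \<notin> edit G H" and a: "a \<ge> 0" "real (card (edit G H)) \<le> a * real (order G) ^ 2"
    "\<And>w. w \<in> {u, v} \<Longrightarrow> real (card {e \<in> edit G H. w \<in> e}) \<le> a * real (order G)"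
  shows "\<bar>rs G {u, v} - rs H {u, v}\<bar> \<le> 6 * B * a * (real (order G) ^ k / real (order G) ^ 2)"
proof -
  let ?n = "real (order G)" and ?D = "edit G H"
  let ?q = "?n ^ k / ?n ^ 2"
  have "finite (verts G)" using fg by (simp add: fin_graph_def)
  then have n: "?n > 0" using uv by (auto simp: card_gt_0_iff)
  have fD: "finite ?D" by (rule finite_edit[OF fg(1,2)])
  have "(\<Sum>e\<in>?D. ?n ^ k / ?n ^ card (e \<union> {u, v})) \<le>
     (\<Sum>e\<in>?D. ?q / ?n ^ 2 + ((if u \<in> e then ?q / ?n else 0) + (if v \<in> e then ?q / ?n else 0)))"
  proof (rule sum_mono)
    fix e assume e: "e \<in> ?D"
    have ce: "card e = 2" "finite e" using edit_card_2[OF fg(1,2) e] by auto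
    have nn: "?q / ?n ^ 2 \<ge> 0" "?q / ?n \<ge> 0" by auto
    show "?n ^ k / ?n ^ card (e \<union> {u, v}) \<le> ?q / ?n ^ 2 + ((if u \<in> e then ?q / ?n else 0) + (if v \<in> e then ?q / ?n else 0))"
    proof (cases "u \<in> e \<or> v \<in> e")
      case False
      then have "card (e \<union> {u, v}) = 4" using ce uv(3) by (simp add: card_insert_if)
      then have eq: "?n ^ k / ?n ^ card (e \<union> {u, v}) = ?q / ?n ^ 2" using n by (simp add: field_simps flip: power_add)
      have "u \<notin> e" "v \<notin> e" using False by auto
      then show ?thesis unfolding eq by simp
    next
      case True
      have "\<not> {u, v} \<subseteq> e"
      proof
        assume "{u, v} \<subseteq> e"
        then have "{u, v} = e" using ce uv(3) by (intro card_subset_eq) auto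
        then show False using e ne by simp
      qed
      then have "card (e \<union> {u, v}) = 3" using True ce uv(3) by (auto simp: card_insert_if insert_absorb)
      then have eq: "?n ^ k / ?n ^ card (e \<union> {u, v}) = ?q / ?n" using n by (simp add: power2_eq_square power3_eq_cube)
      have "?q / ?n \<le> (if u \<in> e then ?q / ?n else 0) + (if v \<in> e then ?q / ?n else 0)"
      proof -
        have "p \<le> (if u \<in> e then p else 0) + (if v \<in> e then p else 0)" if "p \<ge> 0" for p :: real
          using True that by auto
        then show ?thesis using nn(2) by blast
      qed
      then show ?thesis unfolding eq using nn(1) by linarith
    qed
  qed
  also have "\<dots> = real (card ?D) * (?q / ?n ^ 2) + (real (card {e \<in> ?D. u \<in> e}) * (?q / ?n) + real (card {e \<in> ?D. v \<in> e}) * (?q / ?n))"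
    using fD by (simp add: sum.distrib sum.If_cases Int_def)
  also have "\<dots> \<le> (a * ?n ^ 2) * (?q / ?n ^ 2) + ((a * ?n) * (?q / ?n) + (a * ?n) * (?q / ?n))"
    using a(2) a(3)[of u] a(3)[of v] by (intro add_mono mult_right_mono) auto
  also have "\<dots> = 3 * a * ?q"
  proof -
    have e: "(a * ?n ^ 2) * (p / ?n ^ 2) = a * p" "(a * ?n) * (p / ?n) = a * p" for p using n by auto
    have "a * p + (a * p + a * p) = 3 * a * p" for p by simp
    then show ?thesis unfolding e .
  qed
  finally have "(\<Sum>e\<in>?D. ?n ^ k / ?n ^ card (e \<union> {u, v})) \<le> 3 * a * ?q" .
  then have "2 * B * (\<Sum>e\<in>?D. ?n ^ k / ?n ^ card (e \<union> {u, v})) \<le> 2 * B * (3 * a * ?q)"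
    using B_pos by (intro mult_left_mono) auto
  then show ?thesis using rsum_diff[OF fg, of "{u, v}"] uv by (simp add: mult_ac)
qed

text \<open>The same count with one root: order \<open>n^(k-3)\<close> for each of
  \<open>a * n^2\<close> edits away from \<open>z\<close>, order \<open>n^(k-2)\<close> for each of
  \<open>a * n\<close> edits at \<open>z\<close>.\<close>

lemma rsum_diff_vertex:
  assumes fg: "fin_graph G" "fin_graph H" "verts H = verts G" and z: "z \<in> verts G"
    and a: "a \<ge> 0" "real (card (edit G H)) \<le> a * real (order G) ^ 2"
      "real (card {e \<in> edit G H. z \<in> e}) \<le> a * real (order G)"
  shows "\<bar>rs G {z} - rs H {z}\<bar> \<le> 4 * B * a * (real (order G) ^ k / real (order G))"
proof -
  let ?n = "real (order G)" and ?D = "edit G H"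
  let ?q = "?n ^ k / ?n"
  have "finite (verts G)" using fg by (simp add: fin_graph_def)
  then have n: "?n > 0" using z by (auto simp: card_gt_0_iff)
  have fD: "finite ?D" by (rule finite_edit[OF fg(1,2)])
  have "(\<Sum>e\<in>?D. ?n ^ k / ?n ^ card (e \<union> {z})) \<le> (\<Sum>e\<in>?D. ?q / ?n ^ 2 + (if z \<in> e then ?q / ?n else 0))"
  proof (rule sum_mono)
    fix e assume e: "e \<in> ?D"
    have ce: "card e = 2" "finite e" using edit_card_2[OF fg(1,2) e] by auto
    show "?n ^ k / ?n ^ card (e \<union> {z}) \<le> ?q / ?n ^ 2 + (if z \<in> e then ?q / ?n else 0)"
    proof (cases "z \<in> e")
      case True
      then have "card (e \<union> {z}) = 2" using ce by (simp add: insert_absorb)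
      then have eq: "?n ^ k / ?n ^ card (e \<union> {z}) = ?q / ?n" using n by (simp add: power2_eq_square)
      show ?thesis unfolding eq if_P[OF True] by simp
    next
      case False
      then have "card (e \<union> {z}) = 3" using ce by simp
      then have eq: "?n ^ k / ?n ^ card (e \<union> {z}) = ?q / ?n ^ 2" using n by (simp add: power2_eq_square power3_eq_cube)
      show ?thesis unfolding eq if_not_P[OF False] by simp
    qed
  qed
  also have "\<dots> = real (card ?D) * (?q / ?n ^ 2) + real (card {e \<in> ?D. z \<in> e}) * (?q / ?n)"
    using fD by (simp add: sum.distrib sum.If_cases Int_def)
  also have "\<dots> \<le> (a * ?n ^ 2) * (?q / ?n ^ 2) + (a * ?n) * (?q / ?n)"
    using a by (intro add_mono mult_right_mono) auto
  also have "\<dots> = 2 * a * ?q" using n by simp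
  finally have "(\<Sum>e\<in>?D. ?n ^ k / ?n ^ card (e \<union> {z})) \<le> 2 * a * ?q" .
  then have "2 * B * (\<Sum>e\<in>?D. ?n ^ k / ?n ^ card (e \<union> {z})) \<le> 2 * B * (2 * a * ?q)"
    using B_pos by (intro mult_left_mono) auto
  then show ?thesis using rsum_diff[OF fg, of "{z}"] z by (simp add: mult_ac)
qed

lemma lam_le_iff_Lambda:
  assumes "verts H = verts G" "order G \<ge> k"
  shows "lam k \<gamma> G \<le> lam k \<gamma> H \<longleftrightarrow> \<Lambda> G \<le> \<Lambda> H"
proof -
  have "real (order G choose k) > 0" using assms by (simp add: zero_less_binomial_iff)
  then show ?thesis using assms by (simp add: lam_def divide_le_cancel)
qed

end

locale strict_point = graph_param +
  fixes x :: "nat \<Rightarrow> real" and c :: real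
  assumes x_limit: "x \<in> partite_limits" and c_pos: "c > 0"
    and str1: "str1 k \<gamma> c x" and str2: "str2 k \<gamma> c x" and sym: "symmetrisable k \<gamma>"
begin

lemma k2: "k \<ge> 2"
  by (rule str1_k_ge_2[OF x_limit str1 c_pos])

lemma fin_supp: "finite (supp x)"
  by (rule str1_finite_supp[OF x_limit str1 c_pos])

definition top_part :: nat where "top_part = Max (insert 0 (supp x))"

lemma supp_top: "supp x \<subseteq> {0..top_part}"
  unfolding top_part_def using fin_supp by auto

text \<open>(Str2) measures every attachment against \<open>e_vec 1\<close>, a vertex joined to
  everything but part \<open>1\<close>. This is a clone of part \<open>1\<close> if that part is
  present, and otherwise a universal vertex, since then \<open>supp x = {0}\<close>.\<close>

definition base_part :: nat where "base_part = (if 1 \<in> supp x then 1 else 0)"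

lemma supp_without_1: "1 \<notin> supp x \<Longrightarrow> supp x = {0}"
proof -
  assume 1: "1 \<notin> supp x"
  then have "supp x \<subseteq> {0}" using supp_1[OF x_limit] by fastforce
  then show ?thesis using supp_nonempty[OF x_limit] by blast
qed

lemma base_part: "base_part \<in> supp x"
  using supp_without_1 by (auto simp: base_part_def)

text \<open>Half of \<open>c\<close> is given up to approximation errors; \<open>k^k\<close>
  converts the binomial normalisation into powers of \<open>n\<close>.\<close>

definition gain :: real where "gain = c / (2 * real k ^ k)"

lemma gain_pos: "gain > 0"
  unfolding gain_def using c_pos k_pos by simp

text \<open>(Str1) speaks about limits and is turned into a bound uniform over all typed vertex sets
  near \<open>x\<close>. There are finitely many pairs of types, so one truncation level
  \<open>M\<close> approximates all derivatives within \<open>c / 4\<close>; sampling costs another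
  \<open>c / 4\<close>.\<close>

lemma pair_gain:
  obtains \<delta> N where "\<delta> > 0" "\<And>V \<tau> u v. \<lbrakk>near x \<delta> V \<tau>; card V > N; u \<in> V; v \<in> V; u \<noteq> v\<rbrakk> \<Longrightarrow>
    \<Lambda> (pg V \<tau>) - \<Lambda> (flip_pair (pg V \<tau>) u v) \<ge> gain * (real (card V) ^ k / real (card V) ^ 2)"
proof -
  let ?L = "nabla_pair_lim k \<gamma> x"
  have ev: "\<forall>\<^sub>F M in sequentially. \<forall>p\<in>supp x \<times> supp x. \<bar>ddiff M (tail_merge M x) (fst p) (snd p) - ?L (fst p) (snd p)\<bar> \<le> c / 4"
  proof (subst eventually_ball_finite_distrib)
    show "finite (supp x \<times> supp x)" using fin_supp by simp
    show "\<forall>p\<in>supp x \<times> supp x. \<forall>\<^sub>F M in sequentially. \<bar>ddiff M (tail_merge M x) (fst p) (snd p) - ?L (fst p) (snd p)\<bar> \<le> c / 4"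
    proof
      fix p assume "p \<in> supp x \<times> supp x"
      then have "x (fst p) > 0" "x (snd p) > 0" by (auto simp: supp_def)
      from tendstoD[OF nabla_pair_lim_approx[OF k2 x_limit this], of "c / 4"] c_pos
      have "\<forall>\<^sub>F M in sequentially. dist (ddiff M (tail_merge M x) (fst p) (snd p)) (?L (fst p) (snd p)) < c / 4" by simp
      then show "\<forall>\<^sub>F M in sequentially. \<bar>ddiff M (tail_merge M x) (fst p) (snd p) - ?L (fst p) (snd p)\<bar> \<le> c / 4"
        by eventually_elim (simp add: dist_real_def)
    qed
  qed
  from eventually_conj[OF ev eventually_ge_at_top[of top_part]]
  obtain M where M: "\<forall>p\<in>supp x \<times> supp x. \<bar>ddiff M (tail_merge M x) (fst p) (snd p) - ?L (fst p) (snd p)\<bar> \<le> c / 4" "M \<ge> top_part"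
    by (auto simp: eventually_sequentially)
  have sM: "supp x \<subseteq> {0..M}" using supp_top M(2) by fastforce
  \<comment> \<open>From \<open>top_part\<close> on nothing is merged, so the approximating
    densities are evaluated at \<open>x\<close> itself.\<close>
  have tm: "tail_merge M x = x" by (rule tail_merge_eq[OF x_limit sM])
  have "c / 4 > 0" using c_pos by simp
  from pair_near[OF this k2, of M] obtain \<delta> N where d: "\<delta> > 0" and nr: "\<And>V \<tau> u v y. \<lbrakk>finite V; u \<in> V; v \<in> V; u \<noteq> v; card V > N; \<tau> ` V \<subseteq> {0..M};
     \<And>i. i \<le> M \<Longrightarrow> 0 \<le> y i \<and> y i \<le> 1 \<and> \<bar>ratio V \<tau> i - y i\<bar> \<le> \<delta>\<rbrakk>
    \<Longrightarrow> \<bar>nabla_pair k \<gamma> (pg V \<tau>) u v - ddiff M y (\<tau> u) (\<tau> v)\<bar> \<le> c / 4" by metis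
  show ?thesis
  proof (rule that[OF d, of "max N k"])
    fix V \<tau> u v
    assume n: "near x \<delta> V \<tau>" and V: "card V > max N k" and uv: "u \<in> V" "v \<in> V" "u \<noteq> v"
    have fV: "finite V" and im: "\<tau> ` V \<subseteq> supp x" using n by (auto simp: near_def)
    have ts: "\<tau> u \<in> supp x" "\<tau> v \<in> supp x" using im uv by auto
    have "\<bar>nabla_pair k \<gamma> (pg V \<tau>) u v - ddiff M x (\<tau> u) (\<tau> v)\<bar> \<le> c / 4"
    proof (rule nr[OF fV uv])
      show "card V > N" using V by simp
      show "\<tau> ` V \<subseteq> {0..M}" using im sM by blast
      show "0 \<le> x i \<and> x i \<le> 1 \<and> \<bar>ratio V \<tau> i - x i\<bar> \<le> \<delta>" for i
        using partite_limits_nonneg[OF x_limit] partite_limits_le_1[OF x_limit]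
          near_ratio[OF x_limit n] d by simp
    qed
    moreover have "\<bar>ddiff M x (\<tau> u) (\<tau> v) - ?L (\<tau> u) (\<tau> v)\<bar> \<le> c / 4"
      using M(1)[THEN bspec, of "(\<tau> u, \<tau> v)", unfolded fst_conv snd_conv tm] ts by blast
    moreover have "?L (\<tau> u) (\<tau> v) \<ge> c" using str1 ts unfolding str1_def by blast
    ultimately have np: "nabla_pair k \<gamma> (pg V \<tau>) u v \<ge> c / 2" by linarith
    let ?b = "real (card V - 2 choose (k - 2))"
    have "k - 2 \<le> card V - 2" using V by (intro diff_le_mono) simp
    then have b0: "?b > 0" by (simp add: zero_less_binomial_iff)
    have "\<Lambda> (pg V \<tau>) - \<Lambda> (flip_pair (pg V \<tau>) u v) = nabla_pair k \<gamma> (pg V \<tau>) u v * ?b"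
      unfolding nabla_pair_def verts_pg using b0 by simp
    also have "\<dots> \<ge> c / 2 * ?b" using np b0 by (intro mult_right_mono) auto
    also have "c / 2 * ?b = gain * (real k ^ k * ?b)" unfolding gain_def using k_pos by simp
    also have "gain * (real k ^ k * ?b) \<ge> gain * (real (card V) ^ k / real (card V) ^ 2)"
      using power_le_binomial2[OF k2, of "card V"] V gain_pos by (intro mult_left_mono) auto
    finally show "\<Lambda> (pg V \<tau>) - \<Lambda> (flip_pair (pg V \<tau>) u v) \<ge> gain * (real (card V) ^ k / real (card V) ^ 2)" .
  qed
qed

text \<open>The wrong pairs may be flipped in any order. At each flip the graph differs only
  sparsely from \<open>pg V \<tau>\<close> around the pair, so at least half of the gain valid in
  \<open>pg V \<tau>\<close> is realised. The set of wrong pairs only shrinks, so the hypotheses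
  persist along the induction.\<close>

lemma flip_gain:
  obtains \<eta> \<delta> N where "\<eta> > 0" "\<delta> > 0" "\<And>V \<tau> G. \<lbrakk>near x \<delta> V \<tau>; card V > N; fin_graph G; verts G = V;
     real (card (edit G (pg V \<tau>))) \<le> \<eta> * real (card V) ^ 2;
     \<And>v. v \<in> V \<Longrightarrow> real (card {e \<in> edit G (pg V \<tau>). v \<in> e}) \<le> \<eta> * real (card V)\<rbrakk> \<Longrightarrow>
    \<Lambda> (pg V \<tau>) - \<Lambda> G \<ge> gain / 2 * (real (card V) ^ k / real (card V) ^ 2) * real (card (edit G (pg V \<tau>)))"
proof -
  obtain \<delta> N where d: "\<delta> > 0" and pair: "\<And>V \<tau> u v. \<lbrakk>near x \<delta> V \<tau>; card V > N; u \<in> V; v \<in> V; u \<noteq> v\<rbrakk> \<Longrightarrow>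
    \<Lambda> (pg V \<tau>) - \<Lambda> (flip_pair (pg V \<tau>) u v) \<ge> gain * (real (card V) ^ k / real (card V) ^ 2)"
    by (rule pair_gain) (rule that)
  \<comment> \<open>\<open>6 * B * \<eta> = gain / 4\<close>, and each flip uses two comparisons of
    rooted sums.\<close>
  define \<eta> where "\<eta> = gain / (24 * B)"
  have \<eta>: "\<eta> > 0" unfolding \<eta>_def using gain_pos B_pos by simp
  show ?thesis
  proof (rule that[OF \<eta> d, of N])
    fix V \<tau> G
    assume n: "near x \<delta> V \<tau>" and N: "card V > N" and G: "fin_graph G" "verts G = V"
      "real (card (edit G (pg V \<tau>))) \<le> \<eta> * real (card V) ^ 2"
      "\<And>v. v \<in> V \<Longrightarrow> real (card {e \<in> edit G (pg V \<tau>). v \<in> e}) \<le> \<eta> * real (card V)"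
    let ?H = "pg V \<tau>" let ?q = "real (card V) ^ k / real (card V) ^ 2"
    have fV: "finite V" using n by (simp add: near_def)
    have fH: "fin_graph ?H" by (rule fin_graph_pg[OF fV])
    show "\<Lambda> ?H - \<Lambda> G \<ge> gain / 2 * ?q * real (card (edit G ?H))"
      using G
    proof (induction "card (edit G ?H)" arbitrary: G)
      case 0
      then have "edit G ?H = {}" using finite_edit[OF 0(2) fH] by simp
      then have "edges G = edges ?H" by blast
      then have "G = ?H" using 0(3) by (simp add: prod_eq_iff)
      then show ?case by simp
    next
      case (Suc l G)
      let ?D = "edit G ?H"
      have fD: "finite ?D" by (rule finite_edit[OF Suc.prems(1) fH])
      from Suc.hyps(2) have "?D \<noteq> {}" by fastforce
      then obtain e where e: "e \<in> ?D" by blast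
      have vH: "verts ?H = verts G" using Suc.prems(2) by simp
      obtain u v where uv: "e = {u, v}" "u \<noteq> v" "u \<in> V" "v \<in> V"
        using edit_edge[OF Suc.prems(1) fH vH e] Suc.prems(2) by metis
      let ?G' = "flip_pair G u v" and ?H' = "flip_pair ?H u v"
      have fgG': "fin_graph ?G'" and fgH': "fin_graph ?H'"
        using Suc.prems(1,2) fH uv by (auto simp: fin_graph_def flip_pair_def)
      have vG': "verts ?G' = V" "verts ?H' = V" using Suc.prems(2) by (auto simp: flip_pair_def)
      have eD: "edit ?G' ?H = ?D - {e}" using e uv(1) by (auto simp: flip_pair_def)
      have eD': "edit G ?H' = ?D - {e}" using e uv(1) by (auto simp: flip_pair_def)
      have ff: "flip_pair ?G' u v = G" by (auto simp: flip_pair_def prod_eq_iff)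
      have cD: "card (?D - {e}) = l" using e fD Suc.hyps(2) by simp
      have small: "real (card (?D - {e})) \<le> \<eta> * real (card V) ^ 2"
        using Suc.prems(3) card_Diff1_le[of ?D e] by linarith
      have deg: "real (card {e' \<in> ?D - {e}. w \<in> e'}) \<le> \<eta> * real (card V)" if "w \<in> V" for w
      proof -
        have "card {e' \<in> ?D - {e}. w \<in> e'} \<le> card {e' \<in> ?D. w \<in> e'}"
          by (rule card_mono[OF finite_subset[OF _ fD]]) blast+
        then show ?thesis using Suc.prems(4)[OF that] by linarith
      qed
      have IH: "\<Lambda> ?H - \<Lambda> ?G' \<ge> gain / 2 * ?q * real (card (?D - {e}))"
        using Suc.hyps(1)[of ?G'] cD eD fgG' vG' small deg by simp
      \<comment> \<open>With \<open>e\<close> flipped on exactly one side, the two graphs compared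
        agree at \<open>{u, v}\<close>, as \<open>rsum_diff_pair\<close> demands: both are right
        there in this comparison and both wrong in the next.\<close>
      have 1: "\<bar>rs ?G' {u, v} - rs ?H {u, v}\<bar> \<le> 6 * B * \<eta> * ?q"
      proof -
        have "\<bar>rs ?G' {u, v} - rs ?H {u, v}\<bar> \<le> 6 * B * \<eta> * (real (order ?G') ^ k / real (order ?G') ^ 2)"
          by (rule rsum_diff_pair[OF fgG' fH]) (use vG' uv \<eta> small deg in \<open>auto simp only: eD verts_pg\<close>)
        then show ?thesis unfolding vG' .
      qed
      have 2: "\<bar>rs G {u, v} - rs ?H' {u, v}\<bar> \<le> 6 * B * \<eta> * ?q"
      proof -
        have "\<bar>rs G {u, v} - rs ?H' {u, v}\<bar> \<le> 6 * B * \<eta> * (real (order G) ^ k / real (order G) ^ 2)"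
          by (rule rsum_diff_pair[OF Suc.prems(1) fgH']) (use vG' Suc.prems(2) uv \<eta> small deg in \<open>auto simp only: eD'\<close>)
        then show ?thesis unfolding Suc.prems(2) .
      qed
      have 3: "rs ?H {u, v} - rs ?H' {u, v} \<ge> gain * ?q"
        using pair[OF n N uv(3,4,2)] Lambda_flip[of ?H u v] fV by simp
      have 4: "\<Lambda> ?G' - \<Lambda> G = rs ?G' {u, v} - rs G {u, v}"
        using Lambda_flip[of ?G' u v] fV vG' unfolding ff by simp
      have \<eta>': "6 * B * \<eta> = gain / 4" unfolding \<eta>_def using B_pos by simp
      have "r3 - r2 \<ge> gain / 2 * q" if "\<bar>r3 - r1\<bar> \<le> gain / 4 * q" "\<bar>r2 - r4\<bar> \<le> gain / 4 * q" "r1 - r4 \<ge> gain * q"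
        for q r1 r2 r3 r4 :: real using that by linarith
      from this[OF 1[unfolded \<eta>'] 2[unfolded \<eta>'] 3] have "\<Lambda> ?G' - \<Lambda> G \<ge> gain / 2 * ?q" unfolding 4 .
      moreover have "real (card ?D) = real (card (?D - {e})) + 1" using cD Suc.hyps(2) by simp
      ultimately show ?case using IH by (simp add: distrib_left)
    qed
  qed
qed

end

text \<open>The counterpart of \<open>attach_ratio_tendsto\<close> for a single finite graph whose
  vertex \<open>z\<close> sees each part uniformly, with \<open>\<alpha>\<close> the exact share of
  universal vertices adjacent to \<open>z\<close>.\<close>

lemma attach_ratio_near:
  assumes V: "finite V'" and r: "\<And>i. \<bar>ratio V' \<tau> i - x i\<bar> \<le> \<delta>" and \<alpha>: "0 \<le> \<alpha>" "\<alpha> \<le> 1" and q: "q \<in> {0, 1}"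
    and nb: "\<And>v. v \<in> V' \<Longrightarrow> \<tau> v \<noteq> 0 \<Longrightarrow> {z, v} \<in> edges G \<longleftrightarrow> b (\<tau> v)"
    and cnt: "real (card {v \<in> V'. \<tau> v = 0 \<and> {z, v} \<in> edges G}) = \<alpha> * real (card {v \<in> V'. \<tau> v = 0})"
  shows "\<bar>ratio V' (nbr_type G z \<tau>) (i, q) - attach_ratio x b \<alpha> (i, q)\<bar> \<le> \<delta>"
proof -
  have \<delta>: "\<delta> \<ge> 0" using r[of 0] by linarith
  have scale: "\<bar>a * s - a * t\<bar> \<le> \<delta>" if "0 \<le> a" "a \<le> 1" "\<bar>s - t\<bar> \<le> \<delta>" for a s t :: real
  proof -
    have "\<bar>a * s - a * t\<bar> = a * \<bar>s - t\<bar>" using that(1) by (simp add: abs_mult flip: right_diff_distrib)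
    also have "\<dots> \<le> 1 * \<delta>" using that by (intro mult_mono) auto
    finally show ?thesis by simp
  qed
  show ?thesis
  proof (cases "i = 0")
    case False
    have "{v \<in> V'. nbr_type G z \<tau> v = (i, q)} = (if (q = 1) = b i then {v \<in> V'. \<tau> v = i} else {})"
      using nb False q by (auto simp: nbr_type_def)
    then have "ratio V' (nbr_type G z \<tau>) (i, q) = (if (q = 1) = b i then ratio V' \<tau> i else 0)"
      by (simp add: ratio_def)
    then show ?thesis using r[of i] False \<delta> by (simp add: attach_ratio_def)
  next
    case True
    let ?A = "{v \<in> V'. \<tau> v = 0 \<and> {z, v} \<in> edges G}" and ?C = "{v \<in> V'. \<tau> v = 0}"
    show ?thesis
    proof (cases "q = 1")
      case q1: True
      have "{v \<in> V'. nbr_type G z \<tau> v = (i, q)} = ?A" using True q1 by (auto simp: nbr_type_def)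
      then have "ratio V' (nbr_type G z \<tau>) (i, q) = \<alpha> * ratio V' \<tau> 0" by (simp add: ratio_def cnt)
      then show ?thesis using scale[OF \<alpha> r[of 0]] True q1 by (simp add: attach_ratio_def)
    next
      case q0: False
      have "{v \<in> V'. nbr_type G z \<tau> v = (i, q)} = ?C - ?A" using True q0 q by (auto simp: nbr_type_def)
      moreover have "card (?C - ?A) = card ?C - card ?A" using V by (intro card_Diff_subset) auto
      moreover have "card ?A \<le> card ?C" using V by (intro card_mono) auto
      ultimately have "real (card {v \<in> V'. nbr_type G z \<tau> v = (i, q)}) = (1 - \<alpha>) * real (card ?C)"
        by (simp add: of_nat_diff cnt left_diff_distrib)
      then have "ratio V' (nbr_type G z \<tau>) (i, q) = (1 - \<alpha>) * ratio V' \<tau> 0" by (simp add: ratio_def)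
      then show ?thesis using scale[OF _ _ r[of 0], of "1 - \<alpha>"] \<alpha> True q0 by (simp add: attach_ratio_def)
    qed
  qed
qed

lemma edit_vertex_card:
  assumes V: "finite V" "z \<in> V" and G: "fin_graph G" "verts G = V" "del_vertex G z = del_vertex (pg V \<tau>) z"
  shows "card (edit G (pg V (\<tau>(z := i)))) = card {v \<in> V - {z}. ({z, v} \<in> edges G) \<noteq> adj i (\<tau> v)}"
proof -
  let ?H = "pg V (\<tau>(z := i))"
  have fH: "fin_graph ?H" by (rule fin_graph_pg[OF V(1)])
  have d: "del_vertex G z = del_vertex ?H z" using G(3) by (simp only: del_vertex_pg_upd)
  have "{e \<in> edit G ?H. z \<in> e} = edit G ?H"
    using del_vertex_edit[OF d G(1) fH] G(2) by auto
  then have "card (edit G ?H) = card {v \<in> V - {z}. ({z, v} \<in> edges G) \<noteq> ({z, v} \<in> edges ?H)}"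
    using incident_edit[OF G(1) fH, of z] G(2) V(2) by simp
  also have "{v \<in> V - {z}. ({z, v} \<in> edges G) \<noteq> ({z, v} \<in> edges ?H)} = {v \<in> V - {z}. ({z, v} \<in> edges G) \<noteq> adj i (\<tau> v)}"
    using V(2) by (intro Collect_cong) (auto simp: pg_edge)
  finally show ?thesis .
qed

section \<open>Gain from replacing a vertex that sees each part uniformly\<close>

context strict_point begin

text \<open>Here the weight in (Str2) acquires its meaning:
  \<open>(1 - \<alpha>) * x 0 + str_weight x b i\<close> is the limiting proportion of vertices
  whose adjacency to \<open>z\<close> would be wrong if \<open>z\<close> belonged to part
  \<open>i\<close>.\<close>

lemma bad_neighbours_le:
  assumes V: "finite V'" "V' \<noteq> {}" "\<tau> ` V' \<subseteq> supp x" and r: "\<And>i. \<bar>ratio V' \<tau> i - x i\<bar> \<le> \<delta>"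
    and \<alpha>: "0 \<le> \<alpha>" "\<alpha> \<le> 1" and i: "i \<in> supp x"
    and nb: "\<And>v. v \<in> V' \<Longrightarrow> \<tau> v \<noteq> 0 \<Longrightarrow> {z, v} \<in> edges G \<longleftrightarrow> b (\<tau> v)"
    and cnt: "real (card {v \<in> V'. \<tau> v = 0 \<and> {z, v} \<in> edges G}) = \<alpha> * real (card {v \<in> V'. \<tau> v = 0})"
  shows "real (card {v \<in> V'. ({z, v} \<in> edges G) \<noteq> adj i (\<tau> v)}) \<le>
    real (card V') * ((1 - \<alpha>) * x 0 + str_weight x b i + real (card (supp x)) * \<delta>)"
proof -
  let ?bad = "{v \<in> V'. ({z, v} \<in> edges G) \<noteq> adj i (\<tau> v)}" and ?n = "real (card V')"
  \<comment> \<open>The wrong proportion contributed by type \<open>j\<close>: missing universal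
    vertices, unwanted neighbours in the own part, missing neighbours in another part.\<close>
  define t where "t j = (if j = 0 then (1 - \<alpha>) * x 0 else if j = i then of_bool (b i) * x i else (1 - of_bool (b j)) * x j)" for j
  have n: "?n > 0" using V by (simp add: card_gt_0_iff)
  have \<delta>: "\<delta> \<ge> 0" using r[of 0] by linarith
  have nn: "0 \<le> x j" for j by (rule partite_limits_nonneg[OF x_limit])
  have cj: "real (card {v \<in> V'. \<tau> v = j}) = ?n * ratio V' \<tau> j" for j using n by (simp add: ratio_def)
  have cj_le: "real (card {v \<in> V'. \<tau> v = j}) \<le> ?n * (x j + \<delta>)" for j
    unfolding cj using r[of j] n by (intro mult_left_mono) auto
  have part: "real (card {v \<in> ?bad. \<tau> v = j}) \<le> ?n * (t j + \<delta>)" for j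
  proof (cases "j = 0")
    case True
    have "{v \<in> ?bad. \<tau> v = j} = {v \<in> V'. \<tau> v = 0} - {v \<in> V'. \<tau> v = 0 \<and> {z, v} \<in> edges G}"
      using True by (auto simp: adj_def)
    moreover have "card ({v \<in> V'. \<tau> v = 0} - {v \<in> V'. \<tau> v = 0 \<and> {z, v} \<in> edges G}) =
      card {v \<in> V'. \<tau> v = 0} - card {v \<in> V'. \<tau> v = 0 \<and> {z, v} \<in> edges G}"
      using V by (intro card_Diff_subset) auto
    moreover have "card {v \<in> V'. \<tau> v = 0 \<and> {z, v} \<in> edges G} \<le> card {v \<in> V'. \<tau> v = 0}"
      using V by (intro card_mono) auto
    ultimately have "real (card {v \<in> ?bad. \<tau> v = j}) = (1 - \<alpha>) * real (card {v \<in> V'. \<tau> v = 0})"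
      by (simp add: of_nat_diff cnt left_diff_distrib)
    also have "\<dots> \<le> (1 - \<alpha>) * (?n * (x 0 + \<delta>))" using cj_le[of 0] \<alpha> by (intro mult_left_mono) auto
    also have "\<dots> = ?n * ((1 - \<alpha>) * x 0 + (1 - \<alpha>) * \<delta>)" by (simp add: algebra_simps)
    also have "\<dots> \<le> ?n * ((1 - \<alpha>) * x 0 + 1 * \<delta>)" using \<alpha> \<delta> by (intro mult_left_mono add_left_mono mult_right_mono) auto
    finally show ?thesis using True by (simp add: t_def)
  next
    case j0: False
    have sub: "card {v \<in> ?bad. \<tau> v = j} \<le> card {v \<in> V'. \<tau> v = j}" using V by (intro card_mono) auto
    show ?thesis
    proof (cases "b j = (j = i)")
      case True
      then have "t j = x j" using j0 by (auto simp: t_def)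
      then show ?thesis using sub cj_le[of j] by simp
    next
      case False
      have "{v \<in> ?bad. \<tau> v = j} = {}" using False nb j0 by (auto simp: adj_def)
      moreover have "0 \<le> ?n * (t j + \<delta>)" using False j0 \<delta> by (auto simp: t_def)
      ultimately show ?thesis by (simp only: card.empty of_nat_0)
    qed
  qed
  have "?bad = (\<Union>j\<in>supp x. {v \<in> ?bad. \<tau> v = j})" using V(3) by auto
  then have "card ?bad = card (\<Union>j\<in>supp x. {v \<in> ?bad. \<tau> v = j})" by (rule arg_cong[where f = card])
  also have "\<dots> \<le> (\<Sum>j\<in>supp x. card {v \<in> ?bad. \<tau> v = j})" by (rule card_UN_le[OF fin_supp])
  finally have "real (card ?bad) \<le> (\<Sum>j\<in>supp x. real (card {v \<in> ?bad. \<tau> v = j}))"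
    by (simp flip: of_nat_sum)
  also have "\<dots> \<le> (\<Sum>j\<in>supp x. ?n * (t j + \<delta>))" by (rule sum_mono) (rule part)
  also have "\<dots> = ?n * (sum t (supp x) + real (card (supp x)) * \<delta>)"
    by (simp add: sum.distrib flip: sum_distrib_left)
  also have "sum t (supp x) = (1 - \<alpha>) * x 0 + str_weight x b i"
  proof -
    have "sum t (supp x) = sum t (insert 0 (supp x))"
    proof (cases "0 \<in> supp x")
      case False
      then have "x 0 = 0" using nn[of 0] by (simp add: supp_def)
      then show ?thesis using False fin_supp by (simp add: t_def)
    qed (simp add: insert_absorb)
    also have "\<dots> = t 0 + sum t (supp x - {0})" using fin_supp by (rule sum.insert_remove)
    also have "sum t (supp x - {0}) = str_weight x b i"
    proof (cases "i = 0")
      case True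
      have "sum t (supp x - {0}) = (\<Sum>j\<in>supp x - {0}. (1 - of_bool (b j)) * x j)"
        by (rule sum.cong) (auto simp: t_def True)
      then show ?thesis using fin_supp True by (simp add: str_weight_def)
    next
      case False
      have "sum t (supp x - {0}) = t i + sum t (supp x - {0} - {i})"
        using fin_supp i False by (intro sum.remove) auto
      also have "sum t (supp x - {0} - {i}) = (\<Sum>j\<in>supp x - {0, i}. (1 - of_bool (b j)) * x j)"
        by (rule sum.cong) (auto simp: t_def)
      finally show ?thesis using fin_supp False by (simp add: str_weight_def t_def)
    qed
    finally show ?thesis by (simp add: t_def)
  qed
  finally show ?thesis .
qed

text \<open>If \<open>z\<close> is \<open>d * n\<close> pairs away from every clone, the count of
  wrong adjacencies bounds the right side of (Str2) from below by about \<open>c * d\<close>. The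
  error \<open>\<omega>\<close> is fixed before \<open>d\<close>; already \<open>d = 0\<close> says
  that no clone beats the base clone by more than the error.\<close>

lemma vertex_gain:
  assumes \<omega>: "\<omega> > 0"
  obtains \<delta> N where "\<delta> > 0" "\<And>V \<tau> z G d. \<lbrakk>near x \<delta> V \<tau>; card V > N; z \<in> V; fin_graph G; verts G = V;
     del_vertex G z = del_vertex (pg V \<tau>) z;
     \<And>i. i \<ge> 1 \<Longrightarrow> (\<forall>v\<in>V - {z}. \<tau> v = i \<longrightarrow> {z, v} \<in> edges G) \<or> (\<forall>v\<in>V - {z}. \<tau> v = i \<longrightarrow> {z, v} \<notin> edges G);
     d \<ge> 0; \<And>i. i \<in> supp x \<Longrightarrow> real (card (edit G (pg V (\<tau>(z := i))))) \<ge> d * real (card V)\<rbrakk> \<Longrightarrow>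
    \<Lambda> (pg V (\<tau>(z := base_part))) - \<Lambda> G \<ge> (c * d - \<omega>) * real (card V - 1 choose (k - 1))"
proof -
  let ?M = top_part and ?K = "real (card (supp x))"
  have "\<omega> / 4 > 0" using \<omega> by simp
  from vertex_near[OF this, of ?M] obtain \<delta>1 N1 where d1: "\<delta>1 > 0" and nr: "\<And>G z \<tau> y. \<lbrakk>fin_graph G; z \<in> verts G; del_vertex G z = pg (verts G - {z}) \<tau>;
     order G > N1; \<tau> ` (verts G - {z}) \<subseteq> {0..?M};
     \<And>i q. i \<le> ?M \<Longrightarrow> q \<in> {0, 1} \<Longrightarrow>
       0 \<le> y (i, q) \<and> y (i, q) \<le> 1 \<and> \<bar>ratio (verts G - {z}) (nbr_type G z \<tau>) (i, q) - y (i, q)\<bar> \<le> \<delta>1\<rbrakk>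
    \<Longrightarrow> \<bar>rs G {z} / real (order G - 1 choose (k - 1)) - dens1 ?M y\<bar> \<le> \<omega> / 4" by metis
  \<comment> \<open>The second bound makes the proportion errors of all types together cost at most
    \<open>\<omega> / 2\<close>; two sampling errors of \<open>\<omega> / 4\<close> use up the
    rest.\<close>
  define \<delta> where "\<delta> = min (\<delta>1 / 2) (\<omega> / (4 * c * (?K + 1)))"
  have \<delta>: "\<delta> > 0" "2 * \<delta> \<le> \<delta>1" "\<delta> \<le> \<omega> / (4 * c * (?K + 1))"
    unfolding \<delta>_def using d1 \<omega> c_pos by (auto simp: add_pos_nonneg min_def)
  have cK: "c * (?K * (2 * \<delta>)) \<le> \<omega> / 2"
  proof -
    have "\<delta> * (4 * c * (?K + 1)) \<le> \<omega>" using \<delta>(3) c_pos by (simp add: pos_le_divide_eq add_pos_nonneg)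
    moreover have "4 * c * \<delta> \<ge> 0" using c_pos \<delta>(1) by simp
    ultimately show ?thesis by (simp add: algebra_simps)
  qed
  define N where "N = max N1 (max k (1 + nat \<lceil>1 / \<delta>\<rceil>))"
  show ?thesis
  proof (rule that[OF \<delta>(1), of N])
    fix V \<tau> z G d
    assume n: "near x \<delta> V \<tau>" and NV: "card V > N" and z: "z \<in> V" and G: "fin_graph G" "verts G = V"
      "del_vertex G z = del_vertex (pg V \<tau>) z"
      and hom: "\<And>i. i \<ge> 1 \<Longrightarrow> (\<forall>v\<in>V - {z}. \<tau> v = i \<longrightarrow> {z, v} \<in> edges G) \<or> (\<forall>v\<in>V - {z}. \<tau> v = i \<longrightarrow> {z, v} \<notin> edges G)"
      and d: "d \<ge> 0" and far: "\<And>i. i \<in> supp x \<Longrightarrow> real (card (edit G (pg V (\<tau>(z := i))))) \<ge> d * real (card V)"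
    let ?V' = "V - {z}" and ?H = "pg V (\<tau>(z := base_part))"
    let ?b = "real (card V - 1 choose (k - 1))"
    have fV: "finite V" and im: "\<tau> ` V \<subseteq> supp x" using n by (auto simp: near_def)
    have cV: "card V > N1" "card V > k" "real (card V - 1) \<ge> 1 / \<delta>" "card V > 1" using NV unfolding N_def by linarith+
    have cV': "card ?V' = card V - 1" using z fV by simp
    have fV': "finite ?V'" "?V' \<noteq> {}"
    proof -
      show "finite ?V'" using fV by simp
      show "?V' \<noteq> {}"
      proof
        assume "?V' = {}"
        then have "card ?V' = 0" by (simp only: card.empty)
        then show False using cV(4) cV' by simp
      qed
    qed
    have im': "\<tau> ` ?V' \<subseteq> supp x" using im by blast
    have b0: "?b > 0" using cV(2) by (simp add: zero_less_binomial_iff diff_le_mono)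
    have r: "\<bar>ratio ?V' \<tau> i - x i\<bar> \<le> 2 * \<delta>" for i
    proof -
      have "\<bar>ratio ?V' \<tau> i - ratio V \<tau> i\<bar> \<le> 1 / real (card V - 1)"
        using ratio_remove[OF fV, of "{z}" \<tau> i] z cV(4) by simp
      also have "\<dots> \<le> \<delta>" using cV(3,4) \<delta>(1) by (simp add: field_simps)
      finally show ?thesis using near_ratio[OF x_limit n, of i] \<delta>(1) by linarith
    qed
    have fH: "fin_graph ?H" by (rule fin_graph_pg[OF fV])
    have dH: "del_vertex ?H z = pg ?V' \<tau>" unfolding del_vertex_pg_upd by (rule del_vertex_pg)
    have dG: "del_vertex G z = pg ?V' \<tau>" unfolding G(3) by (rule del_vertex_pg)
    have estimate: "\<bar>rs K {z} / ?b - dens1 ?M (attach_ratio x b \<alpha>)\<bar> \<le> \<omega> / 4"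
      if K: "fin_graph K" "verts K = V" "del_vertex K z = pg ?V' \<tau>" and \<alpha>: "0 \<le> \<alpha>" "\<alpha> \<le> 1"
        and nb: "\<And>v. v \<in> ?V' \<Longrightarrow> \<tau> v \<noteq> 0 \<Longrightarrow> {z, v} \<in> edges K \<longleftrightarrow> b (\<tau> v)"
        and cnt: "real (card {v \<in> ?V'. \<tau> v = 0 \<and> {z, v} \<in> edges K}) = \<alpha> * real (card {v \<in> ?V'. \<tau> v = 0})"
      for K b \<alpha>
    proof -
      have "\<bar>rs K {z} / real (order K - 1 choose (k - 1)) - dens1 ?M (attach_ratio x b \<alpha>)\<bar> \<le> \<omega> / 4"
      proof (rule nr)
        show "fin_graph K" by (rule K(1))
        show "z \<in> verts K" using z K(2) by simp
        show "del_vertex K z = pg (verts K - {z}) \<tau>" unfolding K(2) by (rule K(3))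
        show "order K > N1" using cV(1) K(2) by simp
        show "\<tau> ` (verts K - {z}) \<subseteq> {0..?M}" unfolding K(2) using im' supp_top by blast
        show "0 \<le> attach_ratio x b \<alpha> (i, q) \<and> attach_ratio x b \<alpha> (i, q) \<le> 1 \<and>
          \<bar>ratio (verts K - {z}) (nbr_type K z \<tau>) (i, q) - attach_ratio x b \<alpha> (i, q)\<bar> \<le> \<delta>1" if q: "q \<in> {0, 1}" for i q
          unfolding K(2) using attach_ratio_bounds[OF x_limit \<alpha>, of b "(i, q)"]
            attach_ratio_near[OF fV'(1) r \<alpha> q nb cnt, of i] \<delta>(2) by linarith
      qed
      then show ?thesis unfolding K(2) .
    qed
    have H1: "\<bar>rs ?H {z} / ?b - dens1 ?M (attach_ratio x (e_vec 1) 1)\<bar> \<le> \<omega> / 4"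
    proof (rule estimate[OF fH _ dH])
      have edge: "{z, v} \<in> edges ?H \<longleftrightarrow> adj base_part (\<tau> v)" if "v \<in> ?V'" for v
        using that z by (subst pg_edge) auto
      show "{z, v} \<in> edges ?H \<longleftrightarrow> e_vec 1 (\<tau> v)" if v: "v \<in> ?V'" "\<tau> v \<noteq> 0" for v
      proof (cases "1 \<in> supp x")
        case True
        then show ?thesis using edge[OF v(1)] by (auto simp: base_part_def adj_def e_vec_def)
      next
        case False
        then have "\<tau> v = 0" using supp_without_1 im' v(1) by blast
        then show ?thesis using v(2) by simp
      qed
      have "{v \<in> ?V'. \<tau> v = 0 \<and> {z, v} \<in> edges ?H} = {v \<in> ?V'. \<tau> v = 0}"
      proof (intro Collect_cong iffI)
        fix v assume v: "v \<in> ?V' \<and> \<tau> v = 0"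
        then have "adj base_part (\<tau> v)" by (auto simp: adj_def)
        then show "v \<in> ?V' \<and> \<tau> v = 0 \<and> {z, v} \<in> edges ?H" using edge v by blast
      qed blast
      then show "real (card {v \<in> ?V'. \<tau> v = 0 \<and> {z, v} \<in> edges ?H}) = 1 * real (card {v \<in> ?V'. \<tau> v = 0})"
        by simp
    qed auto
    define b where "b i = (\<exists>v\<in>?V'. \<tau> v = i \<and> {z, v} \<in> edges G)" for i
    define s where "s = card {v \<in> ?V'. \<tau> v = 0 \<and> {z, v} \<in> edges G}"
    define m where "m = card {v \<in> ?V'. \<tau> v = 0}"
    \<comment> \<open>The value \<open>1\<close> for an empty universal class is the convention that
      (Str2) demands when \<open>x 0 = 0\<close>.\<close>
    define \<alpha> where "\<alpha> = (if m = 0 then 1 else real s / real m)"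
    have sm: "s \<le> m" unfolding s_def m_def using fV'(1) by (intro card_mono) auto
    have \<alpha>: "0 \<le> \<alpha>" "\<alpha> \<le> 1" using sm by (auto simp: \<alpha>_def)
    have cnt: "real (card {v \<in> ?V'. \<tau> v = 0 \<and> {z, v} \<in> edges G}) = \<alpha> * real (card {v \<in> ?V'. \<tau> v = 0})"
      unfolding s_def[symmetric] m_def[symmetric] \<alpha>_def using sm by simp
    have nb: "{z, v} \<in> edges G \<longleftrightarrow> b (\<tau> v)" if v: "v \<in> ?V'" "\<tau> v \<noteq> 0" for v
    proof -
      have "\<tau> v \<ge> 1" using v(2) by simp
      from hom[OF this] show ?thesis unfolding b_def using v(1) by blast
    qed
    have x0: "\<alpha> = 1" if "x 0 = 0"
    proof -
      have "{v \<in> ?V'. \<tau> v = 0} = {}" using that im' by (auto simp: supp_def)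
      then have "m = 0" unfolding m_def by (simp only: card.empty)
      then show ?thesis by (simp add: \<alpha>_def)
    qed
    have H2: "\<bar>rs G {z} / ?b - dens1 ?M (attach_ratio x b \<alpha>)\<bar> \<le> \<omega> / 4"
      by (rule estimate[OF G(1,2) dG \<alpha> nb cnt])
    have w: "d - ?K * (2 * \<delta>) - (1 - \<alpha>) * x 0 \<le> str_weight x b i" if i: "i \<in> supp x" for i
    proof -
      have "d * real (card ?V') \<le> d * real (card V)" using d cV' by (intro mult_left_mono) auto
      also have "\<dots> \<le> real (card {v \<in> ?V'. ({z, v} \<in> edges G) \<noteq> adj i (\<tau> v)})"
        using far[OF i] edit_vertex_card[OF fV z G] by simp
      also have "\<dots> \<le> real (card ?V') * ((1 - \<alpha>) * x 0 + str_weight x b i + ?K * (2 * \<delta>))"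
        by (rule bad_neighbours_le[OF fV' im' r \<alpha> i nb cnt])
      finally have "real (card ?V') * d \<le> real (card ?V') * ((1 - \<alpha>) * x 0 + str_weight x b i + ?K * (2 * \<delta>))"
        by (simp only: mult.commute)
      moreover have "real (card ?V') > 0" using fV' by (simp add: card_gt_0_iff)
      ultimately have "d \<le> (1 - \<alpha>) * x 0 + str_weight x b i + ?K * (2 * \<delta>)"
        by (rule mult_left_le_imp_le)
      then show ?thesis by linarith
    qed
    have "d - ?K * (2 * \<delta>) - (1 - \<alpha>) * x 0 \<le> (INF i\<in>supp x. str_weight x b i)"
      by (rule cINF_greatest[OF supp_nonempty[OF x_limit] w])
    then have "d - ?K * (2 * \<delta>) \<le> (1 - \<alpha>) * x 0 + (INF i\<in>supp x. str_weight x b i)" by linarith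
    then have "c * (d - ?K * (2 * \<delta>)) \<le> c * ((1 - \<alpha>) * x 0 + (INF i\<in>supp x. str_weight x b i))"
      using c_pos by (intro mult_left_mono) auto
    also have "\<dots> \<le> nabla_vertex_lim k \<gamma> b \<alpha> x" using str2 \<alpha> x0 unfolding str2_def by blast
    also have "\<dots> = dens1 ?M (attach_ratio x (e_vec 1) 1) - dens1 ?M (attach_ratio x b \<alpha>)"
      by (rule nabla_vertex_lim_eq[OF x_limit supp_top \<alpha>])
    finally have "c * d - c * (?K * (2 * \<delta>)) \<le> dens1 ?M (attach_ratio x (e_vec 1) 1) - dens1 ?M (attach_ratio x b \<alpha>)"
      by (simp only: right_diff_distrib)
    then have "c * d - \<omega> \<le> rs ?H {z} / ?b - rs G {z} / ?b" using H1 H2 cK by linarith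
    then have "c * d - \<omega> \<le> (rs ?H {z} - rs G {z}) / ?b" by (simp only: diff_divide_distrib)
    then have "(c * d - \<omega>) * ?b \<le> rs ?H {z} - rs G {z}" using b0 by (simp only: pos_le_divide_eq)
    moreover have "\<Lambda> ?H - \<Lambda> G = rs ?H {z} - rs G {z}"
      using fV G(2) dH dG by (intro Lambda_vertex) auto
    ultimately show "\<Lambda> ?H - \<Lambda> G \<ge> (c * d - \<omega>) * ?b" by simp
  qed
qed

end

lemma incident_pg:
  assumes V: "finite V" "v \<in> V" and G: "fin_graph G" "verts G = V"
  shows "card {e \<in> edit G (pg V \<sigma>). v \<in> e} = card {w \<in> V - {v}. ({v, w} \<in> edges G) \<noteq> adj (\<sigma> v) (\<sigma> w)}"
proof -
  have "{w \<in> V - {v}. ({v, w} \<in> edges G) \<noteq> ({v, w} \<in> edges (pg V \<sigma>))} =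
      {w \<in> V - {v}. ({v, w} \<in> edges G) \<noteq> adj (\<sigma> v) (\<sigma> w)}"
    using V(2) by (intro Collect_cong) (auto simp: pg_edge)
  then show ?thesis using incident_edit[OF G(1) fin_graph_pg[OF V(1)], of \<sigma> v] V(2) G(2) by simp
qed

text \<open>(Sym2) is phrased for parts, and universal vertices are singleton parts, so it makes the
  neighbourhood of \<open>z\<close> constant on the types \<open>i \<ge> 1\<close> only. Type
  \<open>0\<close> may remain split, which is what \<open>\<alpha>\<close> records.\<close>

lemma complete_partite_on_homogeneous:
  assumes A: "\<And>A. A \<in> cls V \<tau> ` V \<Longrightarrow> A \<subseteq> neighbours G z \<or> neighbours G z \<inter> A = {}" and i: "i \<ge> 1" and V: "V \<subseteq> verts G"
  shows "(\<forall>v\<in>V. \<tau> v = i \<longrightarrow> {z, v} \<in> edges G) \<or> (\<forall>v\<in>V. \<tau> v = i \<longrightarrow> {z, v} \<notin> edges G)"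
proof (cases "\<exists>v\<in>V. \<tau> v = i")
  case True
  then obtain v0 where v0: "v0 \<in> V" "\<tau> v0 = i" by blast
  have c: "cls V \<tau> v0 = {w \<in> V. \<tau> w = i}" using v0 i by (auto simp: cls_def)
  have "cls V \<tau> v0 \<in> cls V \<tau> ` V" using v0 by blast
  from A[OF this] show ?thesis unfolding c neighbours_def using V by blast
qed blast

section \<open>Gain from replacing an arbitrary vertex, and the local statement\<close>

context strict_point begin

text \<open>The conclusion of \<open>flip_gain\<close> as a predicate, so that the same constants
  can be handed to the two arguments below.\<close>

definition flip_ok :: "real \<Rightarrow> real \<Rightarrow> nat \<Rightarrow> bool" where
  "flip_ok \<eta> \<delta> N \<longleftrightarrow> (\<forall>V \<tau> G. near x \<delta> V \<tau> \<and> card V > N \<and> fin_graph G \<and> verts G = V \<and>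
     real (card (edit G (pg V \<tau>))) \<le> \<eta> * real (card V) ^ 2 \<and>
     (\<forall>v\<in>V. real (card {e \<in> edit G (pg V \<tau>). v \<in> e}) \<le> \<eta> * real (card V)) \<longrightarrow>
    \<Lambda> (pg V \<tau>) - \<Lambda> G \<ge> gain / 2 * (real (card V) ^ k / real (card V) ^ 2) * real (card (edit G (pg V \<tau>))))"

lemma flip_ok_exists: "\<exists>\<eta>>0. \<exists>\<delta>>0. \<exists>N. flip_ok \<eta> \<delta> N"
proof -
  obtain \<eta> \<delta> N where "\<eta> > 0" "\<delta> > 0" "\<And>V \<tau> G. \<lbrakk>near x \<delta> V \<tau>; card V > N; fin_graph G; verts G = V;
     real (card (edit G (pg V \<tau>))) \<le> \<eta> * real (card V) ^ 2;
     \<And>v. v \<in> V \<Longrightarrow> real (card {e \<in> edit G (pg V \<tau>). v \<in> e}) \<le> \<eta> * real (card V)\<rbrakk> \<Longrightarrow>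
    \<Lambda> (pg V \<tau>) - \<Lambda> G \<ge> gain / 2 * (real (card V) ^ k / real (card V) ^ 2) * real (card (edit G (pg V \<tau>)))"
    apply (rule flip_gain)
    subgoal premises p for a b c by (rule that[of a b c]; fact p)
    done
  then show ?thesis unfolding flip_ok_def by (intro exI[of _ \<eta>] exI[of _ \<delta>] exI[of _ N] conjI) auto
qed

text \<open>By continuity along the symmetrisation path, either the path ends far from every clone, where
  (Str2) applies, or it passes through a graph at a distance from some clone that is small enough
  for flipping pairs one by one, yet not negligible.\<close>

lemma clone_gain:
  assumes flip: "flip_ok \<eta>0 \<delta>0 N0" and \<delta>0: "\<delta>0 > 0" and \<eta>: "0 < \<eta>" "\<eta> \<le> \<eta>0"
  obtains \<beta> \<delta> N where "\<beta> > 0" "\<delta> > 0" "\<And>V \<tau> z G. \<lbrakk>near x \<delta> V \<tau>; card V > N; z \<in> V; fin_graph G; verts G = V;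
     del_vertex G z = del_vertex (pg V \<tau>) z;
     \<And>i. i \<in> supp x \<Longrightarrow> real (card (edit G (pg V (\<tau>(z := i))))) \<ge> \<eta> * real (card V)\<rbrakk> \<Longrightarrow>
    \<Lambda> (pg V (\<tau>(z := base_part))) - \<Lambda> G \<ge> \<beta> * (real (card V) ^ k / real (card V))"
proof -
  \<comment> \<open>The first bound leaves half of \<open>c * \<eta>\<close> if the path ends far
    from all clones. The second keeps the price of exchanging one clone for another at half of the
    gain from flipping.\<close>
  define \<omega> where "\<omega> = min (c * \<eta> / 2) (gain * \<eta> / 8)"
  have \<omega>: "\<omega> > 0" "\<omega> \<le> c * \<eta> / 2" "\<omega> \<le> gain * \<eta> / 8"
    unfolding \<omega>_def using c_pos gain_pos \<eta> by auto
  obtain \<delta>1 N1 where d1: "\<delta>1 > 0" and vg: "\<And>V \<tau> z G d. \<lbrakk>near x \<delta>1 V \<tau>; card V > N1; z \<in> V; fin_graph G; verts G = V;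
     del_vertex G z = del_vertex (pg V \<tau>) z;
     \<And>i. i \<ge> 1 \<Longrightarrow> (\<forall>v\<in>V - {z}. \<tau> v = i \<longrightarrow> {z, v} \<in> edges G) \<or> (\<forall>v\<in>V - {z}. \<tau> v = i \<longrightarrow> {z, v} \<notin> edges G);
     d \<ge> 0; \<And>i. i \<in> supp x \<Longrightarrow> real (card (edit G (pg V (\<tau>(z := i))))) \<ge> d * real (card V)\<rbrakk> \<Longrightarrow>
    \<Lambda> (pg V (\<tau>(z := base_part))) - \<Lambda> G \<ge> (c * d - \<omega>) * real (card V - 1 choose (k - 1))"
    apply (rule vertex_gain[OF \<omega>(1)])
    subgoal premises p for a b by (rule that[of a b]; fact p)
    done
  \<comment> \<open>With steps of at most \<open>\<eta> / 2 * n\<close>, the first graph of the path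
    that is closer than \<open>\<eta> * n\<close> to a clone is still at distance at least
    \<open>\<eta> / 2 * n\<close> from it.\<close>
  have "\<eta> / 2 > 0" using \<eta> by simp
  then obtain n0 where n0: "\<And>G. fin_graph G \<Longrightarrow> order G \<ge> n0 \<Longrightarrow> sym2 k \<gamma> (\<eta> / 2) G"
    using sym unfolding symmetrisable_def by blast
  define \<delta> where "\<delta> = min \<delta>1 (\<delta>0 / 2)"
  have \<delta>: "\<delta> > 0" "\<delta> \<le> \<delta>1" "\<delta> \<le> \<delta>0 / 2" unfolding \<delta>_def using d1 \<delta>0 by auto
  define N where "N = N0 + N1 + n0 + k + nat \<lceil>2 / \<delta>0\<rceil> + nat \<lceil>1 / \<eta>0\<rceil>"
  show ?thesis
  proof (rule that[of "gain * \<eta> / 8" \<delta> N])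
    show "gain * \<eta> / 8 > 0" using gain_pos \<eta> by simp
    show "\<delta> > 0" by (rule \<delta>)
    fix V \<tau> z G
    assume n: "near x \<delta> V \<tau>" and NV: "card V > N" and z: "z \<in> V" and G: "fin_graph G" "verts G = V"
      "del_vertex G z = del_vertex (pg V \<tau>) z"
      and far: "\<And>i. i \<in> supp x \<Longrightarrow> real (card (edit G (pg V (\<tau>(z := i))))) \<ge> \<eta> * real (card V)"
    let ?n = "real (card V)" and ?V' = "V - {z}" and ?H = "\<lambda>i. pg V (\<tau>(z := i))"
    let ?b = "real (card V - 1 choose (k - 1))"
    have fV: "finite V" and im: "\<tau> ` V \<subseteq> supp x" using n by (auto simp: near_def)
    have cV: "card V > N0" "card V > N1" "card V \<ge> n0" "card V \<ge> k" "?n \<ge> 2 / \<delta>0" "?n \<ge> 1 / \<eta>0" "?n \<ge> 1"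
      using NV unfolding N_def by linarith+
    have \<eta>0: "\<eta>0 > 0" using \<eta> by linarith
    have \<eta>0n: "\<eta>0 * ?n \<ge> 1" using cV(6) \<eta>0 by (simp add: field_simps)
    have q0: "?n ^ k / ?n \<ge> 0" by simp
    have b_le: "?b \<le> ?n ^ k / ?n"
    proof -
      have "?b \<le> real (card V - 1) ^ (k - 1)" by (rule binomial_le_power)
      also have "\<dots> \<le> ?n ^ (k - 1)" by (intro power_mono) auto
      also have "\<dots> = ?n ^ k / ?n" using k_pos cV(7) by (simp add: power_diff)
      finally show ?thesis .
    qed
    have n1: "near x \<delta>1 V \<tau>" by (rule near_mono[OF n \<delta>(2)])
    have fH: "fin_graph (?H i)" for i by (rule fin_graph_pg[OF fV])
    have cp: "complete_partite_on (del_vertex G z) (cls ?V' \<tau> ` ?V')"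
    proof -
      have "finite ?V'" using fV by (rule finite_Diff)
      from complete_partite_on_pg[OF this, of \<tau>] show ?thesis unfolding G(3) del_vertex_pg .
    qed
    have s2: "sym2 k \<gamma> (\<eta> / 2) G" by (rule n0[OF G(1)]) (simp only: G(2) cV(3))
    have zG: "z \<in> verts G" using z G(2) by simp
    obtain m :: nat and Gs :: "nat \<Rightarrow> graph" where path: "Gs 0 = G" "\<forall>i\<le>m. fin_graph (Gs i) \<and> verts (Gs i) = verts G"
      "\<forall>i\<in>{1..m}. del_vertex (Gs i) z = del_vertex G z \<and> lam k \<gamma> (Gs (i - 1)) \<le> lam k \<gamma> (Gs i) \<and>
         real (card (edit (Gs (i - 1)) (Gs i))) \<le> \<eta> / 2 * (real (order G) - 1)"
      and fin: "\<forall>A\<in>cls ?V' \<tau> ` ?V'. A \<subseteq> neighbours (Gs m) z \<or> neighbours (Gs m) z \<inter> A = {}"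
      using s2[unfolded sym2_def, THEN bspec, OF zG, THEN spec, THEN mp, OF cp]
      apply (elim exE conjE)
      subgoal premises p for m Gs by (rule that[of Gs m]; fact p)
      done
    have g: "fin_graph (Gs l)" "verts (Gs l) = V" if "l \<le> m" for l using path(2) that G(2) by auto
    have dg: "del_vertex (Gs l) z = del_vertex (pg V \<tau>) z" if "l \<le> m" for l
      using path(1,3) that G(3) by (cases "l = 0") auto
    have inc: "\<Lambda> G \<le> \<Lambda> (Gs l)" if "l \<le> m" for l
      using that
    proof (induction l)
      case (Suc l)
      then have "lam k \<gamma> (Gs l) \<le> lam k \<gamma> (Gs (Suc l))" using path(3)[THEN bspec, of "Suc l"] by simp
      then have "\<Lambda> (Gs l) \<le> \<Lambda> (Gs (Suc l))"
        using lam_le_iff_Lambda[of "Gs (Suc l)" "Gs l"] g Suc.prems cV(4) by simp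
      then show ?case using Suc by simp
    qed (simp add: path(1))
    define F where "F l i = real (card (edit (Gs l) (?H i)))" for l i
    show "\<Lambda> (?H base_part) - \<Lambda> G \<ge> gain * \<eta> / 8 * (?n ^ k / ?n)"
    proof (cases "\<forall>i\<in>supp x. F m i \<ge> \<eta> * ?n")
      case True
      have "\<Lambda> (?H base_part) - \<Lambda> (Gs m) \<ge> (c * \<eta> - \<omega>) * ?b"
      proof (rule vg[OF n1 cV(2) z g dg])
        show "(\<forall>v\<in>?V'. \<tau> v = i \<longrightarrow> {z, v} \<in> edges (Gs m)) \<or> (\<forall>v\<in>?V'. \<tau> v = i \<longrightarrow> {z, v} \<notin> edges (Gs m))" if "i \<ge> 1" for i
          using fin g(2)[of m] that by (intro complete_partite_on_homogeneous) auto
        show "real (card (edit (Gs m) (?H i))) \<ge> \<eta> * ?n" if "i \<in> supp x" for i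
          using True that unfolding F_def by blast
      qed (use \<eta> in auto)
      moreover have "c * \<eta> / 2 \<le> c * \<eta> - \<omega>" using \<omega>(2) by linarith
      then have "(c * \<eta> - \<omega>) * ?b \<ge> c * \<eta> / 2 * ?b" by (rule mult_right_mono) simp
      moreover have "c * \<eta> / 2 * ?b = gain * \<eta> * (real k ^ k * ?b)" unfolding gain_def using k_pos by simp
      moreover have "gain * \<eta> * (real k ^ k * ?b) \<ge> gain * \<eta> * (?n ^ k / ?n)"
        using power_le_binomial1[OF k_pos cV(4)] gain_pos \<eta> by (intro mult_left_mono) auto
      moreover have "gain * \<eta> / 8 * (?n ^ k / ?n) \<le> gain * \<eta> * (?n ^ k / ?n)"
        using gain_pos \<eta> by (intro mult_right_mono) auto
      ultimately show ?thesis using inc[of m] by linarith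
    next
      case False
      define P where "P l = (\<exists>i\<in>supp x. F l i < \<eta> * ?n)" for l
      have Pm: "P m" using False by (auto simp: P_def not_le)
      define l where "l = (LEAST l. P l)"
      have Pl: "P l" unfolding l_def using Pm by (rule LeastI)
      have lm: "l \<le> m" unfolding l_def using Pm by (rule Least_le)
      have "\<not> P 0"
      proof
        assume "P 0"
        then obtain i where "i \<in> supp x" "F 0 i < \<eta> * ?n" by (auto simp: P_def)
        then show False using far[of i] by (simp add: F_def path(1))
      qed
      then have l0: "l \<ge> 1" using Pl by (cases l) auto
      have nP: "\<not> P (l - 1)" unfolding l_def[symmetric]
        using not_less_Least[of "l - 1" P] l0 unfolding l_def[symmetric] by simp
      obtain i where i: "i \<in> supp x" "F l i < \<eta> * ?n" using Pl by (auto simp: P_def)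
      have Fl1: "F (l - 1) i \<ge> \<eta> * ?n" using nP i(1) by (auto simp: P_def not_less)
      have "F (l - 1) i \<le> real (card (edit (Gs (l - 1)) (Gs l))) + F l i"
        unfolding F_def using g lm by (intro card_edit_triangle) auto
      moreover have "real (card (edit (Gs (l - 1)) (Gs l))) \<le> \<eta> / 2 * (?n - 1)"
        using path(3) l0 lm G(2) by auto
      moreover have "\<eta> / 2 * (?n - 1) \<le> \<eta> / 2 * ?n" using \<eta> by (intro mult_left_mono) auto
      ultimately have Fl: "F l i \<ge> \<eta> / 2 * ?n" using Fl1 by linarith
      have ni: "near x \<delta>0 V (\<tau>(z := i))"
      proof -
        have "near x (\<delta> + \<delta>0 / 2) V (\<tau>(z := i))"
        proof (rule near_retype[OF n])
          show "{z} \<subseteq> V" using z by simp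
          show "real (card {z}) \<le> \<delta>0 / 2 * ?n" using cV(5) \<delta>0 by (simp add: field_simps)
          show "(\<tau>(z := i)) ` V \<subseteq> supp x" using im i(1) by auto
        qed (use \<delta>0 in auto)
        then show ?thesis by (rule near_mono) (use \<delta>(3) in linarith)
      qed
      have dl: "del_vertex (Gs l) z = del_vertex (?H i) z" unfolding del_vertex_pg_upd by (rule dg[OF lm])
      have fE: "finite (edit (Gs l) (?H i))" by (rule finite_edit[OF g(1)[OF lm] fH])
      have Fn: "F l i \<le> \<eta>0 * ?n"
      proof -
        have "\<eta> * ?n \<le> \<eta>0 * ?n" using \<eta> by (intro mult_right_mono) auto
        then show ?thesis using i(2) by linarith
      qed
      have Fn2: "F l i \<le> \<eta>0 * ?n ^ 2"
      proof -
        have "?n * 1 \<le> ?n * ?n" using cV(7) by (intro mult_left_mono) auto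
        then have "\<eta>0 * ?n \<le> \<eta>0 * ?n ^ 2" using \<eta>0 by (intro mult_left_mono) (auto simp: power2_eq_square)
        then show ?thesis using Fn by linarith
      qed
      \<comment> \<open>All wrong pairs contain \<open>z\<close>, so any other vertex lies in at
        most one of them, and \<open>1 \<le> \<eta>0 * n\<close> by the choice of
        \<open>N\<close>.\<close>
      have deg: "real (card {e \<in> edit (Gs l) (?H i). v \<in> e}) \<le> \<eta>0 * ?n" if v: "v \<in> V" for v
      proof (cases "v = z")
        case True
        have "card {e \<in> edit (Gs l) (?H i). v \<in> e} \<le> card (edit (Gs l) (?H i))"
          by (rule card_mono[OF fE]) blast
        then show ?thesis using Fn unfolding F_def by linarith
      next
        case False
        have "{e \<in> edit (Gs l) (?H i). v \<in> e} \<subseteq> {{z, v}}"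
        proof
          fix e assume e: "e \<in> {e \<in> edit (Gs l) (?H i). v \<in> e}"
          have vH: "verts (?H i) = verts (Gs l)" using g(2)[OF lm] by simp
          have "z \<in> e" by (rule del_vertex_edit[OF dl g(1)[OF lm] fH vH]) (use e in blast)
          moreover have "card e = 2" "finite e" using edit_card_2[OF g(1)[OF lm] fH, of e i] e by blast+
          ultimately have "{z, v} = e" using e False by (intro card_subset_eq) auto
          then show "e \<in> {{z, v}}" by simp
        qed
        then have "card {e \<in> edit (Gs l) (?H i). v \<in> e} \<le> card {{z, v}}" by (intro card_mono) auto
        then show ?thesis using \<eta>0n by simp
      qed
      have "\<Lambda> (?H i) - \<Lambda> (Gs l) \<ge> gain / 2 * (?n ^ k / ?n ^ 2) * F l i"
        using flip ni cV(1) g[OF lm] Fn2 deg unfolding flip_ok_def F_def by blast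
      moreover have "gain / 2 * (?n ^ k / ?n ^ 2) * F l i \<ge> gain / 2 * (?n ^ k / ?n ^ 2) * (\<eta> / 2 * ?n)"
        using Fl gain_pos by (intro mult_left_mono) auto
      moreover have "gain / 2 * (?n ^ k / ?n ^ 2) * (\<eta> / 2 * ?n) = gain * \<eta> / 4 * (?n ^ k / ?n)"
        using cV(7) by (simp add: power2_eq_square)
      \<comment> \<open>Passing from clone \<open>i\<close> to the base clone is the case
        \<open>d = 0\<close> of the vertex estimate.\<close>
      moreover have "\<Lambda> (?H base_part) - \<Lambda> (?H i) \<ge> (c * 0 - \<omega>) * ?b"
      proof (rule vg[OF n1 cV(2) z fH])
        show "(\<forall>v\<in>?V'. \<tau> v = j \<longrightarrow> {z, v} \<in> edges (?H i)) \<or> (\<forall>v\<in>?V'. \<tau> v = j \<longrightarrow> {z, v} \<notin> edges (?H i))" for j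
          using z by (auto simp: pg_edge)
      qed (auto simp: del_vertex_pg_upd)
      moreover have "(c * 0 - \<omega>) * ?b \<ge> - (gain * \<eta> / 8 * (?n ^ k / ?n))"
      proof -
        have "\<omega> * ?b \<le> gain * \<eta> / 8 * (?n ^ k / ?n)"
          using \<omega> b_le gain_pos \<eta> by (intro mult_mono) auto
        then show ?thesis by simp
      qed
      moreover have "gain * \<eta> / 4 * (?n ^ k / ?n) = gain * \<eta> / 8 * (?n ^ k / ?n) + gain * \<eta> / 8 * (?n ^ k / ?n)"
        by (simp add: field_simps)
      ultimately show ?thesis using inc[OF lm] by linarith
    qed
  qed
qed

text \<open>Vertices of large wrong degree are few; those that fit some part are merely retyped, and
  only the rest, \<open>U\<close>, has to be replaced. A replaced vertex absorbs at most
  \<open>n\<close> wrong pairs and gains order \<open>n^k / n\<close>, a flipped pair gains order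
  \<open>n^k / n^2\<close>, so both stages gain the same amount per edited pair.\<close>

lemma local_stability:
  obtains \<delta> N c' where "\<delta> > 0" "c' > 0" "\<And>G. \<lbrakk>fin_graph G; order G > N; close_to \<delta> x G\<rbrakk> \<Longrightarrow>
    \<exists>H. complete_partite H \<and> verts H = verts G \<and>
      \<Lambda> H - \<Lambda> G \<ge> c' * (real (order G) ^ k / real (order G) ^ 2) * real (card (edit G H))"
proof -
  obtain \<eta>0 \<delta>0 N0 where f0: "\<eta>0 > 0" "\<delta>0 > 0" and flip: "flip_ok \<eta>0 \<delta>0 N0" using flip_ok_exists by blast
  \<comment> \<open>Slack for retyping, which changes a wrong degree by at most
    \<open>card Z\<close>: fitting vertices stay within \<open>\<eta>0 * n\<close>, the others keep
    at least \<open>\<eta> / 2 * n\<close>.\<close>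
  define \<eta> where "\<eta> = \<eta>0 / 2"
  have \<eta>: "\<eta> > 0" "\<eta> + \<eta> = \<eta>0" unfolding \<eta>_def using f0 by auto
  have \<eta>2: "0 < \<eta> / 2" "\<eta> / 2 \<le> \<eta>0" using \<eta> by auto
  obtain \<beta> \<delta>2 N2 where b: "\<beta> > 0" "\<delta>2 > 0" and clone: "\<And>V \<tau> z G. \<lbrakk>near x \<delta>2 V \<tau>; card V > N2; z \<in> V; fin_graph G; verts G = V;
     del_vertex G z = del_vertex (pg V \<tau>) z;
     \<And>i. i \<in> supp x \<Longrightarrow> real (card (edit G (pg V (\<tau>(z := i))))) \<ge> \<eta> / 2 * real (card V)\<rbrakk> \<Longrightarrow>
    \<Lambda> (pg V (\<tau>(z := base_part))) - \<Lambda> G \<ge> \<beta> * (real (card V) ^ k / real (card V))"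
    apply (rule clone_gain[OF flip f0(2) \<eta>2])
    subgoal premises p for a b c by (rule that[of a b c]; fact p)
    done
  \<comment> \<open>The last bound makes the two comparisons in each replacement,
    \<open>4 * B * \<xi>\<close> apiece, cost at most half of \<open>\<beta>\<close>.\<close>
  define \<xi> where "\<xi> = min (min \<delta>0 \<delta>2) (min (\<eta> / 2) (\<beta> / (16 * B)))"
  have \<xi>: "\<xi> > 0" "\<xi> \<le> \<delta>0" "\<xi> \<le> \<delta>2" "\<xi> \<le> \<eta> / 2" "\<xi> \<le> \<beta> / (16 * B)"
    unfolding \<xi>_def using f0 b \<eta> B_pos by auto
  have \<xi>B: "8 * B * \<xi> \<le> \<beta> / 2" using \<xi>(5) B_pos by (simp add: field_simps)
  \<comment> \<open>Solved from \<open>\<delta> + 2 * \<zeta> = \<xi>\<close>, where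
    \<open>\<zeta> = 2 * \<delta> / \<eta>\<close> bounds the proportion of
    \<open>Z\<close>.\<close>
  define \<delta> where "\<delta> = \<xi> / (1 + 4 / \<eta>)"
  define \<zeta> where "\<zeta> = 2 * \<delta> / \<eta>"
  have den: "1 + 4 / \<eta> > 0" using \<eta> by (intro add_pos_pos) auto
  have \<delta>: "\<delta> > 0" unfolding \<delta>_def using \<xi> den by simp
  have \<zeta>: "\<zeta> > 0" unfolding \<zeta>_def using \<delta> \<eta> by simp
  have sum: "\<delta> + 2 * \<zeta> = \<xi>"
  proof -
    have "\<delta> + 2 * \<zeta> = \<delta> * (1 + 4 / \<eta>)" unfolding \<zeta>_def by (simp add: field_simps)
    then show ?thesis unfolding \<delta>_def using den by simp
  qed
  have \<zeta>\<xi>: "\<zeta> \<le> \<xi>" "\<delta> + \<zeta> \<le> \<xi>" using sum \<delta> \<zeta> by linarith+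
  show ?thesis
  proof (rule that[of \<delta> "min gain \<beta> / 2" "max N0 N2"])
    show "\<delta> > 0" by (rule \<delta>)
    show "min gain \<beta> / 2 > 0" using gain_pos b by simp
    fix G assume fG: "fin_graph G" and NG: "order G > max N0 N2" and cl: "close_to \<delta> x G"
    define V where "V = verts G"
    let ?n = "real (card V)" and ?E = "edges G"
    have vG: "verts G = V" by (simp add: V_def)
    have fV: "finite V" using fG by (simp add: fin_graph_def V_def)
    have cV: "card V > N0" "card V > N2" using NG by (auto simp: V_def)
    then have n1: "?n \<ge> 1" by linarith
    obtain \<tau> where \<tau>: "\<tau> ` V \<subseteq> supp x" "\<forall>i\<in>supp x. \<bar>ratio V \<tau> i - x i\<bar> \<le> \<delta>" "real (card (edit G (pg V \<tau>))) \<le> \<delta> * ?n ^ 2"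
      using cl unfolding close_to_def vG by blast
    have near0: "near x \<delta> V \<tau>" using \<tau> fV by (simp add: near_def)
    have fpg: "fin_graph (pg V \<sigma>)" for \<sigma> by (rule fin_graph_pg[OF fV])
    define D where "D \<sigma> i v = {w \<in> V - {v}. ({v, w} \<in> ?E) \<noteq> adj i (\<sigma> w)}" for \<sigma> :: "nat \<Rightarrow> nat" and i v
    have fD: "finite (D \<sigma> i v)" for \<sigma> i v unfolding D_def using fV by simp
    \<comment> \<open>The wrong degrees sum to at most twice the number of wrong pairs, so at most
      \<open>\<zeta> * n\<close> vertices exceed the threshold.\<close>
    define Z where "Z = {v \<in> V. real (card (D \<tau> (\<tau> v) v)) > \<eta> * ?n}"
    have ZV: "Z \<subseteq> V" by (auto simp: Z_def)
    have fZ: "finite Z" using ZV fV finite_subset by blast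
    have cZ: "real (card Z) \<le> \<zeta> * ?n"
    proof -
      let ?ed = "edit G (pg V \<tau>)"
      have "\<eta> * ?n * real (card Z) = (\<Sum>v\<in>Z. \<eta> * ?n)" by simp
      also have "\<dots> \<le> (\<Sum>v\<in>Z. real (card (D \<tau> (\<tau> v) v)))" by (rule sum_mono) (auto simp: Z_def)
      also have "\<dots> \<le> (\<Sum>v\<in>V. real (card (D \<tau> (\<tau> v) v)))" using fV ZV by (intro sum_mono2) auto
      also have "\<dots> = (\<Sum>v\<in>V. real (card {e \<in> ?ed. v \<in> e}))"
        unfolding D_def using incident_pg[OF fV _ fG vG, of _ \<tau>] by (intro sum.cong) auto
      also have "\<dots> = real (\<Sum>v\<in>V. card {e \<in> ?ed. v \<in> e})" by simp
      also have "\<dots> \<le> real (2 * card ?ed)"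
        unfolding of_nat_le_iff
      proof (rule handshake_le[OF fV])
        show "finite ?ed" by (rule finite_edit[OF fG fpg])
        show "card e = 2" if "e \<in> ?ed" for e by (rule edit_card_2(1)[OF fG fpg that])
      qed
      also have "\<dots> \<le> 2 * (\<delta> * ?n ^ 2)" using \<tau>(3) by simp
      also have "\<dots> = \<eta> * ?n * (\<zeta> * ?n)" unfolding \<zeta>_def using \<eta> by (simp add: power2_eq_square)
      finally have "\<eta> * ?n * real (card Z) \<le> \<eta> * ?n * (\<zeta> * ?n)" .
      moreover have "\<eta> * ?n > 0" using \<eta> n1 by (intro mult_pos_pos) auto
      ultimately show ?thesis by (rule mult_left_le_imp_le)
    qed
    define good where "good v i \<longleftrightarrow> i \<in> supp x \<and> real (card (D \<tau> i v)) \<le> \<eta> * ?n" for v i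
    \<comment> \<open>Vertices without a fitting part already receive the type of their future
      replacement, so that \<open>pg V \<tau>'\<close> is the final graph of both stages.\<close>
    define \<tau>' where "\<tau>' v = (if v \<in> Z then (if \<exists>i. good v i then (SOME i. good v i) else base_part) else \<tau> v)" for v
    define U where "U = {v \<in> Z. \<not> (\<exists>i. good v i)}"
    have UZ: "U \<subseteq> Z" by (auto simp: U_def)
    have fU: "finite U" using UZ fZ finite_subset by blast
    have goodS: "good v (SOME i. good v i)" if "\<exists>i. good v i" for v using that by (rule someI_ex)
    have im': "\<tau>' ` V \<subseteq> supp x"
    proof
      fix i assume "i \<in> \<tau>' ` V"
      then obtain v where v: "v \<in> V" "i = \<tau>' v" by blast
      have "\<tau> v \<in> supp x" using \<tau>(1) v(1) by blast
      moreover have "(SOME i. good v i) \<in> supp x" if "\<exists>i. good v i" using goodS[OF that] by (simp add: good_def)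
      ultimately show "i \<in> supp x" unfolding v(2) \<tau>'_def using base_part by simp
    qed
    have near1: "near x \<xi> V \<tau>'"
    proof -
      have "near x (\<delta> + \<zeta>) V \<tau>'"
        by (rule near_retype[OF near0 ZV cZ _ im']) (use \<zeta> in \<open>auto simp: \<tau>'_def\<close>)
      then show ?thesis by (rule near_mono[OF _ \<zeta>\<xi>(2)])
    qed
    let ?H = "pg V \<tau>'"
    have shift: "real (card (D \<sigma> i v)) \<le> real (card (D \<rho> i v)) + real (card Z)"
      if "\<And>w. w \<in> V - Z \<Longrightarrow> \<sigma> w = \<rho> w" for \<sigma> \<rho> i v
    proof -
      have "card (D \<sigma> i v) \<le> card (D \<rho> i v \<union> Z)"
      proof (rule card_mono)
        show "finite (D \<rho> i v \<union> Z)" using fD fZ by simp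
        show "D \<sigma> i v \<subseteq> D \<rho> i v \<union> Z" using that unfolding D_def by auto
      qed
      then show ?thesis using card_Un_le[of "D \<rho> i v" Z] by linarith
    qed
    have agree: "\<tau>' w = \<tau> w" if "w \<in> V - Z" for w using that by (simp add: \<tau>'_def)
    have D_good: "real (card (D \<tau>' (\<tau>' v) v)) \<le> \<eta>0 * ?n" if v: "v \<in> V" "v \<notin> U" for v
    proof -
      have "real (card (D \<tau> (\<tau>' v) v)) \<le> \<eta> * ?n"
      proof (cases "v \<in> Z")
        case True
        then have ex: "\<exists>i. good v i" using v(2) by (simp add: U_def)
        then have "\<tau>' v = (SOME i. good v i)" using True by (simp add: \<tau>'_def)
        then show ?thesis using goodS[OF ex] by (simp add: good_def)
      next
        case False
        then have "\<tau>' v = \<tau> v" by (simp add: \<tau>'_def)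
        moreover have "real (card (D \<tau> (\<tau> v) v)) \<le> \<eta> * ?n" using False v(1) unfolding Z_def by simp
        ultimately show ?thesis by simp
      qed
      moreover have "real (card (D \<tau>' (\<tau>' v) v)) \<le> real (card (D \<tau> (\<tau>' v) v)) + real (card Z)"
        by (rule shift) (rule agree)
      moreover have "\<zeta> * ?n \<le> \<eta> * ?n" using \<zeta>\<xi> \<xi>(4) \<eta> by (intro mult_right_mono) auto
      moreover have "\<eta>0 * ?n = \<eta> * ?n + \<eta> * ?n" unfolding \<eta>(2)[symmetric] by (rule distrib_right)
      ultimately show ?thesis using cZ by linarith
    qed
    have D_bad: "real (card (D \<tau>' i v)) \<ge> \<eta> / 2 * ?n" if v: "v \<in> U" "i \<in> supp x" for v i
    proof -
      have "\<not> good v i" using v(1) by (auto simp: U_def)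
      then have "real (card (D \<tau> i v)) > \<eta> * ?n" using v(2) by (simp add: good_def)
      moreover have "real (card (D \<tau> i v)) \<le> real (card (D \<tau>' i v)) + real (card Z)"
        by (rule shift) (rule agree[symmetric])
      moreover have "\<zeta> * ?n \<le> \<eta> / 2 * ?n" using \<zeta>\<xi> \<xi>(4) by (intro mult_right_mono) auto
      moreover have "\<eta> * ?n = \<eta> / 2 * ?n + \<eta> / 2 * ?n" by simp
      ultimately show ?thesis using cZ by linarith
    qed
    have edit_total: "real (card (edit G ?H)) \<le> (\<delta> + \<zeta>) * ?n ^ 2"
    proof -
      have tri: "real (card (edit G ?H)) \<le> real (card (edit G (pg V \<tau>))) + real (card (edit (pg V \<tau>) ?H))"
        by (rule card_edit_triangle[OF fG fpg])
      have "real (card (edit (pg V \<tau>) ?H)) \<le> ?n * (\<zeta> * ?n)"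
      proof (rule card_doubletons_le[OF fV, where R = "\<lambda>u v. v \<in> Z"])
        have "{v \<in> V. v \<in> Z} = Z" using ZV by blast
        then show "real (card {v \<in> V. v \<in> Z}) \<le> \<zeta> * ?n" using cZ by simp
        show "edit (pg V \<tau>) ?H \<subseteq> {{u, v} |u v. u \<in> V \<and> v \<in> V \<and> v \<in> Z}"
        proof
          fix e assume e: "e \<in> edit (pg V \<tau>) ?H"
          have vH: "verts ?H = verts (pg V \<tau>)" by simp
          obtain u v where uv: "e = {u, v}" "u \<noteq> v" "u \<in> V" "v \<in> V"
            using edit_edge[OF fpg fpg vH e] by (metis verts_pg)
          have "({u, v} \<in> edges (pg V \<tau>)) \<noteq> ({u, v} \<in> edges ?H)" using e unfolding uv(1) by blast
          then have "adj (\<tau> u) (\<tau> v) \<noteq> adj (\<tau>' u) (\<tau>' v)" unfolding pg_edge[OF uv(3,4,2)] .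
          then have "v \<in> Z \<or> u \<in> Z" using agree[of u] agree[of v] uv(3,4) by (metis DiffI)
          then show "e \<in> {{u, v} |u v. u \<in> V \<and> v \<in> V \<and> v \<in> Z}"
          proof
            assume "v \<in> Z" then show ?thesis using uv by blast
          next
            assume "u \<in> Z" then show ?thesis using uv by (intro CollectI exI[of _ v] exI[of _ u]) auto
          qed
        qed
      qed
      then show ?thesis using tri \<tau>(3) by (simp add: power2_eq_square algebra_simps)
    qed
    \<comment> \<open>A hybrid: pairs meeting \<open>W\<close> are as in \<open>?H\<close>, all
      others as in \<open>G\<close>. Enlarging \<open>W\<close> vertex by vertex leads from
      \<open>G\<close> to the graph in which all of \<open>U\<close> has been replaced.\<close>
    define gw where "gw W = (V, {e \<in> ?E. e \<inter> W = {}} \<union> {e \<in> edges ?H. e \<inter> W \<noteq> {}})" for W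
    have vgw: "verts (gw W) = V" and egw: "edges (gw W) = {e \<in> ?E. e \<inter> W = {}} \<union> {e \<in> edges ?H. e \<inter> W \<noteq> {}}" for W
      by (simp_all add: gw_def)
    have fgw: "fin_graph (gw W)" for W
      using fG fpg[of \<tau>'] unfolding fin_graph_def vgw egw vG by auto
    have edit_gw: "edit (gw W) ?H = {e \<in> edit G ?H. e \<inter> W = {}}" for W unfolding egw by blast
    have fed: "finite (edit G ?H)" by (rule finite_edit[OF fG fpg])
    have card_gw: "real (card (edit (gw W) ?H)) \<le> (\<delta> + \<zeta>) * ?n ^ 2" for W
    proof -
      have "card (edit (gw W) ?H) \<le> card (edit G ?H)" unfolding edit_gw by (rule card_mono[OF fed]) blast
      then show ?thesis using edit_total by linarith
    qed
    have \<xi>n: "(\<delta> + \<zeta>) * ?n ^ 2 \<le> \<xi> * ?n ^ 2" using \<zeta>\<xi> by (intro mult_right_mono) auto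
    let ?q = "?n ^ k / ?n"
    have replace: "\<Lambda> (gw W) - \<Lambda> G \<ge> \<beta> / 2 * ?q * real (card W)" if "finite W" "W \<subseteq> U" for W
      using that
    proof (induction W rule: finite_induct)
      case empty
      have "gw {} = G" by (simp add: gw_def V_def)
      then show ?case by simp
    next
      case (insert z W)
      have zU: "z \<in> U" and WU: "W \<subseteq> U" using insert.prems by auto
      have zV: "z \<in> V" using zU UZ ZV by blast
      let ?G1 = "gw W" and ?G2 = "gw (insert z W)"
      \<comment> \<open>The clone estimate needs a complete partite graph away from
        \<open>z\<close>. So the step from \<open>?G1\<close> to \<open>?G2\<close> is compared with
        the step from \<open>Hz\<close> to \<open>?H\<close>, where \<open>z\<close> starts from its
        neighbourhood in \<open>G\<close> but in clean surroundings.\<close>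
      define Hz where "Hz = (V, {e \<in> ?E. z \<in> e} \<union> {e \<in> edges ?H. z \<notin> e})"
      have vHz: "verts Hz = V" and eHz: "edges Hz = {e \<in> ?E. z \<in> e} \<union> {e \<in> edges ?H. z \<notin> e}"
        by (simp_all add: Hz_def)
      have fHz: "fin_graph Hz"
        using fG fpg[of \<tau>'] unfolding fin_graph_def vHz eHz vG by auto
      have dHz: "del_vertex Hz z = del_vertex ?H z"
        by (rule del_vertex_eqI) (simp add: vHz, unfold eHz, blast)
      have d12: "del_vertex ?G2 z = del_vertex ?G1 z"
        by (rule del_vertex_eqI) (simp add: vgw, unfold egw, blast)
      have upd: "\<tau>'(z := base_part) = \<tau>'" using zU by (auto simp: \<tau>'_def U_def fun_eq_iff)
      have "\<Lambda> (pg V (\<tau>'(z := base_part))) - \<Lambda> Hz \<ge> \<beta> * ?q"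
      proof (rule clone[OF near_mono[OF near1 \<xi>(3)] cV(2) zV fHz vHz dHz])
        fix i assume i: "i \<in> supp x"
        have "card (edit Hz (pg V (\<tau>'(z := i)))) = card {v \<in> V - {z}. ({z, v} \<in> edges Hz) \<noteq> adj i (\<tau>' v)}"
          by (rule edit_vertex_card[OF fV zV fHz vHz dHz])
        also have "{v \<in> V - {z}. ({z, v} \<in> edges Hz) \<noteq> adj i (\<tau>' v)} = D \<tau>' i z"
          unfolding D_def eHz by (intro Collect_cong) auto
        finally have eq: "card (edit Hz (pg V (\<tau>'(z := i)))) = card (D \<tau>' i z)" .
        show "real (card (edit Hz (pg V (\<tau>'(z := i))))) \<ge> \<eta> / 2 * ?n"
          unfolding eq by (rule D_bad[OF zU i])
      qed
      then have g0: "\<Lambda> ?H - \<Lambda> Hz \<ge> \<beta> * ?q" unfolding upd .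
      have s1: "\<Lambda> ?H - \<Lambda> Hz = rs ?H {z} - rs Hz {z}"
        by (rule Lambda_vertex) (use fV vHz dHz in auto)
      have s2: "\<Lambda> ?G2 - \<Lambda> ?G1 = rs ?G2 {z} - rs ?G1 {z}"
        by (rule Lambda_vertex) (use fV vgw d12 in auto)
      have e1: "\<bar>rs ?G2 {z} - rs ?H {z}\<bar> \<le> 4 * B * \<xi> * ?q"
      proof -
        have "\<bar>rs ?G2 {z} - rs ?H {z}\<bar> \<le> 4 * B * \<xi> * (real (order ?G2) ^ k / real (order ?G2))"
        proof (rule rsum_diff_vertex[OF fgw fpg])
          show "verts ?H = verts ?G2" by (simp add: vgw)
          show "z \<in> verts ?G2" by (simp add: vgw zV)
          show "real (card (edit ?G2 ?H)) \<le> \<xi> * real (order ?G2) ^ 2" unfolding vgw using card_gw[of "insert z W"] \<xi>n by linarith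
          have "{e \<in> edit ?G2 ?H. z \<in> e} = {}" unfolding edit_gw by blast
          then show "real (card {e \<in> edit ?G2 ?H. z \<in> e}) \<le> \<xi> * real (order ?G2)"
            unfolding vgw using \<xi>(1) by (simp only: card.empty) simp
        qed (use \<xi> in simp)
        then show ?thesis unfolding vgw .
      qed
      \<comment> \<open>Away from \<open>z\<close>, \<open>?G1\<close> and \<open>Hz\<close> differ
        at most where \<open>G\<close> and \<open>?H\<close> do. At \<open>z\<close> they differ
        only in pairs towards \<open>W\<close>, the vertices already replaced, and these number at
        most \<open>\<zeta> * n\<close>.\<close>
      have e2: "\<bar>rs ?G1 {z} - rs Hz {z}\<bar> \<le> 4 * B * \<xi> * ?q"
      proof -
        have sub: "edit ?G1 Hz \<subseteq> edit ?G1 ?H \<union> (\<lambda>w. {z, w}) ` W"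
        proof
          fix e assume e: "e \<in> edit ?G1 Hz"
          show "e \<in> edit ?G1 ?H \<union> (\<lambda>w. {z, w}) ` W"
          proof (cases "z \<in> e")
            case False
            then have "e \<in> edges Hz \<longleftrightarrow> e \<in> edges ?H" unfolding eHz by blast
            then show ?thesis using e by blast
          next
            case True
            have v12: "verts Hz = verts ?G1" by (simp add: vgw vHz)
            have ne: "e \<inter> W \<noteq> {}"
            proof
              assume "e \<inter> W = {}"
              then have "e \<in> edges ?G1 \<longleftrightarrow> e \<in> ?E" unfolding egw by blast
              moreover have "e \<in> edges Hz \<longleftrightarrow> e \<in> ?E" unfolding eHz using True by blast
              ultimately show False using e by blast
            qed
            then obtain w where w: "w \<in> e" "w \<in> W" by blast
            have zw: "z \<noteq> w" using w(2) insert.hyps(2) by blast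
            have "card e = 2" "finite e" using edit_card_2[OF fgw fHz e] by auto
            then have "{z, w} = e" using True w(1) zw by (intro card_subset_eq) auto
            then show ?thesis using w(2) by blast
          qed
        qed
        have cW: "real (card W) \<le> \<zeta> * ?n"
        proof -
          have "card W \<le> card Z" using WU UZ by (intro card_mono[OF fZ]) blast
          then show ?thesis using cZ by linarith
        qed
        have fim: "finite ((\<lambda>w. {z, w}) ` W)" using insert.hyps(1) by simp
        have cim: "real (card ((\<lambda>w. {z, w}) ` W)) \<le> \<zeta> * ?n"
          using card_image_le[OF insert.hyps(1), of "\<lambda>w. {z, w}"] cW by linarith
        have nn2: "\<zeta> * ?n \<le> \<zeta> * ?n ^ 2"
        proof -
          have "?n * 1 \<le> ?n * ?n" using n1 by (intro mult_left_mono) auto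
          then show ?thesis using \<zeta> by (intro mult_left_mono) (auto simp: power2_eq_square)
        qed
        have "\<bar>rs ?G1 {z} - rs Hz {z}\<bar> \<le> 4 * B * \<xi> * (real (order ?G1) ^ k / real (order ?G1))"
        proof (rule rsum_diff_vertex[OF fgw fHz])
          show "verts Hz = verts ?G1" by (simp add: vgw vHz)
          show "z \<in> verts ?G1" by (simp add: vgw zV)
          have "card (edit ?G1 Hz) \<le> card (edit ?G1 ?H \<union> (\<lambda>w. {z, w}) ` W)"
            by (rule card_mono[OF _ sub]) (use finite_edit[OF fgw fpg] fim in blast)
          also have "\<dots> \<le> card (edit ?G1 ?H) + card ((\<lambda>w. {z, w}) ` W)" by (rule card_Un_le)
          finally have "real (card (edit ?G1 Hz)) \<le> (\<delta> + \<zeta>) * ?n ^ 2 + \<zeta> * ?n ^ 2"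
            using card_gw[of W] cim nn2 by linarith
          also have "\<dots> = \<xi> * ?n ^ 2" unfolding sum[symmetric] by (simp add: algebra_simps)
          finally show "real (card (edit ?G1 Hz)) \<le> \<xi> * real (order ?G1) ^ 2" unfolding vgw .
          have "{e \<in> edit ?G1 Hz. z \<in> e} \<subseteq> (\<lambda>w. {z, w}) ` W"
          proof
            fix e assume e: "e \<in> {e \<in> edit ?G1 Hz. z \<in> e}"
            show "e \<in> (\<lambda>w. {z, w}) ` W"
            proof (cases "e \<inter> W = {}")
              case True
              have "e \<in> edges ?G1 \<longleftrightarrow> e \<in> ?E" unfolding egw using True by blast
              moreover have "e \<in> edges Hz \<longleftrightarrow> e \<in> ?E" unfolding eHz using e by blast
              ultimately show ?thesis using e by blast
            next
              case False
              then have "e \<notin> edit ?G1 ?H" unfolding edit_gw by blast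
              then show ?thesis using sub e by blast
            qed
          qed
          then have "card {e \<in> edit ?G1 Hz. z \<in> e} \<le> card ((\<lambda>w. {z, w}) ` W)" by (rule card_mono[OF fim])
          moreover have "\<zeta> * ?n \<le> \<xi> * ?n" using \<zeta>\<xi> by (intro mult_right_mono) auto
          ultimately show "real (card {e \<in> edit ?G1 Hz. z \<in> e}) \<le> \<xi> * real (order ?G1)"
            unfolding vgw using cim by linarith
        qed (use \<xi> in simp)
        then show ?thesis unfolding vgw .
      qed
      have "4 * B * \<xi> * ?q + 4 * B * \<xi> * ?q \<le> \<beta> / 2 * ?q"
      proof -
        have "8 * B * \<xi> * ?q \<le> \<beta> / 2 * ?q" by (rule mult_right_mono[OF \<xi>B]) simp
        then show ?thesis by simp
      qed
      moreover have "\<beta> * ?q = \<beta> / 2 * ?q + \<beta> / 2 * ?q" by simp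
      ultimately have "\<Lambda> ?G2 - \<Lambda> ?G1 \<ge> \<beta> / 2 * ?q"
        using g0 e1 e2 unfolding s1 s2 by linarith
      moreover have "\<beta> / 2 * ?q * real (card (insert z W)) = \<beta> / 2 * ?q * real (card W) + \<beta> / 2 * ?q"
        using insert.hyps by (simp add: distrib_left)
      ultimately show ?case using insert.IH[OF WU] by linarith
    qed
    let ?q2 = "?n ^ k / ?n ^ 2"
    have r1: "\<Lambda> (gw U) - \<Lambda> G \<ge> \<beta> / 2 * ?q * real (card U)" by (rule replace[OF fU order_refl])
    have r2: "\<Lambda> ?H - \<Lambda> (gw U) \<ge> gain / 2 * ?q2 * real (card (edit (gw U) ?H))"
    proof -
      have "near x \<delta>0 V \<tau>'" by (rule near_mono[OF near1 \<xi>(2)])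
      moreover have "real (card (edit (gw U) ?H)) \<le> \<eta>0 * ?n ^ 2"
      proof -
        have "\<xi> * ?n ^ 2 \<le> \<eta>0 * ?n ^ 2" using \<xi>(4) \<eta> by (intro mult_right_mono) auto
        then show ?thesis using card_gw[of U] \<xi>n by linarith
      qed
      moreover have "real (card {e \<in> edit (gw U) ?H. v \<in> e}) \<le> \<eta>0 * ?n" if v: "v \<in> V" for v
      proof (cases "v \<in> U")
        case True
        then have "{e \<in> edit (gw U) ?H. v \<in> e} = {}" unfolding edit_gw by blast
        then show ?thesis using f0(1) by (simp only: card.empty) simp
      next
        case False
        have "card {e \<in> edit (gw U) ?H. v \<in> e} \<le> card {e \<in> edit G ?H. v \<in> e}"
          unfolding edit_gw by (rule card_mono[OF finite_subset[OF _ fed]]) blast+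
        also have "card {e \<in> edit G ?H. v \<in> e} = card (D \<tau>' (\<tau>' v) v)"
          unfolding D_def by (rule incident_pg[OF fV v fG vG])
        finally show ?thesis using D_good[OF v False] by linarith
      qed
      ultimately show ?thesis using flip cV(1) fgw[of U] vgw[of U] unfolding flip_ok_def by blast
    qed
    \<comment> \<open>A wrong pair either survives the replacements or meets \<open>U\<close>, and a
      vertex meets at most \<open>n\<close> pairs.\<close>
    have r3: "real (card (edit G ?H)) \<le> real (card (edit (gw U) ?H)) + ?n * real (card U)"
    proof -
      let ?T = "{e \<in> edit G ?H. e \<inter> U \<noteq> {}}"
      have "real (card ?T) \<le> ?n * real (card U)"
      proof (rule card_doubletons_le[OF fV, where R = "\<lambda>u v. v \<in> U"])
        have "{v \<in> V. v \<in> U} = U" using UZ ZV by blast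
        then show "real (card {v \<in> V. v \<in> U}) \<le> real (card U)" by simp
        show "?T \<subseteq> {{u, v} |u v. u \<in> V \<and> v \<in> V \<and> v \<in> U}"
        proof
          fix e assume e: "e \<in> ?T"
          have vH: "verts ?H = verts G" using vG by simp
          have e1: "e \<in> edit G ?H" using e by blast
          obtain u v where uv: "e = {u, v}" "u \<noteq> v" "u \<in> V" "v \<in> V"
            using edit_edge[OF fG fpg vH e1] vG by metis
          have "v \<in> U \<or> u \<in> U" using e uv(1) by blast
          then show "e \<in> {{u, v} |u v. u \<in> V \<and> v \<in> V \<and> v \<in> U}"
          proof
            assume "v \<in> U" then show ?thesis using uv by blast
          next
            assume "u \<in> U" then show ?thesis using uv by (intro CollectI exI[of _ v] exI[of _ u]) auto
          qed
        qed
      qed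
      moreover have "card (edit G ?H) \<le> card (edit (gw U) ?H) + card ?T"
      proof -
        have "edit G ?H = edit (gw U) ?H \<union> ?T" unfolding edit_gw by blast
        then have "card (edit G ?H) = card (edit (gw U) ?H \<union> ?T)" by (rule arg_cong[where f = card])
        also have "\<dots> \<le> card (edit (gw U) ?H) + card ?T" by (rule card_Un_le)
        finally show ?thesis .
      qed
      ultimately show ?thesis by linarith
    qed
    have "\<Lambda> ?H - \<Lambda> G \<ge> min gain \<beta> / 2 * ?q2 * real (card (edit G ?H))"
    proof -
      let ?m = "min gain \<beta> / 2"
      have q2: "?q2 \<ge> 0" by simp
      have m0: "?m \<ge> 0" using gain_pos b by simp
      have "?m * ?q2 * real (card (edit G ?H)) \<le> ?m * ?q2 * (real (card (edit (gw U) ?H)) + ?n * real (card U))"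
        using r3 m0 by (intro mult_left_mono) auto
      also have "\<dots> = ?m * (?q2 * real (card (edit (gw U) ?H))) + ?m * (?q2 * (?n * real (card U)))"
        by (simp only: distrib_left mult.assoc)
      also have "\<dots> \<le> gain / 2 * (?q2 * real (card (edit (gw U) ?H))) + \<beta> / 2 * (?q2 * (?n * real (card U)))"
        by (intro add_mono mult_right_mono) auto
      also have "?q2 * (?n * real (card U)) = ?q * real (card U)" using n1 by (simp add: power2_eq_square)
      finally show ?thesis using r1 r2 by (simp only: mult.assoc)
    qed
    then show "\<exists>H. complete_partite H \<and> verts H = verts G \<and>
      \<Lambda> H - \<Lambda> G \<ge> min gain \<beta> / 2 * (real (order G) ^ k / real (order G) ^ 2) * real (card (edit G H))"
      unfolding vG using complete_partite_pg[OF fV, of \<tau>'] by (intro exI[of _ ?H]) auto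
  qed
qed

end

section \<open>Perfect stability\<close>

lemma close_to_mono: "close_to \<delta> x G \<Longrightarrow> \<delta> \<le> \<delta>' \<Longrightarrow> close_to \<delta>' x G"
proof -
  assume cl: "close_to \<delta> x G" and le: "\<delta> \<le> \<delta>'"
  obtain \<tau> where \<tau>: "\<tau> ` verts G \<subseteq> supp x" "\<forall>i\<in>supp x. \<bar>ratio (verts G) \<tau> i - x i\<bar> \<le> \<delta>"
    "real (card (edit G (pg (verts G) \<tau>))) \<le> \<delta> * real (order G) ^ 2"
    using cl unfolding close_to_def by blast
  have "\<delta> * real (order G) ^ 2 \<le> \<delta>' * real (order G) ^ 2" using le by (rule mult_right_mono) simp
  then have "real (card (edit G (pg (verts G) \<tau>))) \<le> \<delta>' * real (order G) ^ 2" using \<tau>(3) by linarith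
  moreover have "\<forall>i\<in>supp x. \<bar>ratio (verts G) \<tau> i - x i\<bar> \<le> \<delta>'" using \<tau>(2) le by force
  ultimately show ?thesis unfolding close_to_def using \<tau>(1) by blast
qed

lemma close_to_edit:
  assumes cl: "close_to a x H" and G: "fin_graph G" "fin_graph H" "verts H = verts G"
    and e: "real (card (edit G H)) \<le> b * real (order G) ^ 2" "b \<ge> 0"
  shows "close_to (a + b) x G"
proof -
  obtain \<tau> where \<tau>: "\<tau> ` verts G \<subseteq> supp x" "\<forall>i\<in>supp x. \<bar>ratio (verts G) \<tau> i - x i\<bar> \<le> a"
    "real (card (edit H (pg (verts G) \<tau>))) \<le> a * real (order G) ^ 2"
    using cl unfolding close_to_def G(3) by blast
  have "real (card (edit G (pg (verts G) \<tau>))) \<le> real (card (edit G H)) + real (card (edit H (pg (verts G) \<tau>)))"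
    by (rule card_edit_triangle[OF G(1,2)])
  also have "\<dots> \<le> b * real (order G) ^ 2 + a * real (order G) ^ 2" by (rule add_mono[OF e(1) \<tau>(3)])
  also have "\<dots> = (a + b) * real (order G) ^ 2" by (simp add: distrib_right)
  finally have "real (card (edit G (pg (verts G) \<tau>))) \<le> (a + b) * real (order G) ^ 2" .
  moreover have "\<forall>i\<in>supp x. \<bar>ratio (verts G) \<tau> i - x i\<bar> \<le> a + b" using \<tau>(2) e(2) by force
  ultimately show ?thesis unfolding close_to_def using \<tau>(1) by blast
qed

lemma card_edit_le:
  assumes "fin_graph G" "fin_graph H" "verts H = verts G"
  shows "real (card (edit G H)) \<le> real (order G) ^ 2"
proof -
  have "real (card (edit G H)) \<le> real (card (verts G)) * real (card (verts G))"
  proof (rule card_doubletons_le[where R = "\<lambda>u v. True"])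
    show "finite (verts G)" using assms(1) by (simp add: fin_graph_def)
    show "edit G H \<subseteq> {{u, v} |u v. u \<in> verts G \<and> v \<in> verts G \<and> True}"
    proof
      fix e assume "e \<in> edit G H"
      from edit_edge[OF assms this] obtain u v where "e = {u, v}" "u \<in> verts G" "v \<in> verts G" by metis
      then show "e \<in> {{u, v} |u v. u \<in> verts G \<and> v \<in> verts G \<and> True}" by blast
    qed
  qed simp
  then show ?thesis by (simp add: power2_eq_square)
qed

text \<open>The identity is one of the bijections over which the minimum is taken.\<close>

lemma delta1_le:
  assumes "fin_graph G" "fin_graph H" "verts H = verts G"
  shows "delta1 G H \<le> 2 / (real (order G))\<^sup>2 * real (card (edit G H))"
proof -
  let ?S = "{card (edit H (graph_image \<sigma> G)) | \<sigma>. bij_betw \<sigma> (verts G) (verts H)}"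
  have "?S \<subseteq> {..card (edges H) + card (edges G)}"
  proof
    fix s assume "s \<in> ?S"
    then obtain \<sigma> where s: "s = card (edit H (graph_image \<sigma> G))" by blast
    have f: "finite (edges G)" "finite (edges H)" using assms finite_edges by auto
    have f': "finite (edges (graph_image \<sigma> G))" using f by (simp add: graph_image_def)
    have "s \<le> card (edges H \<union> edges (graph_image \<sigma> G))"
      unfolding s using f f' by (intro card_mono) auto
    also have "\<dots> \<le> card (edges H) + card (edges (graph_image \<sigma> G))" by (rule card_Un_le)
    also have "card (edges (graph_image \<sigma> G)) \<le> card (edges G)"
      using f by (simp add: graph_image_def card_image_le)
    finally show "s \<in> {..card (edges H) + card (edges G)}" by simp
  qed
  then have fin: "finite ?S" using finite_subset by blast
  have id: "graph_image id G = G" by (simp add: graph_image_def prod_eq_iff)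
  have "bij_betw id (verts G) (verts H)" using assms(3) by simp
  then have "card (edit H (graph_image id G)) \<in> ?S" by blast
  then have "card (edit H G) \<in> ?S" unfolding id .
  then have "Min ?S \<le> card (edit H G)" by (rule Min_le[OF fin])
  moreover have "edit H G = edit G H" by blast
  ultimately have "real (Min ?S) \<le> real (card (edit G H))" by simp
  then show ?thesis unfolding delta1_def by (rule mult_left_mono) simp
qed

section \<open>From local to global stability\<close>

context graph_param begin

text \<open>Finiteness of \<open>X\<close>, later the set of optimal limits, permits common
  constants: the claim is monotone in \<open>\<delta>\<close>, \<open>c'\<close> and
  \<open>N\<close>, so minima and maxima can be taken along an induction.\<close>

lemma uniform_local_stability:
  assumes sym: "symmetrisable k \<gamma>" and c: "c > 0" and X: "finite X"
    "\<And>x. x \<in> X \<Longrightarrow> x \<in> partite_limits \<and> str1 k \<gamma> c x \<and> str2 k \<gamma> c x"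
  shows "\<exists>\<delta>>0. \<exists>c'>0. \<exists>N. \<forall>x\<in>X. \<forall>G. fin_graph G \<and> order G > N \<and> close_to \<delta> x G \<longrightarrow>
    (\<exists>H. complete_partite H \<and> verts H = verts G \<and>
      \<Lambda> H - \<Lambda> G \<ge> c' * (real (order G) ^ k / real (order G) ^ 2) * real (card (edit G H)))"
  using X
proof (induction X rule: finite_induct)
  case empty
  have "(0 :: real) < 1" by simp
  then show ?case by blast
next
  case (insert x X)
  let ?P = "\<lambda>x \<delta> c' N. \<forall>G. fin_graph G \<and> order G > N \<and> close_to \<delta> x G \<longrightarrow>
    (\<exists>H. complete_partite H \<and> verts H = verts G \<and>
      \<Lambda> H - \<Lambda> G \<ge> c' * (real (order G) ^ k / real (order G) ^ 2) * real (card (edit G H)))"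
  have mono: "?P x \<delta> c' N" if P: "?P x \<delta>1 c1 N1" and le: "\<delta> \<le> \<delta>1" "c' \<le> c1" "N1 \<le> N" for x \<delta> c' N \<delta>1 c1 N1
  proof (intro allI impI)
    fix G assume G: "fin_graph G \<and> order G > N \<and> close_to \<delta> x G"
    then have "close_to \<delta>1 x G" using close_to_mono le(1) by blast
    then obtain H where H: "complete_partite H" "verts H = verts G"
      "\<Lambda> H - \<Lambda> G \<ge> c1 * (real (order G) ^ k / real (order G) ^ 2) * real (card (edit G H))"
      using P[rule_format, of G] G le(3) by auto
    have "c' * (real (order G) ^ k / real (order G) ^ 2) * real (card (edit G H)) \<le>
      c1 * (real (order G) ^ k / real (order G) ^ 2) * real (card (edit G H))"
      using le(2) by (intro mult_right_mono) auto
    then show "\<exists>H. complete_partite H \<and> verts H = verts G \<and>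
      \<Lambda> H - \<Lambda> G \<ge> c' * (real (order G) ^ k / real (order G) ^ 2) * real (card (edit G H))"
      using H by (intro exI[of _ H]) auto
  qed
  have xX: "x \<in> partite_limits" "str1 k \<gamma> c x" "str2 k \<gamma> c x" using insert.prems by auto
  interpret sp: strict_point k \<gamma> B x c
    by unfold_locales (use xX c sym in auto)
  have "\<exists>\<delta>>0. \<exists>c'>0. \<exists>N. ?P x \<delta> c' N"
    apply (rule sp.local_stability)
    subgoal premises p for \<delta> c' N
      using p by (intro exI[of _ \<delta>] exI[of _ c'] exI[of _ N] conjI) auto
    done
  then obtain \<delta>1 c1 N1 where 1: "\<delta>1 > 0" "c1 > 0" "?P x \<delta>1 c1 N1" by blast
  have "\<exists>\<delta>>0. \<exists>c'>0. \<exists>N. \<forall>x\<in>X. ?P x \<delta> c' N" using insert.IH insert.prems by blast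
  then obtain \<delta>2 c2 N2 where 2: "\<delta>2 > 0" "c2 > 0" "\<And>x. x \<in> X \<Longrightarrow> ?P x \<delta>2 c2 N2" by blast
  have "?P y (min \<delta>1 \<delta>2) (min c1 c2) (max N1 N2)" if "y \<in> insert x X" for y
  proof (cases "y = x")
    case True
    show ?thesis unfolding True by (rule mono[OF 1(3)]) auto
  next
    case False
    then have "y \<in> X" using that by blast
    show ?thesis by (rule mono[OF 2(3)[OF \<open>y \<in> X\<close>]]) auto
  qed
  then show ?case using 1(1,2) 2(1,2)
    by (intro exI[of _ "min \<delta>1 \<delta>2"] exI[of _ "min c1 c2"] exI[of _ "max N1 N2"] conjI ballI) auto
qed

lemma lam_gain:
  assumes "verts H = verts G" "order G \<ge> k" "c' \<ge> 0"
    and "\<Lambda> H - \<Lambda> G \<ge> c' * (real (order G) ^ k / real (order G) ^ 2) * real (card (edit G H))"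
  shows "c' * (real (card (edit G H)) / real (order G) ^ 2) \<le> lam k \<gamma> H - lam k \<gamma> G"
proof -
  let ?b = "real (order G choose k)" and ?n = "real (order G)"
  have b: "?b > 0" using assms(2) by (simp add: zero_less_binomial_iff)
  have "c' * (real (card (edit G H)) / ?n ^ 2) * ?b \<le> c' * (real (card (edit G H)) / ?n ^ 2) * ?n ^ k"
    using binomial_le_power[of "order G" k] assms(3) by (intro mult_left_mono) auto
  also have "\<dots> = c' * (?n ^ k / ?n ^ 2) * real (card (edit G H))" by simp
  also have "\<dots> \<le> \<Lambda> H - \<Lambda> G" by (rule assms(4))
  finally have "c' * (real (card (edit G H)) / ?n ^ 2) \<le> (\<Lambda> H - \<Lambda> G) / ?b"
    using b by (simp only: pos_le_divide_eq)
  then show ?thesis using assms(1) by (simp add: lam_def diff_divide_distrib)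
qed

lemma strict_imp_perfectly_stable:
  assumes sym: "symmetrisable k \<gamma>" and finO: "finite (OPT k \<gamma>)" and str: "strict_param k \<gamma>"
  shows "perfectly_stable k \<gamma>"
proof -
  let ?m = "lam_max k \<gamma>"
  obtain c where c: "c > 0" "\<And>x. x \<in> OPT k \<gamma> \<Longrightarrow> str1 k \<gamma> c x \<and> str2 k \<gamma> c x"
    using str unfolding strict_param_def by blast
  have OPT: "x \<in> partite_limits \<and> str1 k \<gamma> c x \<and> str2 k \<gamma> c x" if "x \<in> OPT k \<gamma>" for x
    using c(2)[OF that] that by (simp add: OPT_def)
  have fs: "finite (supp x)" if "x \<in> OPT k \<gamma>" for x
    using OPT[OF that] c(1) str1_finite_supp by blast
  obtain \<delta> c' N where loc0: "\<delta> > 0" "c' > 0" and loc: "\<And>x G. \<lbrakk>x \<in> OPT k \<gamma>; fin_graph G; order G > N; close_to \<delta> x G\<rbrakk> \<Longrightarrow>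
    \<exists>H. complete_partite H \<and> verts H = verts G \<and>
      \<Lambda> H - \<Lambda> G \<ge> c' * (real (order G) ^ k / real (order G) ^ 2) * real (card (edit G H))"
    using uniform_local_stability[OF sym c(1) finO OPT] by blast
  have d4: "\<delta> / 4 > 0" using loc0 by simp
  obtain \<epsilon>1 n1 where e1: "\<epsilon>1 > 0" and nearO: "\<And>H. \<lbrakk>complete_partite H; order H \<ge> n1; lam k \<gamma> H \<ge> ?m - \<epsilon>1\<rbrakk> \<Longrightarrow>
    \<exists>x\<in>OPT k \<gamma>. close_to (\<delta> / 4) x H"
    using complete_partite_near_OPT[OF fs d4] by blast
  \<comment> \<open>If \<open>lam\<close> is at least \<open>lam_max - \<epsilon>\<close> before a
    local improvement and at most \<open>lam_max + \<epsilon>\<close> after it, the improvement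
    edits at most \<open>2 * \<epsilon> / c' * n^2 \<le> \<delta> / 4 * n^2\<close> pairs.\<close>
  define \<epsilon> where "\<epsilon> = min \<epsilon>1 (c' * \<delta> / 8)"
  have \<epsilon>: "\<epsilon> > 0" "\<epsilon> \<le> \<epsilon>1" "\<epsilon> \<le> c' * \<delta> / 8" unfolding \<epsilon>_def using e1 loc0 by auto
  obtain n2 where upper: "\<And>H. \<lbrakk>complete_partite H; order H \<ge> n2\<rbrakk> \<Longrightarrow> lam k \<gamma> H \<le> ?m + \<epsilon>"
    using complete_partite_lam_upper[OF \<epsilon>(1)] by blast
  have "\<epsilon> / 2 > 0" using \<epsilon>(1) by simp
  from lam_ext_ge_lam_max[OF this] obtain n3 where lower: "\<And>n. n \<ge> n3 \<Longrightarrow> lam_ext k \<gamma> n \<ge> ?m - \<epsilon> / 2" by blast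
  have d2: "\<delta> / 2 > 0" using loc0 by simp
  obtain n4 where s1: "\<And>G. fin_graph G \<Longrightarrow> order G \<ge> n4 \<Longrightarrow> sym1 k \<gamma> (\<delta> / 2) G"
    using sym d2 unfolding symmetrisable_def by blast
  define N0 where "N0 = N + n1 + n2 + n3 + n4 + k + 1"
  have cpf: "fin_graph H" if "complete_partite H" for H
    using that by (auto simp: complete_partite_def complete_partite_on_def)
  have close_G: "\<exists>x\<in>OPT k \<gamma>. close_to \<delta> x G"
    if G: "fin_graph G" "order G \<ge> N0" "lam k \<gamma> G \<ge> ?m - \<epsilon>" for G
  proof -
    let ?n = "real (order G)"
    have n: "order G > N" "order G \<ge> n1" "order G \<ge> n2" "order G \<ge> n4" "order G \<ge> k" "?n > 0"
      using G(2) unfolding N0_def by linarith+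
    \<comment> \<open>Closeness \<open>\<delta>\<close> is halved: the improved graph is complete
      partite and nearly optimal, hence within \<open>\<delta> / 4\<close> of a possibly different
      optimal limit, and undoing the edits costs another \<open>\<delta> / 4\<close>. The half
      regained is what one step of the path may use up.\<close>
    have improve: "\<exists>x\<in>OPT k \<gamma>. close_to (\<delta> / 2) x K"
      if K: "fin_graph K" "verts K = verts G" "lam k \<gamma> K \<ge> ?m - \<epsilon>" and x: "x \<in> OPT k \<gamma>" "close_to \<delta> x K" for K x
    proof -
      have oK: "order K > N" using n(1) K(2) by simp
      obtain H where H: "complete_partite H" "verts H = verts K"
        "\<Lambda> H - \<Lambda> K \<ge> c' * (real (order K) ^ k / real (order K) ^ 2) * real (card (edit K H))"
        using loc[OF x(1) K(1) oK x(2)] by blast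
      have g: "c' * (real (card (edit K H)) / ?n ^ 2) \<le> lam k \<gamma> H - lam k \<gamma> K"
        using lam_gain[OF H(2) _ _ H(3)] n(5) K(2) loc0 by simp
      have up: "lam k \<gamma> H \<le> ?m + \<epsilon>" using H(1,2) K(2) n(3) by (intro upper) auto
      have "0 \<le> c' * (real (card (edit K H)) / ?n ^ 2)" using loc0 by simp
      then have "lam k \<gamma> H \<ge> ?m - \<epsilon>1" using g K(3) \<epsilon>(2) by linarith
      then obtain y where y: "y \<in> OPT k \<gamma>" "close_to (\<delta> / 4) y H"
        using nearO[OF H(1)] H(2) K(2) n(2) by auto
      have "c' * (real (card (edit K H)) / ?n ^ 2) \<le> c' * (\<delta> / 4)"
        using g up K(3) \<epsilon>(3) by linarith
      then have "real (card (edit K H)) / ?n ^ 2 \<le> \<delta> / 4" using loc0(2) by (rule mult_left_le_imp_le)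
      then have "real (card (edit K H)) \<le> \<delta> / 4 * real (order K) ^ 2"
        using n(6) K(2) by (simp add: pos_divide_le_eq)
      then have "close_to (\<delta> / 4 + \<delta> / 4) y K"
        using d4 by (intro close_to_edit[OF y(2) K(1) cpf[OF H(1)] H(2)]) auto
      then have "close_to (\<delta> / 2) y K" by (rule close_to_mono) simp
      then show ?thesis using y(1) by blast
    qed
    have s1G: "sym1 k \<gamma> (\<delta> / 2) G" by (rule s1[OF G(1) n(4)])
    obtain m :: nat and Gs :: "nat \<Rightarrow> graph" where path: "Gs 0 = G" "complete_partite (Gs m)"
      "\<forall>i\<le>m. fin_graph (Gs i) \<and> verts (Gs i) = verts G"
      "\<forall>i\<in>{1..m}. lam k \<gamma> (Gs (i - 1)) \<le> lam k \<gamma> (Gs i) \<and>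
         real (card (edit (Gs (i - 1)) (Gs i))) < \<delta> / 2 * real (order G choose 2)"
      using s1G[unfolded sym1_def]
      apply (elim exE conjE)
      subgoal premises p for m Gs by (rule that[of Gs m]; fact p)
      done
    have inc: "lam k \<gamma> (Gs i) \<ge> ?m - \<epsilon>" if "i \<le> m" for i
      using that
    proof (induction i)
      case (Suc i)
      then have "lam k \<gamma> (Gs i) \<le> lam k \<gamma> (Gs (Suc i))" using path(4)[THEN bspec, of "Suc i"] by simp
      then show ?case using Suc by simp
    qed (simp add: path(1) G(3))
    have g: "fin_graph (Gs i)" "verts (Gs i) = verts G" if "i \<le> m" for i using path(3) that by auto
    \<comment> \<open>Induction backwards from the complete partite end; the limit \<open>x\<close>
      may change from step to step.\<close>
    have "\<exists>x\<in>OPT k \<gamma>. close_to (\<delta> / 2) x (Gs (m - i))" if "i \<le> m" for i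
      using that
    proof (induction i)
      case 0
      have "lam k \<gamma> (Gs m) \<ge> ?m - \<epsilon>1" using inc[of m] \<epsilon>(2) by simp
      then obtain x where x: "x \<in> OPT k \<gamma>" "close_to (\<delta> / 4) x (Gs m)"
        using nearO[OF path(2)] g(2)[of m] n(2) by auto
      have "close_to (\<delta> / 2) x (Gs m)" by (rule close_to_mono[OF x(2)]) (use loc0 in simp)
      then show ?case using x(1) by auto
    next
      case (Suc i)
      define j where "j = m - Suc i"
      have j: "m - i = Suc j" "Suc j \<le> m" "j \<le> m" using Suc.prems by (auto simp: j_def)
      obtain x where x: "x \<in> OPT k \<gamma>" "close_to (\<delta> / 2) x (Gs (Suc j))"
        using Suc.IH Suc.prems unfolding j(1) by auto
      have "real (card (edit (Gs j) (Gs (Suc j)))) < \<delta> / 2 * real (order G choose 2)"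
        using path(4)[THEN bspec, of "Suc j"] j(2) by simp
      also have "\<dots> \<le> \<delta> / 2 * ?n ^ 2"
        using binomial_le_power[of "order G" 2] d2 by (intro mult_left_mono) auto
      finally have e: "real (card (edit (Gs j) (Gs (Suc j)))) \<le> \<delta> / 2 * real (order (Gs j)) ^ 2"
        using g(2)[OF j(3)] by simp
      have "close_to (\<delta> / 2 + \<delta> / 2) x (Gs j)"
        using g[OF j(2)] g[OF j(3)] d2 by (intro close_to_edit[OF x(2) _ _ _ e]) auto
      then have "close_to \<delta> x (Gs j)" by (rule close_to_mono) simp
      from improve[OF g[OF j(3)] inc[OF j(3)] x(1) this] show ?case unfolding j_def .
    qed
    from this[of m] obtain x where x: "x \<in> OPT k \<gamma>" "close_to (\<delta> / 2) x G" by (auto simp: path(1))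
    have "close_to \<delta> x G" by (rule close_to_mono[OF x(2)]) (use loc0 in simp)
    then show ?thesis using x(1) by blast
  qed
  \<comment> \<open>\<open>N0\<close> makes the order large, \<open>2 / c'\<close> is the factor
    from the local gain, and \<open>4 / \<epsilon>\<close> covers graphs whose value is not nearly
    optimal.\<close>
  define C where "C = real N0 + 2 / c' + 4 / \<epsilon>"
  have C: "C \<ge> real N0" "C \<ge> 2 / c'" "C \<ge> 4 / \<epsilon>" unfolding C_def using loc0 \<epsilon> by auto
  have C0: "C > 0" using C(2) loc0(2) by (simp add: less_le_trans[of 0 "2 / c'"])
  have "\<exists>H. complete_partite H \<and> order H = order G \<and> delta1 G H \<le> C * (lam_ext k \<gamma> (order G) - lam k \<gamma> G)"
    if G: "fin_graph G" "real (order G) \<ge> C" for G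
  proof -
    let ?n = "real (order G)" and ?d = "lam_ext k \<gamma> (order G) - lam k \<gamma> G"
    have oG: "order G \<ge> N0" using G(2) C(1) by linarith
    have n: "order G > N" "order G \<ge> n3" "order G \<ge> k" "?n > 0" using oG unfolding N0_def by linarith+
    have d0: "?d \<ge> 0" using lam_le_lam_ext[OF G(1) refl] by simp
    show ?thesis
    proof (cases "lam k \<gamma> G \<ge> ?m - \<epsilon>")
      case True
      obtain x where x: "x \<in> OPT k \<gamma>" "close_to \<delta> x G" using close_G[OF G(1) oG True] by blast
      obtain H where H: "complete_partite H" "verts H = verts G"
        "\<Lambda> H - \<Lambda> G \<ge> c' * (?n ^ k / ?n ^ 2) * real (card (edit G H))"
        using loc[OF x(1) G(1) n(1) x(2)] by blast
      have "c' * (real (card (edit G H)) / ?n ^ 2) \<le> lam k \<gamma> H - lam k \<gamma> G"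
        using lam_gain[OF H(2) n(3) _ H(3)] loc0 by simp
      moreover have "lam k \<gamma> H \<le> lam_ext k \<gamma> (order G)" using H(2) by (intro lam_le_lam_ext cpf H(1)) simp
      ultimately have "real (card (edit G H)) / ?n ^ 2 * c' \<le> ?d" by (simp add: mult.commute)
      then have q: "real (card (edit G H)) / ?n ^ 2 \<le> ?d / c'" using loc0(2) by (simp only: pos_le_divide_eq)
      have "delta1 G H \<le> 2 / ?n ^ 2 * real (card (edit G H))" by (rule delta1_le[OF G(1) cpf[OF H(1)] H(2)])
      also have "\<dots> = 2 * (real (card (edit G H)) / ?n ^ 2)" by simp
      also have "\<dots> \<le> 2 * (?d / c')" using q by (rule mult_left_mono) simp
      also have "\<dots> = 2 / c' * ?d" by simp
      also have "\<dots> \<le> C * ?d" using C(2) d0 by (rule mult_right_mono)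
      finally show ?thesis using H(1,2) by (intro exI[of _ H]) auto
    next
      case False
      have fV: "finite (verts G)" using G(1) by (simp add: fin_graph_def)
      \<comment> \<open>Any complete partite graph serves, here the complete graph: the normalised
        distance is at most \<open>2\<close>, while the deficit is at least
        \<open>\<epsilon> / 2\<close>.\<close>
      let ?H = "pg (verts G) (\<lambda>_. 0)"
      have "?d \<ge> \<epsilon> / 2" using lower[OF n(2)] False by linarith
      then have "4 / \<epsilon> * (\<epsilon> / 2) \<le> C * ?d" using C(3) \<epsilon>(1) C0 by (intro mult_mono) auto
      then have two: "2 \<le> C * ?d" using \<epsilon>(1) by simp
      have "delta1 G ?H \<le> 2 / ?n ^ 2 * real (card (edit G ?H))"
        by (rule delta1_le[OF G(1) fin_graph_pg[OF fV]]) simp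
      also have "\<dots> \<le> 2 / ?n ^ 2 * ?n ^ 2"
        using card_edit_le[OF G(1) fin_graph_pg[OF fV, of "\<lambda>_. 0"]] by (intro mult_left_mono) auto
      also have "\<dots> = 2" using n(4) by simp
      finally have "delta1 G ?H \<le> C * ?d" using two by linarith
      then show ?thesis using complete_partite_pg[OF fV, of "\<lambda>_. 0"] by (intro exI[of _ ?H]) auto
    qed
  qed
  then show ?thesis unfolding perfectly_stable_def using C0 by blast
qed

end

theorem theorem3p5:
  fixes k :: nat and \<gamma> :: "graph \<Rightarrow> real"
  assumes "k \<ge> 1"
    and "iso_invariant k \<gamma>"
    and "symmetrisable k \<gamma>"
    and "finite (OPT k \<gamma>)"
    and "strict_param k \<gamma>"
  shows "perfectly_stable k \<gamma>"
proof -
  obtain B where "B > 0" "\<And>G. fin_graph G \<Longrightarrow> order G = k \<Longrightarrow> \<bar>\<gamma> G\<bar> \<le> B"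
    using gamma_bounded[OF assms(2)] by blast
  then interpret graph_param k \<gamma> B
    by unfold_locales (use assms(1,2) in auto)
  show ?thesis by (rule strict_imp_perfectly_stable[OF assms(3-5)])
qed

end
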